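(* Let $\mathcal G$ be a Gerstenhaber algebra and $\mathcal H=\underline\bigotimes^+(\mathcal G[1])$. On $S^+(\mathcal H[1])$, the degree $1$ map $\ell$ and the cobracket $\kappa$ defined in the context satisfy $$(id\otimes \ell+\ell\otimes id)\circ\kappa=-\kappa\circ \ell .$$
   Context: Vector spaces are $\mathbb Z$-graded over a field of characteristic $0$. A Gerstenhaber algebra is a graded vector space $\mathcal G$ with an associative product $\wedge$ of degree $0$, $\alpha\wedge\beta=(-1)^{|\alpha||\beta|}\beta\wedge\alpha$, and a bracket $[\ ,\ ]$ of degree $-1$ such that $(\mathcal G[1],[\ ,\ ])$ is a graded Lie algebra and $[\alpha,\beta\wedge\gamma]=[\alpha,\beta]\wedge\gamma+(-1)^{|\beta|(|\alpha|-1)}\beta\wedge[\alpha,\gamma]$. $V[1]$ is $V$ with degrees lowered by $1$. Koszul rule: exchanging adjacent elements of degrees $x,y$ costs $(-1)^{xy}$; $\varepsilon\binom{\dots}{\dots}$ denotes the resulting sign of a permutation of graded elements; $(f\otimes g)(u\otimes v)=(-1)^{|g||u|}f(u)\otimes g(v)$. For $\alpha_i\in\mathcal G[1]$ of degree $a_i=|\alpha_i|-1$: $Bat(p,q)$ is the set of permutations $\sigma$ of $\{1,\dots,p+q\}$ with $\sigma(1)<\dots<\sigma(p)$, $\sigma(p+1)<\dots<\sigma(p+q)$; $bat_{p,q}(\alpha_1\otimes\dots\otimes\alpha_p,\alpha_{p+1}\otimes\dots\otimes\alpha_{p+q})=\sum_{\sigma\in Bat(p,q)}\varepsilon\binom{a_1\dots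 a_{p+q}}{a_{\sigma^{-1}(1)}\dots a_{\sigma^{-1}(p+q)}}\alpha_{\sigma^{-1}(1)}\otimes\dots\otimes\alpha_{\sigma^{-1}(p+q)}$. $\underline\bigotimes^n(\mathcal G[1])$ is the quotient of $(\mathcal G[1])^{\otimes n}$ by the sum of the images of $bat_{p,n-p}$ ($0<p<n$), with classes written $\alpha_1\underline\otimes\dots\underline\otimes\alpha_n$; $\mathcal H=\bigoplus_{n\ge1}\underline\bigotimes^n(\mathcal G[1])$. In $\mathcal H[1]$ the element $X=\alpha_1\underline\otimes\dots\underline\otimes\alpha_p$ has degree $x=a_1+\dots+a_p-1$. $S^+(\mathcal H[1])$ is the graded symmetric algebra without unit; its product is denoted by a dot, and $X_I=X_{i_1}\cdot\ldots\cdot X_{i_k}$ for $I=\{i_1<\dots<i_k\}$, with degree $x_I$ ($X_\emptyset$ is omitted). The bracket of $\mathcal H$ is $$[\alpha_1\underline\otimes\dots\underline\otimes\alpha_p,\alpha_{p+1}\underline\otimes\dots\underline\otimes\alpha_{p+q}]=\sum_{\sigma,k}\varepsilon\binom{a_1\dots a_{p+q}}{a_{\sigma^{-1}(1)}\dots a_{\sigma^{-1}(p+q)}}\alpha_{\sigma^{-1}(1)}\underline\otimes\dots\underline\otimes[\alpha_{\sigma^{-1}(k)},\alpha_{\sigma^{-1}(k+1)}]\underline\otimes\dots\underline\otimes\alpha_{\sigma^{-1}(p+q)},$$ sum over $\sigma\in Bat(p,q)$ and $k$ with $\sigma^{-1}(k)\le p<\sigma^{-1}(k+1)$ (well defined on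 $\mathcal H$). Put $\ell_2(X,Y)=(-1)^x[X,Y]$ and $$\ell(X_1\cdot\ldots\cdot X_n)=\sum_{i<j}\varepsilon\binom{x_1\dots x_n}{x_ix_jx_1\dots\hat\imath\dots\hat\jmath\dots x_n}\ell_2(X_i,X_j)\cdot X_1\cdot\ldots\hat\imath\ldots\hat\jmath\ldots\cdot X_n.$$ Writing $X_s=\alpha_1\underline\otimes\dots\underline\otimes\alpha_p$, the sum "over $U_s\underline\otimes V_s=X_s$" means the sum over $0<j<p$ with $U_s=\alpha_1\underline\otimes\dots\underline\otimes\alpha_j$, $V_s=\alpha_{j+1}\underline\otimes\dots\underline\otimes\alpha_p$, of degrees $u_s=a_1+\dots+a_j-1$, $v_s=a_{j+1}+\dots+a_p-1$ in $\mathcal H[1]$. Then $$\begin{aligned}\kappa(X_1\cdot\ldots\cdot X_n)=\sum_{\substack{1\le s\le n\\ I\sqcup J=\{1,\dots,n\}\setminus\{s\}}}(-1)^{\sum_{i<s}x_i}\sum_{U_s\underline\otimes V_s=X_s}(-1)^{u_s+1}\Big(&\varepsilon\tbinom{x_1\dots u_s v_s\dots x_n}{x_I\,u_s\,v_s\,x_J}X_I\cdot U_s\otimes V_s\cdot X_J\\&+\varepsilon\tbinom{x_1\dots u_s v_s\dots x_n}{x_I\,v_s\,u_s\,x_J}X_I\cdot V_s\otimes U_s\cdot X_J\Big),\end{aligned}$$ where $I$ or $J$ may be empty and in the signs $x_s$ is replaced by the pair $u_s,v_s$ in the initial order. $\kappa$ is well defined, of degree $1$. *)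

theory Defs
  imports Complex_Main "HOL-Library.Poly_Mapping" "HOL-Combinatorics.Permutations"
begin

section \<open>Gerstenhaber algebras\<close>

locale graded_vector_space = vector_space scale
  for scale :: "'k::field \<Rightarrow> 'g::ab_group_add \<Rightarrow> 'g" +
  fixes gr :: "int \<Rightarrow> 'g set"
  assumes subspace_gr: "subspace (gr d)"
    and direct_sum: "\<exists>!f. (\<forall>d. f d \<in> gr d) \<and> finite {d. f d \<noteq> 0} \<and> x = (\<Sum>d | f d \<noteq> 0. f d)"

text \<open>The degree of a homogeneous element of the algebra is its unshifted degree; on the
  shifted space the bracket has degree 0, whence the exponents \<open>m - 1\<close>, \<open>n - 1\<close> below.\<close>

locale gerstenhaber_algebra = graded_vector_space scale gr
  for scale :: "'k::field_char_0 \<Rightarrow> 'g::ab_group_add \<Rightarrow> 'g" and gr :: "int \<Rightarrow> 'g set" +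
  fixes wedge :: "'g \<Rightarrow> 'g \<Rightarrow> 'g" and brk :: "'g \<Rightarrow> 'g \<Rightarrow> 'g"
  assumes wedge_linear_right: "Vector_Spaces.linear scale scale (wedge x)"
    and wedge_linear_left: "Vector_Spaces.linear scale scale (\<lambda>x. wedge x y)"
    and wedge_degree: "\<lbrakk>x \<in> gr m; y \<in> gr n\<rbrakk> \<Longrightarrow> wedge x y \<in> gr (m + n)"
    and wedge_assoc: "wedge (wedge x y) z = wedge x (wedge y z)"
    and wedge_commute: "\<lbrakk>x \<in> gr m; y \<in> gr n\<rbrakk> \<Longrightarrow> wedge x y = scale ((-1) powi (m * n)) (wedge y x)"
    and brk_linear_right: "Vector_Spaces.linear scale scale (brk x)"
    and brk_linear_left: "Vector_Spaces.linear scale scale (\<lambda>x. brk x y)"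
    and brk_degree: "\<lbrakk>x \<in> gr m; y \<in> gr n\<rbrakk> \<Longrightarrow> brk x y \<in> gr (m + n - 1)"
    and brk_antisym: "\<lbrakk>x \<in> gr m; y \<in> gr n\<rbrakk> \<Longrightarrow>
          brk x y = - scale ((-1) powi ((m - 1) * (n - 1))) (brk y x)"
    and brk_jacobi: "\<lbrakk>x \<in> gr m; y \<in> gr n; z \<in> gr l\<rbrakk> \<Longrightarrow>
          brk x (brk y z) = brk (brk x y) z + scale ((-1) powi ((m - 1) * (n - 1))) (brk y (brk x z))"
    and brk_leibniz: "\<lbrakk>x \<in> gr m; y \<in> gr n; z \<in> gr l\<rbrakk> \<Longrightarrow>
          brk x (wedge y z) = wedge (brk x y) z + scale ((-1) powi (n * (m - 1))) (wedge y (brk x z))"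

section \<open>Graded spaces given by generators and relations\<close>

text \<open>The spaces constructed below are quotients, whose elements are cosets; a graded space is
  therefore a carrier with explicit operations and homogeneous components.\<close>

record ('k, 'v) gspace =
  gcarrier :: "'v set"
  comp :: "int \<Rightarrow> 'v set"
  gadd :: "'v \<Rightarrow> 'v \<Rightarrow> 'v"
  gscale :: "'k \<Rightarrow> 'v \<Rightarrow> 'v"

definition gspace_of :: "('k \<Rightarrow> 'g::ab_group_add \<Rightarrow> 'g) \<Rightarrow> (int \<Rightarrow> 'g set) \<Rightarrow> ('k, 'g) gspace" where
  "gspace_of scale gr = \<lparr>gcarrier = UNIV, comp = gr, gadd = (+), gscale = scale\<rparr>"

text \<open>\<open>V[1]\<close>: an element of degree \<open>d + 1\<close> in \<open>V\<close> has degree \<open>d\<close> in \<open>V[1]\<close>.\<close>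

definition gshift :: "('k, 'v) gspace \<Rightarrow> ('k, 'v) gspace" where
  "gshift V = V\<lparr>comp := \<lambda>d. comp V (d + 1)\<rparr>"

definition glinear :: "('k, 'v) gspace \<Rightarrow> ('k, 'w) gspace \<Rightarrow> ('v \<Rightarrow> 'w) \<Rightarrow> bool" where
  "glinear V W f \<longleftrightarrow>
     (\<forall>x\<in>gcarrier V. f x \<in> gcarrier W) \<and>
     (\<forall>x\<in>gcarrier V. \<forall>y\<in>gcarrier V. f (gadd V x y) = gadd W (f x) (f y)) \<and>
     (\<forall>c. \<forall>x\<in>gcarrier V. f (gscale V c x) = gscale W c (f x))"

text \<open>A letter is a homogeneous element tagged with its degree. The tag is needed because
  \<open>0\<close> is homogeneous of every degree; any word containing \<open>0\<close> becomes \<open>0\<close> by multilinearity,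
  whatever its tag. A word \<open>[(a\<^sub>1, \<alpha>\<^sub>1), \<dots>, (a\<^sub>n, \<alpha>\<^sub>n)]\<close> stands for a product
  \<open>\<alpha>\<^sub>1 \<otimes> \<dots> \<otimes> \<alpha>\<^sub>n\<close>.\<close>

type_synonym 'v letter = "int \<times> 'v"
type_synonym ('k, 'v) formal = "'v letter list \<Rightarrow>\<^sub>0 'k"

definition words :: "('k, 'v) gspace \<Rightarrow> 'v letter list set" where
  "words V = {w. w \<noteq> [] \<and> (\<forall>(d, x)\<in>set w. x \<in> comp V d)}"

definition wdeg :: "'v letter list \<Rightarrow> int" where
  "wdeg w = sum_list (map fst w)"

definition fscale :: "'k::field \<Rightarrow> ('a \<Rightarrow>\<^sub>0 'k) \<Rightarrow> ('a \<Rightarrow>\<^sub>0 'k)" where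
  "fscale c p = Poly_Mapping.map ((*) c) p"

lemma lookup_fscale [simp]: "Poly_Mapping.lookup (fscale c p) w = c * Poly_Mapping.lookup p w"
  by (cases "Poly_Mapping.lookup p w = 0") (simp_all add: fscale_def map.rep_eq when_def)

global_interpretation free: vector_space "fscale :: 'k::field \<Rightarrow> ('a \<Rightarrow>\<^sub>0 'k) \<Rightarrow> ('a \<Rightarrow>\<^sub>0 'k)"
  by standard (auto intro!: poly_mapping_eqI simp: lookup_add algebra_simps)

text \<open>The class of \<open>p\<close> in the quotient of the free vector space by the span of \<open>E\<close>.\<close>

definition tcls :: "('k::field, 'v) formal set \<Rightarrow> ('k, 'v) formal \<Rightarrow> ('k, 'v) formal set" where
  "tcls E p = {q. q - p \<in> free.span E}"

definition gquot :: "'v letter list set \<Rightarrow> ('k::field, 'v) formal set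
    \<Rightarrow> ('k, ('k, 'v) formal set) gspace" where
  "gquot A E =
     \<lparr>gcarrier = {tcls E p |p. Poly_Mapping.keys p \<subseteq> A},
      comp = (\<lambda>d. {tcls E p |p. Poly_Mapping.keys p \<subseteq> {w \<in> A. wdeg w = d}}),
      gadd = (\<lambda>C D. {p + q |p q. p \<in> C \<and> q \<in> D}),
      gscale = (\<lambda>c C. \<Union>p\<in>C. tcls E (fscale c p))\<rparr>"

text \<open>Multilinearity. The quotient of the free space on the words of length \<open>n\<close> by these
  relations is \<open>V\<^bsup>\<otimes>n\<^esup>\<close>.\<close>

definition ml_rels :: "('k::field, 'v) gspace \<Rightarrow> 'v letter list set \<Rightarrow> ('k, 'v) formal set" where
  "ml_rels V A =
     {Poly_Mapping.single (u @ (d, gadd V x y) # v) 1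
        - Poly_Mapping.single (u @ (d, x) # v) 1 - Poly_Mapping.single (u @ (d, y) # v) 1
      |u v d x y. x \<in> comp V d \<and> y \<in> comp V d \<and> u @ (d, x) # v \<in> A} \<union>
     {Poly_Mapping.single (u @ (d, gscale V c x) # v) 1 - Poly_Mapping.single (u @ (d, x) # v) c
      |u v d c x. x \<in> comp V d \<and> u @ (d, x) # v \<in> A}"

section \<open>Koszul signs and shuffles\<close>

text \<open>For distinct indices \<open>i\<^sub>1, \<dots>, i\<^sub>n\<close> in \<open>is\<close>, this is the sign of passing from the
  elements (of degrees \<open>d i\<close>) in increasing order of the index to the order
  \<open>i\<^sub>1, \<dots>, i\<^sub>n\<close>: every pair whose order is reversed contributes one exchange.\<close>

fun ksign :: "(nat \<Rightarrow> int) \<Rightarrow> nat list \<Rightarrow> 'k::field" where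
  "ksign d [] = 1"
| "ksign d (i # is) = (\<Prod>j\<leftarrow>filter (\<lambda>j. j < i) is. (-1) powi (d i * d j)) * ksign d is"

text \<open>Indices start at \<open>0\<close>: these are permutations of \<open>{0, \<dots>, p + q - 1}\<close>.\<close>

definition Bat :: "nat \<Rightarrow> nat \<Rightarrow> (nat \<Rightarrow> nat) set" where
  "Bat p q = {\<sigma>. \<sigma> permutes {..<p + q} \<and> strict_mono_on {..<p} \<sigma> \<and> strict_mono_on {p..<p + q} \<sigma>}"

definition bat_sign :: "(nat \<Rightarrow> nat) \<Rightarrow> 'v letter list \<Rightarrow> 'k::field" where
  "bat_sign \<sigma> w = ksign (\<lambda>i. fst (w ! i)) (map (inv \<sigma>) [0..<length w])"

text \<open>\<open>bat p (v @ w)\<close> is \<open>bat\<^bsub>p,q\<^esub>(v, w)\<close> for \<open>p = length v\<close>, \<open>q = length w\<close>. Here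
  \<open>permute_list (inv \<sigma>) w\<close> is the word with letter \<open>w ! inv \<sigma> k\<close> at position \<open>k\<close>.\<close>

definition bat :: "nat \<Rightarrow> 'v letter list \<Rightarrow> ('k::field, 'v) formal" where
  "bat p w = (\<Sum>\<sigma>\<in>Bat p (length w - p).
     Poly_Mapping.single (permute_list (inv \<sigma>) w) (bat_sign \<sigma> w))"

section \<open>The space \<open>\<H>\<close> and its bracket\<close>

text \<open>In this section \<open>V\<close> is the shifted space \<open>\<G>[1]\<close>. The relations preserve the length of
  words, so the quotient is the direct sum over \<open>n \<ge> 1\<close> of the quotients of \<open>V\<^bsup>\<otimes>n\<^esup>\<close> by
  the images of the \<open>bat\<^bsub>p,n-p\<^esub>\<close>.\<close>

definition Hrel :: "('k::field, 'v) gspace \<Rightarrow> ('k, 'v) formal set" where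
  "Hrel V = ml_rels V (words V) \<union> {bat p w |p w. w \<in> words V \<and> 0 < p \<and> p < length w}"

definition Hspace :: "('k::field, 'v) gspace \<Rightarrow> ('k, ('k, 'v) formal set) gspace" where
  "Hspace V = gquot (words V) (Hrel V)"

definition hcls :: "('k::field, 'v) gspace \<Rightarrow> 'v letter list \<Rightarrow> ('k, 'v) formal set" where
  "hcls V w = tcls (Hrel V) (Poly_Mapping.single w 1)"

definition bracket_word :: "('v \<Rightarrow> 'v \<Rightarrow> 'v) \<Rightarrow> 'v letter list \<Rightarrow> 'v letter list
    \<Rightarrow> ('k::field, 'v) formal" where
  "bracket_word brk v w =
     (let p = length v; q = length w in
      \<Sum>\<sigma>\<in>Bat p q. \<Sum>k | Suc k < p + q \<and> inv \<sigma> k < p \<and> p \<le> inv \<sigma> (Suc k).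
        let u = permute_list (inv \<sigma>) (v @ w) in
        Poly_Mapping.single
          (take k u
            @ (fst (u ! k) + fst (u ! Suc k), brk (snd (u ! k)) (snd (u ! Suc k)))
            # drop (k + 2) u)
          (bat_sign \<sigma> (v @ w)))"

text \<open>The bracket of \<open>\<H>\<close> is the bilinear map with the prescribed values on the classes of words.
  As these classes span, the choice is unique on the carrier; the same applies to the linear maps
  chosen below.\<close>

definition Hbracket :: "('k::field, 'v) gspace \<Rightarrow> ('v \<Rightarrow> 'v \<Rightarrow> 'v)
    \<Rightarrow> ('k, 'v) formal set \<Rightarrow> ('k, 'v) formal set \<Rightarrow> ('k, 'v) formal set" where
  "Hbracket V brk = (SOME b.
     (\<forall>X\<in>gcarrier (Hspace V). glinear (Hspace V) (Hspace V) (b X)) \<and>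
     (\<forall>Y\<in>gcarrier (Hspace V). glinear (Hspace V) (Hspace V) (\<lambda>X. b X Y)) \<and>
     (\<forall>v\<in>words V. \<forall>w\<in>words V. b (hcls V v) (hcls V w) = tcls (Hrel V) (bracket_word brk v w)))"

section \<open>Symmetric algebra without unit and tensor square\<close>

definition Srel :: "('k::field, 'v) gspace \<Rightarrow> ('k, 'v) formal set" where
  "Srel V = ml_rels V (words V) \<union>
     {Poly_Mapping.single (u @ [a, b] @ v) 1
        - Poly_Mapping.single (u @ [b, a] @ v) ((-1) powi (fst a * fst b))
      |u v a b. u @ [a, b] @ v \<in> words V}"

definition Splus :: "('k::field, 'v) gspace \<Rightarrow> ('k, ('k, 'v) formal set) gspace" where
  "Splus V = gquot (words V) (Srel V)"

definition scls :: "('k::field, 'v) gspace \<Rightarrow> 'v letter list \<Rightarrow> ('k, 'v) formal set" where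
  "scls V xs = tcls (Srel V) (Poly_Mapping.single xs 1)"

definition sletter :: "('k::field, 'v) gspace \<Rightarrow> 'v letter list \<Rightarrow> ('k, 'v) formal set letter" where
  "sletter V xs = (wdeg xs, scls V xs)"

definition words2 :: "('k, 'v) gspace \<Rightarrow> 'v letter list set" where
  "words2 V = {w \<in> words V. length w = 2}"

definition T2rel :: "('k::field, 'v) gspace \<Rightarrow> ('k, 'v) formal set" where
  "T2rel V = ml_rels V (words2 V)"

definition tensor2 :: "('k::field, 'v) gspace \<Rightarrow> ('k, ('k, 'v) formal set) gspace" where
  "tensor2 V = gquot (words2 V) (T2rel V)"

text \<open>\<open>f \<otimes> g\<close> on \<open>V \<otimes> V\<close> for endomorphisms \<open>f\<close>, \<open>g\<close> of degrees \<open>m\<close>, \<open>n\<close>.\<close>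

definition tensor_map :: "('k::field, 'v) gspace \<Rightarrow> int \<Rightarrow> ('v \<Rightarrow> 'v) \<Rightarrow> int \<Rightarrow> ('v \<Rightarrow> 'v)
    \<Rightarrow> ('k, 'v) formal set \<Rightarrow> ('k, 'v) formal set" where
  "tensor_map V m f n g = (SOME h. glinear (tensor2 V) (tensor2 V) h \<and>
     (\<forall>x y u v. u \<in> comp V x \<and> v \<in> comp V y \<longrightarrow>
        h (tcls (T2rel V) (Poly_Mapping.single [(x, u), (y, v)] 1)) =
        tcls (T2rel V) (Poly_Mapping.single [(x + m, f u), (y + n, g v)] ((-1) powi (n * x)))))"

section \<open>The maps \<open>\<ell>\<close> and \<open>\<kappa>\<close>\<close>

text \<open>Again \<open>V\<close> is \<open>\<G>[1]\<close>. The letters of \<open>S\<^sup>+(\<H>[1])\<close> carry their degree in \<open>\<H>[1]\<close>.\<close>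

abbreviation SH :: "('k::field, 'v) gspace \<Rightarrow> ('k, ('k, ('k, 'v) formal set) formal set) gspace" where
  "SH V \<equiv> Splus (gshift (Hspace V))"

definition hletter :: "('k::field, 'v) gspace \<Rightarrow> 'v letter list \<Rightarrow> ('k, 'v) formal set letter" where
  "hletter V w = (wdeg w - 1, hcls V w)"

definition ell2 :: "('k::field, 'v) gspace \<Rightarrow> ('v \<Rightarrow> 'v \<Rightarrow> 'v)
    \<Rightarrow> ('k, 'v) formal set letter \<Rightarrow> ('k, 'v) formal set letter \<Rightarrow> ('k, 'v) formal set letter" where
  "ell2 V brk X Y =
     (fst X + fst Y + 1, gscale (Hspace V) ((-1) powi fst X) (Hbracket V brk (snd X) (snd Y)))"

definition ell_word :: "('k::field, 'v) gspace \<Rightarrow> ('v \<Rightarrow> 'v \<Rightarrow> 'v)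
    \<Rightarrow> ('k, 'v) formal set letter list \<Rightarrow> ('k, ('k, 'v) formal set) formal" where
  "ell_word V brk Xs =
     (\<Sum>j<length Xs. \<Sum>i<j.
        let rest = filter (\<lambda>m. m \<noteq> i \<and> m \<noteq> j) [0..<length Xs] in
        Poly_Mapping.single (ell2 V brk (Xs ! i) (Xs ! j) # map ((!) Xs) rest)
          (ksign (\<lambda>m. fst (Xs ! m)) (i # j # rest)))"

definition ell :: "('k::field, 'v) gspace \<Rightarrow> ('v \<Rightarrow> 'v \<Rightarrow> 'v)
    \<Rightarrow> ('k, ('k, 'v) formal set) formal set \<Rightarrow> ('k, ('k, 'v) formal set) formal set" where
  "ell V brk = (SOME f. glinear (SH V) (SH V) f \<and>
     (\<forall>Xs\<in>words (gshift (Hspace V)).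
        f (scls (gshift (Hspace V)) Xs) = tcls (Srel (gshift (Hspace V))) (ell_word V brk Xs)))"

text \<open>\<open>ws\<close> lists the words representing \<open>X\<^sub>1, \<dots>, X\<^sub>n\<close>, and \<open>Z\<close> is the list
  \<open>X\<^sub>1, \<dots>, U\<^sub>s, V\<^sub>s, \<dots>, X\<^sub>n\<close>, so that \<open>U\<^sub>s\<close> and \<open>V\<^sub>s\<close> sit at positions \<open>s\<close> and \<open>s + 1\<close>. The
  sets \<open>I\<close> and \<open>J\<close> are taken as sets of positions in \<open>Z\<close>: an index \<open>i > s\<close> occurs as \<open>i + 1\<close>.\<close>

definition kappa_word :: "('k::field, 'v) gspace \<Rightarrow> 'v letter list list
    \<Rightarrow> ('k, ('k, ('k, 'v) formal set) formal set) formal" where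
  "kappa_word V ws =
     (\<Sum>s<length ws. \<Sum>I\<in>Pow ({..length ws} - {s, Suc s}). \<Sum>j\<in>{0<..<length (ws ! s)}.
        let Z = map (hletter V) (take s ws @ [take j (ws ! s), drop j (ws ! s)] @ drop (Suc s) ws);
            d = (\<lambda>i. fst (Z ! i));
            Is = sorted_list_of_set I;
            Js = sorted_list_of_set ({..length ws} - {s, Suc s} - I);
            M = (\<lambda>is. sletter (gshift (Hspace V)) (map ((!) Z) is));
            c = (-1) powi (\<Sum>i<s. d i) * (-1) powi (d s + 1)
        in Poly_Mapping.single [M (Is @ [s]), M (Suc s # Js)] (c * ksign d (Is @ [s, Suc s] @ Js))
         + Poly_Mapping.single [M (Is @ [Suc s]), M (s # Js)] (c * ksign d (Is @ [Suc s, s] @ Js)))"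

definition kappa :: "('k::field, 'v) gspace
    \<Rightarrow> ('k, ('k, 'v) formal set) formal set
    \<Rightarrow> ('k, ('k, ('k, 'v) formal set) formal set) formal set" where
  "kappa V = (SOME f. glinear (SH V) (tensor2 (SH V)) f \<and>
     (\<forall>ws. ws \<noteq> [] \<and> set ws \<subseteq> words V \<longrightarrow>
        f (scls (gshift (Hspace V)) (map (hletter V) ws)) = tcls (T2rel (SH V)) (kappa_word V ws)))"

end

theory Submission
  imports Defs
begin

text \<open>By linear algebra, elements of a quotient of a free space coincide once all functionals
  that vanish on the relations agree on them. Maps are therefore replaced by their transposes acting
  on functionals of words, and both sides become scalars. The coproduct \<open>X\<^sub>1 \<cdot> \<dots> \<cdot> X\<^sub>n \<mapsto> \<Sum> \<plusminus> X\<^sub>I \<otimes> X\<^sub>J\<close>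
  intertwines \<open>\<ell>\<close> with \<open>\<ell> \<otimes> id + id \<otimes> \<ell>\<close>, and \<open>\<kappa>\<close> is this coproduct with one factor \<open>X\<^sub>s\<close>
  replaced by its symmetrized deconcatenation \<open>\<delta>(X\<^sub>s)\<close>. By induction on the number of factors all
  terms cancel except those in which \<open>\<ell>\<^sub>2\<close> and \<open>\<delta>\<close> meet, so that the claim reduces to the compatibility
  of \<open>\<delta>([X, Y])\<close> with \<open>[\<delta>(X), Y]\<close> and \<open>[X, \<delta>(Y)]\<close>. Deconcatenating a shuffle product gives shuffle
  products of the pieces, with the bracketed letter in one of them; a piece that is a
  proper shuffle product vanishes in the quotient, and what survives are exactly these two terms.\<close>

section \<open>Coderivations on functionals of lists\<close>

text \<open>All maps in the definitions are selected by \<open>SOME\<close>, so the bracket, \<ell>,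
  \<kappa> and the two tensor maps must first be shown to exist. The same functionals serve for
  this: a map given on words descends to the quotients once its transpose carries functionals
  respecting the target relations to functionals respecting the source relations. The transposes are
  defined by recursion on the first letter, which turns the sums over permutations, pairs and
  subsets into inductions; the closed formulas are matched separately. Symmetrizing \<delta> is
  forced by well-definedness: the plain deconcatenation of a shuffle of v and w leaves v \<otimes> w
  and \<plusminus> w \<otimes> v, and only a symmetric functional makes these cancel. A further
  obstacle is that quotients are nested. A letter of S^+(H[1]) is the class of a homogeneous
  combination of words, while \<kappa> is prescribed on classes of single words. The combinatorial
  identity is therefore proved for lists of words and carried to arbitrary letters by
  multilinearity.\<close>

definition sg :: "int \<Rightarrow> 'k::field" where
  "sg n = (if even n then 1 else -1)"

text \<open>Sign identities are settled throughout by splitting on the parity of the degrees: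
  \<open>sg\<close> unfolds to a conditional on \<open>even\<close>, which the simplifier can
  evaluate.\<close>

lemma powi_eq_sg: "(-1) powi n = (sg n :: 'k::field)"
  by (simp add: power_int_minus_left sg_def)

lemma sg_0 [simp]: "sg 0 = 1"
  by (simp add: sg_def)

lemma sg_add: "sg (m + n) = sg m * (sg n :: 'k::field)"
  by (simp add: sg_def)

text \<open>Operations are given by their transposes: \<open>B \<chi> X Y\<close> stands for \<open>\<chi> (\<ell>\<^sub>2(X, Y))\<close>, \<open>ad X \<psi> L\<close> for the
  value of \<open>\<psi>\<close> on the terms of \<open>\<ell>(X \<cdot> L)\<close> that involve \<open>X\<close> in \<open>\<ell>\<^sub>2\<close>, \<open>el \<psi> L\<close> for \<open>\<psi> (\<ell>(L))\<close>, and \<open>cop \<phi> L\<close>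
  and \<open>kap \<phi> L\<close> for \<open>\<phi>\<close> on the coproduct and on \<open>\<kappa>(L)\<close>. \<open>AD X\<close> and \<open>LL\<close> are the extensions of \<open>ad X\<close> and
  \<open>el\<close> to the tensor square, and \<open>dd X\<close> multiplies by \<open>X \<otimes> 1 + 1 \<otimes> X\<close>.\<close>

locale brace =
  fixes dg :: "'x \<Rightarrow> int"
    and B :: "('x \<Rightarrow> 'k::field) \<Rightarrow> 'x \<Rightarrow> 'x \<Rightarrow> 'k"
    and ok :: "'x \<Rightarrow> bool"
  assumes B_add: "B (\<lambda>Z. f Z + g Z) X Y = B f X Y + B g X Y"
    and B_mult: "B (\<lambda>Z. c * f Z) X Y = c * B f X Y"
    and B_cong: "(\<And>Z. dg Z = dg X + dg Y + 1 \<Longrightarrow> f Z = g Z) \<Longrightarrow> B f X Y = B g X Y"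
    and B_cong_ok: "\<lbrakk>ok X; ok Y; \<And>Z. \<lbrakk>ok Z; dg Z = dg X + dg Y + 1\<rbrakk> \<Longrightarrow> f Z = g Z\<rbrakk>
      \<Longrightarrow> B f X Y = B g X Y"
begin

lemma B_zero: "B (\<lambda>Z. 0) X Y = 0"
  using B_mult[of 0 "\<lambda>_. 0"] by simp

lemma B_sum_list: "B (\<lambda>Z. \<Sum>i\<leftarrow>l. f i Z) X Y = (\<Sum>i\<leftarrow>l. B (f i) X Y)"
  by (induction l) (simp_all add: B_zero B_add)

text \<open>A functional evaluated on \<open>\<ell>\<^sub>2(X, Y)\<close> meets only arguments of
  degree \<open>dg X + dg Y + 1\<close> (this is \<open>B_cong\<close>), so a sign depending on the
  degree of the argument is a constant.\<close>

lemma B_sg: "B (\<lambda>Z. sg (dg Z * c) * f Z) X Y = sg ((dg X + dg Y + 1) * c) * B f X Y"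
  by (subst B_mult[symmetric], rule B_cong) simp

definition dgs :: "'x list \<Rightarrow> int" where
  "dgs L = sum_list (map dg L)"

lemma dgs_simps [simp]: "dgs [] = 0" "dgs (X # L) = dg X + dgs L" "dgs (L @ L') = dgs L + dgs L'"
  by (simp_all add: dgs_def)

text \<open>The new letter takes the place of \<open>Y\<close>, whereas \<open>ell_word\<close> puts
  it in front; the local form suits induction, and both agree on graded symmetric functionals
  (\<open>sterm1_sum\<close>). The operator has degree \<open>dg X + 1\<close>, whence the sign for
  passing \<open>Y\<close>.\<close>

primrec ad :: "'x \<Rightarrow> ('x list \<Rightarrow> 'k) \<Rightarrow> 'x list \<Rightarrow> 'k" where
  "ad X \<psi> [] = 0"
| "ad X \<psi> (Y # L) = B (\<lambda>Z. \<psi> (Z # L)) X Y + sg ((dg X + 1) * dg Y) * ad X (\<lambda>L. \<psi> (Y # L)) L"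

primrec el :: "('x list \<Rightarrow> 'k) \<Rightarrow> 'x list \<Rightarrow> 'k" where
  "el \<psi> [] = 0"
| "el \<psi> (X # L) = ad X \<psi> L + sg (dg X) * el (\<lambda>L. \<psi> (X # L)) L"

lemma ad_add: "ad X (\<lambda>L. f L + g L) L = ad X f L + ad X g L"
  by (induction L arbitrary: f g) (simp_all add: B_add algebra_simps)

lemma ad_mult: "ad X (\<lambda>L. c * f L) L = c * ad X f L"
  by (induction L arbitrary: f) (simp_all add: B_mult algebra_simps)

lemma el_add: "el (\<lambda>L. f L + g L) L = el f L + el g L"
  by (induction L arbitrary: f g) (simp_all add: ad_add algebra_simps)

lemma el_mult: "el (\<lambda>L. c * f L) L = c * el f L"
  by (induction L arbitrary: f) (simp_all add: ad_mult algebra_simps)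

lemma ad_zero: "ad X (\<lambda>L. 0) L = 0"
  using ad_mult[of X 0 "\<lambda>_. 0"] by simp

lemma el_zero: "el (\<lambda>L. 0) L = 0"
  using el_mult[of 0 "\<lambda>_. 0"] by simp

lemma ad_sum_list: "ad X (\<lambda>L. \<Sum>i\<leftarrow>l. f i L) L = (\<Sum>i\<leftarrow>l. ad X (f i) L)"
  by (induction l) (simp_all add: ad_zero ad_add)

lemma el_sum_list: "el (\<lambda>L. \<Sum>i\<leftarrow>l. f i L) L = (\<Sum>i\<leftarrow>l. el (f i) L)"
  by (induction l) (simp_all add: el_zero el_add)

lemma ad_cong:
  "(\<And>L'. dgs L' = dg X + 1 + dgs L \<Longrightarrow> f L' = g L') \<Longrightarrow> ad X f L = ad X g L"
proof (induction L arbitrary: f g)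
  case (Cons Y L)
  have "B (\<lambda>Z. f (Z # L)) X Y = B (\<lambda>Z. g (Z # L)) X Y"
    by (rule B_cong) (simp add: Cons.prems)
  moreover have "ad X (\<lambda>L. f (Y # L)) L = ad X (\<lambda>L. g (Y # L)) L"
    by (rule Cons.IH) (simp add: Cons.prems)
  ultimately show ?case by simp
qed simp

lemma el_cong:
  "(\<And>L'. dgs L' = 1 + dgs L \<Longrightarrow> f L' = g L') \<Longrightarrow> el f L = el g L"
proof (induction L arbitrary: f g)
  case (Cons X L)
  have "ad X f L = ad X g L"
    by (rule ad_cong) (simp add: Cons.prems)
  moreover have "el (\<lambda>L. f (X # L)) L = el (\<lambda>L. g (X # L)) L"
    by (rule Cons.IH) (simp add: Cons.prems)
  ultimately show ?case by simp
qed simp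

lemma ad_cong_ok:
  "\<lbrakk>ok X; list_all ok L; \<And>L'. \<lbrakk>L' \<noteq> []; list_all ok L'; dgs L' = dg X + 1 + dgs L\<rbrakk> \<Longrightarrow> f L' = g L'\<rbrakk>
    \<Longrightarrow> ad X f L = ad X g L"
proof (induction L arbitrary: f g)
  case (Cons Y L)
  have "B (\<lambda>Z. f (Z # L)) X Y = B (\<lambda>Z. g (Z # L)) X Y"
    by (rule B_cong_ok) (use Cons.prems in auto)
  moreover have "ad X (\<lambda>L. f (Y # L)) L = ad X (\<lambda>L. g (Y # L)) L"
    by (rule Cons.IH) (use Cons.prems in auto)
  ultimately show ?case by simp
qed simp

text \<open>Only nonempty lists of valid letters are reached. Two functionals may thus differ
  elsewhere, in particular where \<open>Phi\<close> takes its default value.\<close>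

lemma el_cong_ok:
  "\<lbrakk>list_all ok L; \<And>L'. \<lbrakk>L' \<noteq> []; list_all ok L'; dgs L' = 1 + dgs L\<rbrakk> \<Longrightarrow> f L' = g L'\<rbrakk>
    \<Longrightarrow> el f L = el g L"
proof (induction L arbitrary: f g)
  case (Cons X L)
  have "ad X f L = ad X g L"
    by (rule ad_cong_ok) (use Cons.prems in auto)
  moreover have "el (\<lambda>L. f (X # L)) L = el (\<lambda>L. g (X # L)) L"
    by (rule Cons.IH) (use Cons.prems in auto)
  ultimately show ?case by simp
qed simp

lemma ad_sg: "ad X (\<lambda>L. sg (c * dgs L) * f L) L = sg (c * (dg X + 1 + dgs L)) * ad X f L"
  by (subst ad_mult[symmetric], rule ad_cong) simp

lemma el_sg: "el (\<lambda>L. sg (c * dgs L) * f L) L = sg (c * (1 + dgs L)) * el f L"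
  by (subst el_mult[symmetric], rule el_cong) simp

definition dd :: "'x \<Rightarrow> ('x list \<Rightarrow> 'x list \<Rightarrow> 'k) \<Rightarrow> 'x list \<Rightarrow> 'x list \<Rightarrow> 'k" where
  "dd X \<phi> A C = \<phi> (X # A) C + sg (dg X * dgs A) * \<phi> A (X # C)"

text \<open>Empty sides are kept, as if a unit were adjoined: I and J may be empty in \<kappa>, the
  pieces of \<open>X\<^sub>s\<close> then filling the two sides.\<close>

primrec cop :: "('x list \<Rightarrow> 'x list \<Rightarrow> 'k) \<Rightarrow> 'x list \<Rightarrow> 'k" where
  "cop \<phi> [] = \<phi> [] []"
| "cop \<phi> (X # L) = cop (dd X \<phi>) L"

definition AD :: "'x \<Rightarrow> ('x list \<Rightarrow> 'x list \<Rightarrow> 'k) \<Rightarrow> 'x list \<Rightarrow> 'x list \<Rightarrow> 'k" where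
  "AD X \<phi> A C = ad X (\<lambda>A. \<phi> A C) A + sg ((dg X + 1) * dgs A) * ad X (\<phi> A) C"

definition LL :: "('x list \<Rightarrow> 'x list \<Rightarrow> 'k) \<Rightarrow> 'x list \<Rightarrow> 'x list \<Rightarrow> 'k" where
  "LL \<phi> A C = el (\<lambda>A. \<phi> A C) A + sg (dgs A) * el (\<phi> A) C"

lemma dd_add: "dd X (\<lambda>A C. f A C + g A C) A C = dd X f A C + dd X g A C"
  by (simp add: dd_def algebra_simps)

lemma dd_mult: "dd X (\<lambda>A C. c * f A C) A C = c * dd X f A C"
  by (simp add: dd_def algebra_simps)

lemma cop_add: "cop (\<lambda>A C. f A C + g A C) L = cop f L + cop g L"
proof (induction L arbitrary: f g)
  case (Cons X L)
  have "dd X (\<lambda>A C. f A C + g A C) = (\<lambda>A C. dd X f A C + dd X g A C)"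
    by (intro ext dd_add)
  then show ?case by (simp add: Cons.IH)
qed simp

lemma cop_mult: "cop (\<lambda>A C. c * f A C) L = c * cop f L"
proof (induction L arbitrary: f)
  case (Cons X L)
  have "dd X (\<lambda>A C. c * f A C) = (\<lambda>A C. c * dd X f A C)"
    by (intro ext dd_mult)
  then show ?case by (simp add: Cons.IH)
qed simp

lemma cop_B: "cop (\<lambda>A C. B (\<lambda>Z. f Z A C) X Y) L = B (\<lambda>Z. cop (f Z) L) X Y"
proof (induction L arbitrary: f)
  case (Cons W L)
  have "dd W (\<lambda>A C. B (\<lambda>Z. f Z A C) X Y) = (\<lambda>A C. B (\<lambda>Z. dd W (f Z) A C) X Y)"
    by (intro ext) (simp add: dd_def B_add B_mult)
  then show ?case by (simp add: Cons.IH)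
qed simp

text \<open>\<ell> behaves like a second-order operator: its graded commutator with multiplication
  by \<open>X\<close> is the derivation \<open>AD X\<close>, and the commutator of that with
  multiplication by \<open>Y\<close> is multiplication by \<open>\<ell>\<^sub>2(X, Y)\<close>
  (\<open>dd_AD\<close>). The inductions on the list below move operators past one letter in this
  way.\<close>

lemma dd_LL: "dd X (LL \<phi>) A C = AD X \<phi> A C + sg (dg X) * LL (dd X \<phi>) A C"
  unfolding dd_def LL_def AD_def
  by (simp add: el_add el_mult el_sg)
     (cases "even (dg X)"; cases "even (dgs A)"; simp add: sg_def)

lemma dd_AD:
  "dd Y (AD X \<phi>) A C
    = B (\<lambda>Z. dd Z \<phi> A C) X Y + sg ((dg X + 1) * dg Y) * AD X (dd Y \<phi>) A C"
  unfolding dd_def AD_def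
  by (simp add: ad_add ad_mult ad_sg B_add B_sg)
     (cases "even (dg X)"; cases "even (dg Y)"; cases "even (dgs A)"; simp add: sg_def)

lemma cop_AD: "cop (AD X \<phi>) L = ad X (cop \<phi>) L"
proof (induction L arbitrary: \<phi>)
  case (Cons Y L)
  have "dd Y (AD X \<phi>)
      = (\<lambda>A C. B (\<lambda>Z. dd Z \<phi> A C) X Y + sg ((dg X + 1) * dg Y) * AD X (dd Y \<phi>) A C)"
    by (intro ext dd_AD)
  then show ?case by (simp add: cop_add cop_mult cop_B Cons.IH)
qed (simp add: AD_def)

lemma cop_LL: "cop (LL \<phi>) L = el (cop \<phi>) L"
proof (induction L arbitrary: \<phi>)
  case (Cons X L)
  have "dd X (LL \<phi>) = (\<lambda>A C. AD X \<phi> A C + sg (dg X) * LL (dd X \<phi>) A C)"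
    by (intro ext dd_LL)
  then show ?case by (simp add: cop_add cop_mult cop_AD Cons.IH)
qed (simp add: LL_def)

end

text \<open>\<open>adm\<close> singles out the functionals that descend to \<H>.
  \<open>cut_adm\<close> says that deconcatenation descends when tested on symmetric \<gamma>.
  \<open>key\<close> is the point where bracket and deconcatenation meet: the pieces of
  \<open>\<ell>\<^sub>2(X, Y)\<close>, the brackets of \<open>Y\<close> with a piece of
  \<open>X\<close> and the brackets of \<open>X\<close> with a piece of \<open>Y\<close> add up to 0
  against every \<gamma> that descends in each argument.\<close>

locale brace_cobrace = brace dg B ok
  for dg :: "'x \<Rightarrow> int" and B :: "('x \<Rightarrow> 'k::field) \<Rightarrow> 'x \<Rightarrow> 'x \<Rightarrow> 'k" and ok +
  fixes splits :: "'x \<Rightarrow> ('x \<times> 'x) list"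
    and adm :: "('x \<Rightarrow> 'k) \<Rightarrow> bool"
  assumes splits_dg: "(U, V) \<in> set (splits X) \<Longrightarrow> dg U + dg V = dg X - 1"
    and splits_ok: "\<lbrakk>(U, V) \<in> set (splits X); ok X\<rbrakk> \<Longrightarrow> ok U \<and> ok V"
    and adm_add: "\<lbrakk>adm f; adm g\<rbrakk> \<Longrightarrow> adm (\<lambda>P. f P + g P)"
    and adm_mult: "adm f \<Longrightarrow> adm (\<lambda>P. c * f P)"
    and adm_sg: "adm f \<Longrightarrow> adm (\<lambda>P. sg (n * dg P) * f P)"
    and cut_adm: "\<lbrakk>\<And>Q. adm (\<lambda>P. \<gamma> P Q); \<And>P. adm (\<gamma> P); \<And>P Q. \<gamma> P Q = sg (dg P * dg Q) * \<gamma> Q P\<rbrakk>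
      \<Longrightarrow> adm (\<lambda>Z. \<Sum>(P, Q)\<leftarrow>splits Z. sg (dg P + 1) * \<gamma> P Q)"
    and key: "\<lbrakk>\<And>Q. adm (\<lambda>P. \<gamma> P Q); \<And>P. adm (\<gamma> P)\<rbrakk> \<Longrightarrow>
      B (\<lambda>Z. \<Sum>(P, Q)\<leftarrow>splits Z. sg (dg P + 1) * \<gamma> P Q) X Y
      + (\<Sum>(U, V)\<leftarrow>splits X. sg (dg U + 1) *
          (sg (dg V * dg Y) * B (\<lambda>Z. \<gamma> Z V) U Y + sg (dg U) * B (\<lambda>Z. \<gamma> U Z) V Y))
      + sg (dg X) * (\<Sum>(U, V)\<leftarrow>splits Y. sg (dg U + 1) *
          (B (\<lambda>Z. \<gamma> Z V) X U + sg ((dg X + 1) * dg U) * B (\<lambda>Z. \<gamma> U Z) X V)) = 0"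
begin

definition cut :: "('x \<Rightarrow> 'x \<Rightarrow> 'k) \<Rightarrow> 'x \<Rightarrow> 'k" where
  "cut f X = (\<Sum>p\<leftarrow>splits X. f (fst p) (snd p))"

lemma cut_eq: "(\<Sum>(U, V)\<leftarrow>splits X. f U V) = cut f X"
  by (simp add: cut_def case_prod_unfold)

lemma cut_add: "cut (\<lambda>U V. f U V + g U V) X = cut f X + cut g X"
  by (simp add: cut_def sum_list_addf)

lemma cut_mult: "cut (\<lambda>U V. c * f U V) X = c * cut f X"
  by (simp add: cut_def sum_list_const_mult)

lemma cut_cong: "(\<And>U V. dg U + dg V = dg X - 1 \<Longrightarrow> f U V = g U V) \<Longrightarrow> cut f X = cut g X"
  unfolding cut_def using splits_dg by (intro arg_cong[of _ _ sum_list] map_cong) auto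

lemma cut_ad: "ad X (\<lambda>A. cut (\<lambda>U V. f U V A) Y) A = cut (\<lambda>U V. ad X (f U V) A) Y"
  by (simp add: cut_def ad_sum_list)

lemma cut_el: "el (\<lambda>A. cut (\<lambda>U V. f U V A) Y) A = cut (\<lambda>U V. el (f U V) A) Y"
  by (simp add: cut_def el_sum_list)

lemma cut_AD: "AD X (\<lambda>A C. cut (\<lambda>U V. f U V A C) Y) A C = cut (\<lambda>U V. AD X (f U V) A C) Y"
  unfolding AD_def by (simp add: cut_ad cut_add cut_mult)

lemma cut_LL: "LL (\<lambda>A C. cut (\<lambda>U V. f U V A C) Y) A C = cut (\<lambda>U V. LL (f U V) A C) Y"
  unfolding LL_def by (simp add: cut_el cut_add cut_mult)

lemma cut_dd: "dd X (\<lambda>A C. cut (\<lambda>U V. f U V A C) Y) A C = cut (\<lambda>U V. dd X (f U V) A C) Y"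
  unfolding dd_def by (simp add: cut_add cut_mult)

lemma AD_mult: "AD X (\<lambda>A C. c * f A C) A C = c * AD X f A C"
  unfolding AD_def by (simp add: ad_mult algebra_simps)

lemma LL_mult: "LL (\<lambda>A C. c * f A C) A C = c * LL f A C"
  unfolding LL_def by (simp add: el_mult algebra_simps)

lemma AD_add: "AD X (\<lambda>A C. f A C + g A C) A C = AD X f A C + AD X g A C"
  unfolding AD_def by (simp add: ad_add algebra_simps)

lemma LL_add: "LL (\<lambda>A C. f A C + g A C) A C = LL f A C + LL g A C"
  unfolding LL_def by (simp add: el_add algebra_simps)

definition tens :: "'x \<Rightarrow> 'x \<Rightarrow> ('x list \<Rightarrow> 'x list \<Rightarrow> 'k) \<Rightarrow> 'x list \<Rightarrow> 'x list \<Rightarrow> 'k" where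
  "tens U V \<phi> A C = sg (dg V * dgs A) * \<phi> (U # A) (V # C)"

definition tsym :: "'x \<Rightarrow> 'x \<Rightarrow> ('x list \<Rightarrow> 'x list \<Rightarrow> 'k) \<Rightarrow> 'x list \<Rightarrow> 'x list \<Rightarrow> 'k" where
  "tsym U V \<phi> A C = tens U V \<phi> A C + sg (dg U * dg V) * tens V U \<phi> A C"

definition dlt :: "'x \<Rightarrow> ('x list \<Rightarrow> 'x list \<Rightarrow> 'k) \<Rightarrow> 'x list \<Rightarrow> 'x list \<Rightarrow> 'k" where
  "dlt X \<phi> A C = cut (\<lambda>U V. sg (dg U + 1) * tsym U V \<phi> A C) X"

text \<open>This is \<open>\<kappa>(X \<cdot> L) = \<delta>(X) \<cdot> \<Delta>(L) + (-1)\<^sup>x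
  \<Delta>(X) \<cdot> \<kappa>(L)\<close>: \<kappa> is a derivation of degree 1 along the coproduct
  \<Delta>. The agreement with the explicit sum is \<open>pair_kappa_word\<close>.\<close>

primrec kap :: "('x list \<Rightarrow> 'x list \<Rightarrow> 'k) \<Rightarrow> 'x list \<Rightarrow> 'k" where
  "kap \<phi> [] = 0"
| "kap \<phi> (X # L) = cop (dlt X \<phi>) L + sg (dg X) * kap (dd X \<phi>) L"

text \<open>The graded commutator of \<open>\<ell> \<otimes> id + id \<otimes> \<ell>\<close> with
  multiplication by \<open>U \<otimes> V\<close> (\<open>tens_LL\<close>): \<open>U\<close> is
  bracketed with a letter of the first side, or \<open>V\<close> with one of the second.\<close>

definition tad :: "'x \<Rightarrow> 'x \<Rightarrow> ('x list \<Rightarrow> 'x list \<Rightarrow> 'k) \<Rightarrow> 'x list \<Rightarrow> 'x list \<Rightarrow> 'k" where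
  "tad U V \<phi> A C = sg (dg V * dgs A) * ad U (\<lambda>A. \<phi> A (V # C)) A
     + sg (dg U + (dg V + 1) * dgs A) * ad V (\<phi> (U # A)) C"

definition tads :: "'x \<Rightarrow> 'x \<Rightarrow> ('x list \<Rightarrow> 'x list \<Rightarrow> 'k) \<Rightarrow> 'x list \<Rightarrow> 'x list \<Rightarrow> 'k" where
  "tads U V \<phi> A C = tad U V \<phi> A C + sg (dg U * dg V) * tad V U \<phi> A C"

text \<open>The same commutator for multiplication by \<delta>(X), see
  \<open>dlt_LL\<close>.\<close>

definition EE :: "'x \<Rightarrow> ('x list \<Rightarrow> 'x list \<Rightarrow> 'k) \<Rightarrow> 'x list \<Rightarrow> 'x list \<Rightarrow> 'k" where
  "EE X \<phi> A C = cut (\<lambda>U V. sg (dg U + 1) * tads U V \<phi> A C) X"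

definition swapsym :: "('x list \<Rightarrow> 'k) \<Rightarrow> bool" where
  "swapsym f \<longleftrightarrow> (\<forall>P X Y A. f (P @ X # Y # A) = sg (dg X * dg Y) * f (P @ Y # X # A))"

definition slotadm :: "('x list \<Rightarrow> 'k) \<Rightarrow> bool" where
  "slotadm f \<longleftrightarrow> (\<forall>P A. adm (\<lambda>X. f (P @ X # A)))"

text \<open>The properties that a functional on the tensor square of S^+(H[1]) has on pairs of lists
  of words: it obeys the commutation rule on both sides and respects the relations of \<H> in every
  slot.\<close>

definition good :: "('x list \<Rightarrow> 'x list \<Rightarrow> 'k) \<Rightarrow> bool" where
  "good \<phi> \<longleftrightarrow> (\<forall>C. swapsym (\<lambda>A. \<phi> A C) \<and> slotadm (\<lambda>A. \<phi> A C))
     \<and> (\<forall>A. swapsym (\<phi> A) \<and> slotadm (\<phi> A))"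

lemma swapsymD: "swapsym f \<Longrightarrow> f (P @ X # Y # A) = sg (dg X * dg Y) * f (P @ Y # X # A)"
  unfolding swapsym_def by blast

lemma good_swap1: "good \<phi> \<Longrightarrow> \<phi> (P @ X # Y # A) C = sg (dg X * dg Y) * \<phi> (P @ Y # X # A) C"
  unfolding good_def using swapsymD[of "\<lambda>A. \<phi> A C"] by blast

lemma good_swap2: "good \<phi> \<Longrightarrow> \<phi> A (P @ X # Y # C) = sg (dg X * dg Y) * \<phi> A (P @ Y # X # C)"
  unfolding good_def using swapsymD[of "\<phi> A"] by blast

lemma good_adm1: "good \<phi> \<Longrightarrow> adm (\<lambda>X. \<phi> (P @ X # A) C)"
  unfolding good_def slotadm_def by blast

lemma good_adm2: "good \<phi> \<Longrightarrow> adm (\<lambda>X. \<phi> A (P @ X # C))"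
  unfolding good_def slotadm_def by blast

lemma good_dd:
  assumes "good \<phi>" shows "good (dd X \<phi>)"
  unfolding good_def swapsym_def slotadm_def
proof (intro conjI allI)
  fix C P Y Z A
  show "dd X \<phi> (P @ Y # Z # A) C = sg (dg Y * dg Z) * dd X \<phi> (P @ Z # Y # A) C"
    using good_swap1[OF assms, of "X # P" Y Z A C] good_swap1[OF assms, of P Y Z A "X # C"]
    by (simp add: dd_def algebra_simps)
  show "dd X \<phi> A (P @ Y # Z # C) = sg (dg Y * dg Z) * dd X \<phi> A (P @ Z # Y # C)"
    using good_swap2[OF assms, of A "X # P" Y Z C] good_swap2[OF assms, of "X # A" P Y Z C]
    by (simp add: dd_def algebra_simps)
  have "adm (\<lambda>Y. sg (dg X * (dgs P + dgs A)) * (sg (dg X * dg Y) * \<phi> (P @ Y # A) (X # C)))"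
    by (intro adm_mult adm_sg good_adm1 assms)
  then have "adm (\<lambda>Y. sg (dg X * dgs (P @ Y # A)) * \<phi> (P @ Y # A) (X # C))"
    by (simp add: sg_add[symmetric] mult.assoc[symmetric] algebra_simps)
  then show "adm (\<lambda>Y. dd X \<phi> (P @ Y # A) C)"
    unfolding dd_def using good_adm1[OF assms, of "X # P" A C] by (simp add: adm_add)
  show "adm (\<lambda>Y. dd X \<phi> A (P @ Y # C))"
    unfolding dd_def
    using good_adm2[OF assms, of "X # A" P C] good_adm2[OF assms, of A "X # P" C]
    by (simp add: adm_add adm_mult)
qed

lemma tens_LL: "tens U V (LL \<phi>) A C = tad U V \<phi> A C + sg (dg U + dg V) * LL (tens U V \<phi>) A C"
  unfolding tens_def LL_def tad_def
  by (simp add: el_mult el_sg)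
     (cases "even (dg U)"; cases "even (dg V)"; cases "even (dgs A)"; simp add: sg_def)

lemma tsym_LL:
  "tsym U V (LL \<phi>) A C = tads U V \<phi> A C + sg (dg U + dg V) * LL (tsym U V \<phi>) A C"
proof -
  have "LL (tsym U V \<phi>) A C = LL (tens U V \<phi>) A C + sg (dg U * dg V) * LL (tens V U \<phi>) A C"
    using LL_add[of "tens U V \<phi>" "\<lambda>A C. sg (dg U * dg V) * tens V U \<phi> A C" A C]
    by (simp add: LL_mult tsym_def[abs_def])
  then show ?thesis
    by (simp add: tsym_def tens_LL tads_def algebra_simps)
qed

lemma dlt_LL: "dlt X (LL \<phi>) A C = EE X \<phi> A C - sg (dg X) * LL (dlt X \<phi>) A C"
proof -
  have "dlt X (LL \<phi>) A C = EE X \<phi> A C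
      + cut (\<lambda>U V. sg (dg U + dg V) * (sg (dg U + 1) * LL (tsym U V \<phi>) A C)) X"
    unfolding dlt_def EE_def by (simp add: tsym_LL algebra_simps cut_add)
  also have "cut (\<lambda>U V. sg (dg U + dg V) * (sg (dg U + 1) * LL (tsym U V \<phi>) A C)) X
      = cut (\<lambda>U V. (- sg (dg X)) * (sg (dg U + 1) * LL (tsym U V \<phi>) A C)) X"
    by (rule cut_cong) (simp only:, simp add: sg_def)
  also have "\<dots> = - sg (dg X) * LL (dlt X \<phi>) A C"
    unfolding dlt_def[abs_def] cut_LL LL_mult cut_mult ..
  finally show ?thesis by simp
qed

text \<open>Commuting \<open>Y\<close> behind \<open>U\<close> and \<open>V\<close> inside \<phi>
  separates the brackets with the other letters from the two new ones,
  \<open>\<ell>\<^sub>2(U, Y)\<close> and \<open>\<ell>\<^sub>2(V, Y)\<close>.\<close>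

lemma dd_tad:
  assumes "good \<phi>"
  shows "dd Y (tad U V \<phi>) A C = sg (dg Y * (dg U + dg V + 1)) * tad U V (dd Y \<phi>) A C
    + sg (dg V * dg Y) * B (\<lambda>Z. tens Z V \<phi> A C) U Y + sg (dg U) * B (\<lambda>Z. tens U Z \<phi> A C) V Y"
proof -
  have 1: "\<phi> (Y # U # A) D = sg (dg U * dg Y) * \<phi> (U # Y # A) D" for A D
    using good_swap1[OF assms, of "[]" Y U A D] by (simp add: mult.commute)
  have 2: "\<phi> D (Y # V # C) = sg (dg V * dg Y) * \<phi> D (V # Y # C)" for D C
    using good_swap2[OF assms, of D "[]" Y V C] by (simp add: mult.commute)
  show ?thesis
    unfolding dd_def tad_def tens_def
    by (simp add: 1 2 ad_add ad_mult ad_sg B_mult B_sg)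
       (cases "even (dg U)"; cases "even (dg V)"; cases "even (dg Y)"; cases "even (dgs A)";
         simp add: sg_def)
qed

lemma dd_tads:
  assumes "good \<phi>"
  shows "dd Y (tads U V \<phi>) A C = sg (dg Y * (dg U + dg V + 1)) * tads U V (dd Y \<phi>) A C
    + sg (dg V * dg Y) * B (\<lambda>Z. tsym Z V \<phi> A C) U Y + sg (dg U) * B (\<lambda>Z. tsym U Z \<phi> A C) V Y"
proof -
  have B2: "B (\<lambda>Z. sg (c * dg Z) * f Z) X Y = sg ((dg X + dg Y + 1) * c) * B f X Y" for c f X Y
    using B_sg[of c f X Y] by (simp add: mult.commute)
  have "dd Y (tads U V \<phi>) A C
      = dd Y (tad U V \<phi>) A C + sg (dg U * dg V) * dd Y (tad V U \<phi>) A C"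
    by (simp add: dd_def tads_def algebra_simps)
  then show ?thesis
    by (simp add: dd_tad[OF assms] tads_def tsym_def B_add B_mult B_sg B2)
       (cases "even (dg U)"; cases "even (dg V)"; cases "even (dg Y)"; simp add: sg_def)
qed

text \<open>Moving the derivation \<open>AD X\<close> past multiplication by
  \<open>U \<otimes> V\<close> leaves the products in which \<open>X\<close> is bracketed with
  \<open>U\<close> or with \<open>V\<close>.\<close>

lemma tens_AD:
  "tens U V (AD X \<phi>) A C = sg ((dg X + 1) * (dg U + dg V)) * AD X (tens U V \<phi>) A C
    + B (\<lambda>Z. tens Z V \<phi> A C) X U + sg ((dg X + 1) * dg U) * B (\<lambda>Z. tens U Z \<phi> A C) X V"
  unfolding tens_def AD_def
  by (simp add: ad_mult ad_sg B_mult B_sg)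
     (cases "even (dg U)"; cases "even (dg V)"; cases "even (dg X)"; cases "even (dgs A)";
       simp add: sg_def)

lemma tsym_AD:
  "tsym U V (AD X \<phi>) A C = sg ((dg X + 1) * (dg U + dg V)) * AD X (tsym U V \<phi>) A C
    + B (\<lambda>Z. tsym Z V \<phi> A C) X U + sg ((dg X + 1) * dg U) * B (\<lambda>Z. tsym U Z \<phi> A C) X V"
proof -
  have B2: "B (\<lambda>Z. sg (c * dg Z) * f Z) X Y = sg ((dg X + dg Y + 1) * c) * B f X Y" for c f X Y
    using B_sg[of c f X Y] by (simp add: mult.commute)
  have "AD X (tsym U V \<phi>) A C = AD X (tens U V \<phi>) A C + sg (dg U * dg V) * AD X (tens V U \<phi>) A C"
    using AD_add[of X "tens U V \<phi>" "\<lambda>A C. sg (dg U * dg V) * tens V U \<phi> A C" A C]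
    by (simp add: AD_mult tsym_def[abs_def])
  then show ?thesis
    by (simp add: tens_AD tsym_def B_add B_mult B_sg B2)
       (cases "even (dg U)"; cases "even (dg V)"; cases "even (dg X)"; simp add: sg_def)
qed

text \<open>The core of the induction step of \<open>kap_AD\<close>. With \<open>A\<close> and
  \<open>C\<close> fixed, \<open>key\<close> is applied to \<phi> as a function of the two pieces;
  the terms in which \<open>AD X\<close> acts outside \<delta>(Y) cancel by their signs.\<close>

lemma dlt_compat:
  assumes "good \<phi>"
  shows "dd Y (EE X \<phi>) A C + sg (dg X) * dlt Y (AD X \<phi>) A C + B (\<lambda>Z. dlt Z \<phi> A C) X Y
    + sg ((dg X + 1) * dg Y) * AD X (dlt Y \<phi>) A C = sg (dg X * dg Y) * EE X (dd Y \<phi>) A C"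
proof -
  let ?g = "\<lambda>P Q. tsym P Q \<phi> A C"
  have sg_swap: "sg (dg P * dg Q) * tens Q P \<phi> A C
      = sg (dg Q * dg P) * (sg (dgs A * dg P) * \<phi> (Q # A) (P # C))" for P Q
    by (simp add: tens_def mult.commute)
  have t1: "adm (\<lambda>P. tens P Q \<phi> A C)" for Q
    unfolding tens_def using good_adm1[OF assms, of "[]"] by (simp add: adm_mult)
  have t2: "adm (\<lambda>P. tens Q P \<phi> A C)" for Q
    unfolding tens_def using adm_sg[OF good_adm2[OF assms, of "Q # A" "[]" C], of "dgs A"]
    by (simp add: mult.commute)
  have a1: "adm (\<lambda>P. ?g P Q)" for Q
    unfolding tsym_def using adm_sg[OF t2, of "dg Q" Q] t1 by (simp add: adm_add mult.commute)
  have a2: "adm (?g P)" for P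
    unfolding tsym_def[abs_def] using adm_sg[OF t1, of "dg P" P] t2 by (simp add: adm_add)
  \<comment> \<open>\<open>c1\<close> collects the brackets of a piece of \<open>X\<close> with
    \<open>Y\<close>, \<open>c2\<close> those of \<open>X\<close> with a piece of \<open>Y\<close>,
    in the form in which they occur in \<open>key\<close>.\<close>
  define c1 where "c1 = cut (\<lambda>U V. sg (dg U + 1) *
          (sg (dg V * dg Y) * B (\<lambda>Z. ?g Z V) U Y + sg (dg U) * B (\<lambda>Z. ?g U Z) V Y)) X"
  define c2 where "c2 = cut (\<lambda>U V. sg (dg U + 1) *
          (B (\<lambda>Z. ?g Z V) X U + sg ((dg X + 1) * dg U) * B (\<lambda>Z. ?g U Z) X V)) Y"
  have e1: "dd Y (EE X \<phi>) A C = sg (dg X * dg Y) * EE X (dd Y \<phi>) A C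
      + c1"
  proof -
    have "dd Y (EE X \<phi>) A C = cut (\<lambda>U V. sg (dg U + 1) * dd Y (tads U V \<phi>) A C) X"
      unfolding EE_def[abs_def] by (simp add: cut_dd dd_mult)
    also have "\<dots> = cut (\<lambda>U V. sg (dg X * dg Y) * (sg (dg U + 1) * tads U V (dd Y \<phi>) A C)
        + sg (dg U + 1) * (sg (dg V * dg Y) * B (\<lambda>Z. ?g Z V) U Y + sg (dg U) * B (\<lambda>Z. ?g U Z) V Y)) X"
    proof (rule cut_cong)
      fix U V assume "dg U + dg V = dg X - 1"
      then have "dg U + dg V + 1 = dg X" by simp
      then show "sg (dg U + 1) * dd Y (tads U V \<phi>) A C
        = sg (dg X * dg Y) * (sg (dg U + 1) * tads U V (dd Y \<phi>) A C)
        + sg (dg U + 1) * (sg (dg V * dg Y) * B (\<lambda>Z. ?g Z V) U Y + sg (dg U) * B (\<lambda>Z. ?g U Z) V Y)"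
        by (simp add: dd_tads[OF assms] algebra_simps)
    qed
    finally show ?thesis by (simp add: cut_add cut_mult EE_def c1_def)
  qed
  have e2: "dlt Y (AD X \<phi>) A C = sg ((dg X + 1) * (dg Y + 1)) * AD X (dlt Y \<phi>) A C + c2"
  proof -
    have "dlt Y (AD X \<phi>) A C = cut (\<lambda>U V. sg ((dg X + 1) * (dg Y + 1)) *
          (sg (dg U + 1) * AD X (tsym U V \<phi>) A C) + sg (dg U + 1) *
          (B (\<lambda>Z. ?g Z V) X U + sg ((dg X + 1) * dg U) * B (\<lambda>Z. ?g U Z) X V)) Y"
      unfolding dlt_def
    proof (rule cut_cong)
      fix U V assume *: "dg U + dg V = dg Y - 1"
      have "(sg ((dg X + 1) * (dg U + dg V)) :: 'k) = sg ((dg X + 1) * (dg Y + 1))"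
        unfolding * by (simp add: sg_def)
      then show "sg (dg U + 1) * tsym U V (AD X \<phi>) A C = sg ((dg X + 1) * (dg Y + 1)) *
          (sg (dg U + 1) * AD X (tsym U V \<phi>) A C) + sg (dg U + 1) *
          (B (\<lambda>Z. ?g Z V) X U + sg ((dg X + 1) * dg U) * B (\<lambda>Z. ?g U Z) X V)"
        unfolding tsym_AD by (simp only: distrib_left mult.left_commute add.assoc)
    qed
    then show ?thesis
      by (simp add: cut_add cut_mult dlt_def[abs_def] cut_AD AD_mult c2_def)
  qed
  have e2': "sg (dg X) * dlt Y (AD X \<phi>) A C
      = - sg ((dg X + 1) * dg Y) * AD X (dlt Y \<phi>) A C + sg (dg X) * c2"
    unfolding e2 by (simp add: sg_def)
  have "B (\<lambda>Z. dlt Z \<phi> A C) X Y + c1 + sg (dg X) * c2 = 0"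
    using key[of ?g X Y, OF a1 a2] unfolding cut_eq dlt_def c1_def c2_def .
  then have B: "B (\<lambda>Z. dlt Z \<phi> A C) X Y = - c1 - sg (dg X) * c2"
    by (simp add: algebra_simps add_eq_0_iff)
  show ?thesis
    unfolding e1 e2' B by simp
qed

lemma kap_add: "kap (\<lambda>A C. f A C + g A C) L = kap f L + kap g L"
proof (induction L arbitrary: f g)
  case (Cons X L)
  have "dd X (\<lambda>A C. f A C + g A C) = (\<lambda>A C. dd X f A C + dd X g A C)"
    by (intro ext dd_add)
  moreover have "dlt X (\<lambda>A C. f A C + g A C) = (\<lambda>A C. dlt X f A C + dlt X g A C)"
    by (intro ext) (simp add: dlt_def tsym_def tens_def cut_add[symmetric] algebra_simps)
  ultimately show ?case by (simp add: Cons.IH cop_add algebra_simps)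
qed simp

lemma kap_mult: "kap (\<lambda>A C. c * f A C) L = c * kap f L"
proof (induction L arbitrary: f)
  case (Cons X L)
  have "dd X (\<lambda>A C. c * f A C) = (\<lambda>A C. c * dd X f A C)"
    by (intro ext dd_mult)
  moreover have "dlt X (\<lambda>A C. c * f A C) = (\<lambda>A C. c * dlt X f A C)"
    by (intro ext) (simp add: dlt_def tsym_def tens_def cut_mult[symmetric] algebra_simps)
  ultimately show ?case by (simp add: Cons.IH cop_mult algebra_simps)
qed simp

lemma kap_B: "kap (\<lambda>A C. B (\<lambda>Z. f Z A C) X Y) L = B (\<lambda>Z. kap (f Z) L) X Y"
proof (induction L arbitrary: f)
  case (Cons W L)
  have "dd W (\<lambda>A C. B (\<lambda>Z. f Z A C) X Y) = (\<lambda>A C. B (\<lambda>Z. dd W (f Z) A C) X Y)"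
    by (intro ext) (simp add: dd_def B_add B_mult)
  moreover have "dlt W (\<lambda>A C. B (\<lambda>Z. f Z A C) X Y) = (\<lambda>A C. B (\<lambda>Z. dlt W (f Z) A C) X Y)"
    by (intro ext) (simp add: dlt_def cut_def tsym_def tens_def B_sum_list B_add B_mult)
  ultimately show ?case by (simp add: Cons.IH cop_B B_add B_mult)
qed (simp add: B_zero)

text \<open>The part of the identity for \<open>X # L\<close> in which \<open>\<ell>\<^sub>2\<close>
  involves \<open>X\<close> or a piece of \<delta>(X). Passing the head \<open>Y\<close> of the list
  reproduces the statement for \<open>dd Y \<phi>\<close> up to sign; what is left over is removed
  by \<open>dlt_compat\<close>.\<close>

lemma kap_AD:
  assumes "good \<phi>"
  shows "cop (EE X \<phi>) L + sg (dg X) * kap (AD X \<phi>) L + ad X (kap \<phi>) L = 0"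
  using assms
proof (induction L arbitrary: \<phi>)
  case Nil
  show ?case by (simp add: EE_def tads_def tad_def cut_def)
next
  case (Cons Y L)
  have IH: "cop (EE X (dd Y \<phi>)) L + sg (dg X) * kap (AD X (dd Y \<phi>)) L + ad X (kap (dd Y \<phi>)) L = 0"
    by (rule Cons.IH[OF good_dd[OF Cons.prems]])
  have dd: "dd Y (AD X \<phi>)
      = (\<lambda>A C. B (\<lambda>Z. dd Z \<phi> A C) X Y + sg ((dg X + 1) * dg Y) * AD X (dd Y \<phi>) A C)"
    by (intro ext dd_AD)
  \<comment> \<open>\<open>dlt_compat\<close> solved for its first term. Minus signs are written
    with \<open>sg\<close> so that \<open>cop_add\<close> and \<open>cop_mult\<close> take the sum
    apart.\<close>
  have K: "dd Y (EE X \<phi>) = (\<lambda>A C. sg (dg X * dg Y) * EE X (dd Y \<phi>) A C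
     + sg (dg X + 1) * dlt Y (AD X \<phi>) A C + sg 1 * B (\<lambda>Z. dlt Z \<phi> A C) X Y
     + sg ((dg X + 1) * dg Y + 1) * AD X (dlt Y \<phi>) A C)"
    by (intro ext, subst dlt_compat[OF Cons.prems, symmetric]) (simp add: sg_def)
  have "B (\<lambda>Z. sg (dg Z) * kap (dd Z \<phi>) L) X Y = sg (dg X + dg Y + 1) * B (\<lambda>Z. kap (dd Z \<phi>) L) X Y"
    using B_sg[of 1] by simp
  then have "cop (EE X \<phi>) (Y # L) + sg (dg X) * kap (AD X \<phi>) (Y # L) + ad X (kap \<phi>) (Y # L)
     = sg (dg X * dg Y) * (cop (EE X (dd Y \<phi>)) L + sg (dg X) * kap (AD X (dd Y \<phi>)) L
         + ad X (kap (dd Y \<phi>)) L)"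
    by (simp add: K dd cop_add cop_mult kap_add kap_mult kap_B cop_B cop_AD ad_add ad_mult B_add)
       (cases "even (dg X)"; cases "even (dg Y)"; simp add: sg_def)
  then show ?case using IH by simp
qed

text \<open>The identity to be proved, transposed, for a product of classes of words. Terms in which
  \<open>\<ell>\<^sub>2\<close> involves the first letter or one of its pieces cancel by
  \<open>kap_AD\<close>; where \<delta> cuts the first letter and \<open>\<ell>\<^sub>2\<close>
  avoids it, \<open>cop_LL\<close> gives the cancellation; the rest is the statement for
  \<open>L\<close>.\<close>

theorem kap_LL:
  assumes "good \<phi>"
  shows "kap (LL \<phi>) L + el (kap \<phi>) L = 0"
  using assms
proof (induction L arbitrary: \<phi>)
  case (Cons X L)
  have IH: "kap (LL (dd X \<phi>)) L + el (kap (dd X \<phi>)) L = 0"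
    by (rule Cons.IH[OF good_dd[OF Cons.prems]])
  have dd: "dd X (LL \<phi>) = (\<lambda>A C. AD X \<phi> A C + sg (dg X) * LL (dd X \<phi>) A C)"
    by (intro ext dd_LL)
  have dlt: "dlt X (LL \<phi>) = (\<lambda>A C. EE X \<phi> A C + sg (dg X + 1) * LL (dlt X \<phi>) A C)"
    by (intro ext) (simp add: dlt_LL sg_def)
  have "kap (LL \<phi>) (X # L) + el (kap \<phi>) (X # L)
    = (cop (EE X \<phi>) L + sg (dg X) * kap (AD X \<phi>) L + ad X (kap \<phi>) L)
      + (kap (LL (dd X \<phi>)) L + el (kap (dd X \<phi>)) L)"
    by (simp add: dd dlt cop_add cop_mult kap_add kap_mult cop_LL el_add el_mult)
       (cases "even (dg X)"; simp add: sg_def)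
  then show ?case using IH kap_AD[OF Cons.prems, of X L] by simp
qed simp

end

lemma wdeg_simps [simp]: "wdeg [] = 0" "wdeg (a # w) = fst a + wdeg w" "wdeg (v @ w) = wdeg v + wdeg w"
  by (simp_all add: wdeg_def)

section \<open>Shuffles, brackets and deconcatenation of words\<close>

text \<open>\<open>sh \<chi>\<close>, \<open>br brk \<chi>\<close> and \<open>cutf \<beta>\<close> are again transposes: \<open>\<chi>\<close> on the shuffle product and on the bracket of two
  words, \<open>\<beta>\<close> on all deconcatenations, those with an empty piece included.\<close>

fun sh :: "('v letter list \<Rightarrow> 'k::field) \<Rightarrow> 'v letter list \<Rightarrow> 'v letter list \<Rightarrow> 'k" where
  "sh \<chi> [] w = \<chi> w"
| "sh \<chi> (a # v) [] = \<chi> (a # v)"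
| "sh \<chi> (a # v) (b # w) = sh (\<lambda>z. \<chi> (a # z)) v (b # w)
     + sg (fst b * wdeg (a # v)) * sh (\<lambda>z. \<chi> (b # z)) (a # v) w"

lemma sh_Nil1 [simp]: "sh \<chi> [] = \<chi>"
  by (rule ext) simp

lemma sh_Nil2 [simp]: "sh \<chi> v [] = \<chi> v"
  by (cases v) simp_all

definition bl :: "('v \<Rightarrow> 'v \<Rightarrow> 'v) \<Rightarrow> 'v letter \<Rightarrow> 'v letter \<Rightarrow> 'v letter" where
  "bl brk a b = (fst a + fst b, brk (snd a) (snd b))"

lemma fst_bl [simp]: "fst (bl brk a b) = fst a + fst b"
  by (simp add: bl_def)

text \<open>A letter of the first word is bracketed with a letter of the second directly behind it.
  Either these are the two heads, \<open>b\<close> then passing \<open>v\<close> but not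
  \<open>a\<close>, or the result begins with \<open>a\<close> or with \<open>b\<close> and the
  bracket comes later.\<close>

fun br :: "('v \<Rightarrow> 'v \<Rightarrow> 'v) \<Rightarrow> ('v letter list \<Rightarrow> 'k::field) \<Rightarrow> 'v letter list \<Rightarrow> 'v letter list \<Rightarrow> 'k"
where
  "br brk \<chi> [] w = 0"
| "br brk \<chi> (a # v) [] = 0"
| "br brk \<chi> (a # v) (b # w) = sg (fst b * wdeg v) * sh (\<lambda>z. \<chi> (bl brk a b # z)) v w
     + br brk (\<lambda>z. \<chi> (a # z)) v (b # w)
     + sg (fst b * wdeg (a # v)) * br brk (\<lambda>z. \<chi> (b # z)) (a # v) w"

lemma br_Nil2 [simp]: "br brk \<chi> v [] = 0"
  by (cases v) simp_all

lemma sh_cong: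
  "(\<And>z. mset z = mset v + mset w \<Longrightarrow> f z = g z) \<Longrightarrow> sh f v w = sh g v w"
proof (induction f v w arbitrary: g rule: sh.induct)
  case (3 f a v b w)
  have "sh (\<lambda>z. f (a # z)) v (b # w) = sh (\<lambda>z. g (a # z)) v (b # w)"
    by (rule "3.IH") (simp add: "3.prems")
  moreover have "sh (\<lambda>z. f (b # z)) (a # v) w = sh (\<lambda>z. g (b # z)) (a # v) w"
    by (rule "3.IH") (simp add: "3.prems")
  ultimately show ?case by simp
qed simp_all

lemma mset_wdeg: "mset z = mset v + mset w \<Longrightarrow> wdeg z = wdeg v + wdeg w"
  unfolding wdeg_def by (metis mset_append mset_map sum_list_append sum_mset_sum_list map_append)

lemma sh_cong_wdeg:
  "(\<And>z. wdeg z = wdeg v + wdeg w \<Longrightarrow> f z = g z) \<Longrightarrow> sh f v w = sh g v w"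
  by (rule sh_cong) (simp add: mset_wdeg)

lemma sh_add: "sh (\<lambda>z. f z + g z) v w = sh f v w + sh g v w"
proof (induction f v w arbitrary: g rule: sh.induct)
  case (3 f a v b w)
  then show ?case by (simp add: distrib_left)
qed simp_all

lemma sh_mult: "sh (\<lambda>z. c * f z) v w = c * sh f v w"
  by (induction f v w rule: sh.induct) (simp_all add: algebra_simps)

lemma sh_zero: "sh (\<lambda>z. 0) v w = 0"
  using sh_mult[of 0 "\<lambda>_. 0" v w] by simp

lemma sh_sg: "sh (\<lambda>z. sg (c * wdeg z) * f z) v w = sg (c * (wdeg v + wdeg w)) * sh f v w"
  by (subst sh_mult[symmetric], rule sh_cong_wdeg) simp

lemma br_cong:
  "\<lbrakk>\<And>a b. \<lbrakk>P a; P b\<rbrakk> \<Longrightarrow> P (bl brk a b); list_all P v; list_all P w;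
     \<And>z. \<lbrakk>list_all P z; z \<noteq> []; wdeg z = wdeg v + wdeg w\<rbrakk> \<Longrightarrow> f z = g z\<rbrakk>
    \<Longrightarrow> br brk f v w = br brk g v w"
proof (induction brk f v w arbitrary: g rule: br.induct)
  case (3 brk f a v b w)
  have "sh (\<lambda>z. f (bl brk a b # z)) v w = sh (\<lambda>z. g (bl brk a b # z)) v w"
  proof (rule sh_cong)
    fix z assume z: "mset z = mset v + mset w"
    then have "set z = set v \<union> set w"
      by (metis set_mset_mset set_mset_union)
    moreover have "P (bl brk a b)"
      using "3.prems"(2,3) by (intro "3.prems"(1)) auto
    ultimately show "f (bl brk a b # z) = g (bl brk a b # z)"
      by (intro "3.prems"(4)) (use "3.prems"(2,3) mset_wdeg[OF z] in \<open>auto simp: list_all_iff\<close>)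
  qed
  moreover have "br brk (\<lambda>z. f (a # z)) v (b # w) = br brk (\<lambda>z. g (a # z)) v (b # w)"
    by (rule "3.IH") (use "3.prems" in auto)
  moreover have "br brk (\<lambda>z. f (b # z)) (a # v) w = br brk (\<lambda>z. g (b # z)) (a # v) w"
    by (rule "3.IH") (use "3.prems" in auto)
  ultimately show ?case by simp
qed simp_all

lemma br_cong_wdeg:
  "(\<And>z. \<lbrakk>z \<noteq> []; wdeg z = wdeg v + wdeg w\<rbrakk> \<Longrightarrow> f z = g z) \<Longrightarrow> br brk f v w = br brk g v w"
  using br_cong[of "\<lambda>_. True" brk v w f g] by (simp add: list_all_iff)

lemma br_add: "br brk (\<lambda>z. f z + g z) v w = br brk f v w + br brk g v w"
proof (induction brk f v w arbitrary: g rule: br.induct)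
  case (3 brk f a v b w)
  then show ?case by (simp add: sh_add distrib_left)
qed simp_all

lemma br_mult: "br brk (\<lambda>z. c * f z) v w = c * br brk f v w"
  by (induction brk f v w rule: br.induct) (simp_all add: sh_mult algebra_simps)

lemma br_zero: "br brk (\<lambda>z. 0) v w = 0"
  using br_mult[of brk 0 "\<lambda>_. 0" v w] by simp

lemma br_sg: "br brk (\<lambda>z. sg (c * wdeg z) * f z) v w = sg (c * (wdeg v + wdeg w)) * br brk f v w"
  by (subst br_mult[symmetric], rule br_cong_wdeg) simp

lemma sh_commute: "sh \<chi> v w = sg (wdeg v * wdeg w) * sh \<chi> w v"
proof (induction \<chi> v w rule: sh.induct)
  case (3 \<chi> a v b w)
  then show ?case
    by (simp only: sh.simps wdeg_simps)
       (cases "even (fst a)"; cases "even (fst b)"; cases "even (wdeg v)"; cases "even (wdeg w)";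
         simp add: sg_def)
qed simp_all

declare sh.simps(3) [simp del] br.simps(3) [simp del]

text \<open>Both sides range over the shuffles of three words; they are sorted by the word that
  supplies the first letter.\<close>

lemma sh_assoc: "sh (\<lambda>x. sh \<chi> x w) u v = sh (\<lambda>y. sh \<chi> u y) v w"
proof (induction "length u + length v + length w" arbitrary: \<chi> u v w rule: less_induct)
  case less
  show ?case
  proof (cases "u = [] \<or> v = [] \<or> w = []")
    case True
    then show ?thesis by auto
  next
    case False
    then obtain a u' b v' c w' where e: "u = a # u'" "v = b # v'" "w = c # w'"
      by (metis neq_Nil_conv)
    let ?u = "a # u'" and ?v = "b # v'" and ?w = "c # w'"
    have Ia: "sh (\<lambda>x. sh (\<lambda>z. \<chi> (a # z)) x ?w) u' ?v = sh (\<lambda>y. sh (\<lambda>z. \<chi> (a # z)) u' y) ?v ?w"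
     and Ib: "sh (\<lambda>x. sh (\<lambda>z. \<chi> (b # z)) x ?w) ?u v' = sh (\<lambda>y. sh (\<lambda>z. \<chi> (b # z)) ?u y) v' ?w"
     and Ic: "sh (\<lambda>x. sh (\<lambda>z. \<chi> (c # z)) x w') ?u ?v = sh (\<lambda>y. sh (\<lambda>z. \<chi> (c # z)) ?u y) ?v w'"
      by (intro less; simp add: e)+
    have L1: "sh (\<lambda>x. sh \<chi> (a # x) ?w) u' ?v = sh (\<lambda>x. sh (\<lambda>z. \<chi> (a # z)) x ?w) u' ?v
        + sg (fst c * (fst a + wdeg u' + wdeg ?v)) * sh (\<lambda>x. sh (\<lambda>z. \<chi> (c # z)) (a # x) w') u' ?v"
      by (subst sh_mult[symmetric], subst sh_add[symmetric], rule sh_cong_wdeg)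
         (simp add: add.assoc sh.simps(3))
    have L2: "sh (\<lambda>x. sh \<chi> (b # x) ?w) ?u v' = sh (\<lambda>x. sh (\<lambda>z. \<chi> (b # z)) x ?w) ?u v'
        + sg (fst c * (fst b + wdeg ?u + wdeg v')) * sh (\<lambda>x. sh (\<lambda>z. \<chi> (c # z)) (b # x) w') ?u v'"
      by (subst sh_mult[symmetric], subst sh_add[symmetric], rule sh_cong_wdeg)
         (simp add: add.assoc sh.simps(3))
    show ?thesis
      unfolding e sh.simps(3)[of "\<lambda>x. sh \<chi> x ?w" a u' b v'] L1 L2 Ia Ib
        sh.simps(3)[of "\<lambda>y. sh \<chi> ?u y" b v' c w']
      \<comment> \<open>The terms beginning with \<open>c\<close> arise in two parts, one from
        \<open>L1\<close> and one from \<open>L2\<close>; together they are the left side of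
        \<open>Ic\<close>.\<close>
      using Ic[unfolded sh.simps(3)[of "\<lambda>x. sh (\<lambda>z. \<chi> (c # z)) x w'" a u' b v']]
      by (simp add: sh.simps(3)[of \<chi>] sh.simps(3)[of _ b v' c w'] sh_add sh_mult)
         (cases "even (fst a)"; cases "even (fst b)"; cases "even (fst c)"; cases "even (wdeg u')";
           cases "even (wdeg v')"; simp add: sg_def algebra_simps)
  qed
qed

lemma sg_sg_eq: "(even m = even n \<Longrightarrow> sg m * x = sg n * (x :: 'k::field))"
  "(even (m + n) = even (p + q) \<Longrightarrow> sg m * (sg n * x) = sg p * (sg q * x))"
  "(even (m + n) = even p \<Longrightarrow> sg m * (sg n * x) = sg p * x)"
  by (auto simp: sg_def)

lemma sh_perm: "sh (\<lambda>x. sh \<chi> x w) u v = sg (wdeg v * wdeg w) * sh (\<lambda>x. sh \<chi> x v) u w"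
  unfolding sh_assoc by (rule sh_commute)

lemma sh_lin2: "sh (\<lambda>z. f z + c * g z) v w = sh f v w + c * sh g v w"
  by (simp add: sh_add sh_mult)

lemma sh_lin3: "sh (\<lambda>z. c * f z + g z + d * h z) v w = c * sh f v w + sh g v w + d * sh h v w"
  by (simp add: sh_add sh_mult)

lemma br_lin2: "br brk (\<lambda>z. f z + c * g z) v w = br brk f v w + c * br brk g v w"
  by (simp add: br_add br_mult)

text \<open>The bracket is a graded derivation of the shuffle product: the bracketed letter of a
  shuffle of \<open>u\<close> and \<open>v\<close> comes from \<open>v\<close> or from
  \<open>u\<close>. If \<chi> vanishes on shuffles of nonempty words, both terms on the right
  vanish, so the bracket descends to \<H> in its first argument.\<close>

lemma sh_br:
  fixes \<chi> :: "'v letter list \<Rightarrow> 'k::field"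
  shows "sh (\<lambda>x. br brk \<chi> x w) u v
    = br brk (\<lambda>y. sh \<chi> u y) v w + sg (wdeg v * wdeg w) * br brk (\<lambda>y. sh \<chi> y v) u w"
proof (induction "length u + length v + length w" arbitrary: \<chi> u v w rule: less_induct)
  case less
  show ?case
  proof (cases "u = [] \<or> v = [] \<or> w = []")
    case True
    then show ?thesis by (auto simp: sh_zero)
  next
    case False
    then obtain a u' b v' c w' where e: "u = a # u'" "v = b # v'" "w = c # w'"
      by (metis neq_Nil_conv)
    let ?u = "a # u'" and ?v = "b # v'" and ?w = "c # w'"
    let ?ac = "bl brk a c" and ?bc = "bl brk b c"
    let ?f = "\<lambda>q z. \<chi> (q # z)"
    have Ia: "sh (\<lambda>x. br brk (?f a) x ?w) u' ?v = br brk (\<lambda>y. sh (?f a) u' y) ?v ?w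
        + sg (wdeg ?v * wdeg ?w) * br brk (\<lambda>y. sh (?f a) y ?v) u' ?w"
     and Ib: "sh (\<lambda>x. br brk (?f b) x ?w) ?u v' = br brk (\<lambda>y. sh (?f b) ?u y) v' ?w
        + sg (wdeg v' * wdeg ?w) * br brk (\<lambda>y. sh (?f b) y v') ?u ?w"
     and Ic: "sh (\<lambda>x. br brk (?f c) x w') ?u ?v = br brk (\<lambda>y. sh (?f c) ?u y) ?v w'
        + sg (wdeg ?v * wdeg w') * br brk (\<lambda>y. sh (?f c) y ?v) ?u w'"
      by (intro less; simp add: e)+
    have L1: "sh (\<lambda>x. br brk \<chi> (a # x) ?w) u' ?v
      = sg (fst c * (wdeg u' + wdeg ?v)) * sh (\<lambda>x. sh (?f ?ac) x w') u' ?v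
      + sh (\<lambda>x. br brk (?f a) x ?w) u' ?v
      + sg (fst c * (fst a + wdeg u' + wdeg ?v)) * sh (\<lambda>x. br brk (?f c) (a # x) w') u' ?v"
      by (subst sh_lin3[symmetric], rule sh_cong_wdeg) (simp add: add.assoc br.simps(3))
    have L2: "sh (\<lambda>x. br brk \<chi> (b # x) ?w) ?u v'
      = sg (fst c * (wdeg ?u + wdeg v')) * sh (\<lambda>x. sh (?f ?bc) x w') ?u v'
      + sh (\<lambda>x. br brk (?f b) x ?w) ?u v'
      + sg (fst c * (fst b + wdeg ?u + wdeg v')) * sh (\<lambda>x. br brk (?f c) (b # x) w') ?u v'"
      by (subst sh_lin3[symmetric], rule sh_cong_wdeg) (simp add: add.assoc br.simps(3))
    have R2a: "sh (\<lambda>z. sh \<chi> (?ac # z) ?v) u' w' = sh (\<lambda>z. sh (?f ?ac) z ?v) u' w'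
        + sg (fst b * (fst ?ac + (wdeg u' + wdeg w'))) * sh (\<lambda>z. sh (?f b) (?ac # z) v') u' w'"
      by (subst sh_lin2[symmetric], rule sh_cong_wdeg) (simp add: add.assoc sh.simps(3))
    have R2b: "br brk (\<lambda>z. sh \<chi> (a # z) ?v) u' ?w = br brk (\<lambda>z. sh (?f a) z ?v) u' ?w
        + sg (fst b * (fst a + (wdeg u' + wdeg ?w))) * br brk (\<lambda>z. sh (?f b) (a # z) v') u' ?w"
      by (subst br_lin2[symmetric], rule br_cong_wdeg) (simp add: add.assoc sh.simps(3))
    have R2c: "br brk (\<lambda>z. sh \<chi> (c # z) ?v) ?u w' = br brk (\<lambda>z. sh (?f c) z ?v) ?u w'
        + sg (fst b * (fst c + (wdeg ?u + wdeg w'))) * br brk (\<lambda>z. sh (?f b) (c # z) v') ?u w'"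
      by (subst br_lin2[symmetric], rule br_cong_wdeg) (simp add: add.assoc sh.simps(3))
    have R1: "br brk (\<lambda>y. sh \<chi> ?u y) ?v ?w = br brk (\<lambda>y. sh (?f a) u' y) ?v ?w
        + sg (fst c * wdeg v' + (fst b + fst c) * wdeg ?u) * sh (\<lambda>z. sh (?f ?bc) ?u z) v' w'
        + sg (fst b * wdeg ?u) * br brk (\<lambda>z. sh (?f b) ?u z) v' ?w
        + sg (fst c * wdeg ?v + fst c * wdeg ?u) * br brk (\<lambda>z. sh (?f c) ?u z) ?v w'"
      unfolding br.simps(3)[of _ _ b v' c w']
      by (simp add: sh.simps(3)[of \<chi>] sh_add sh_mult br_add br_mult sg_add distrib_left)
    have R2: "br brk (\<lambda>y. sh \<chi> y ?v) ?u ?w = br brk (\<lambda>z. sh (?f a) z ?v) u' ?w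
        + sg (fst c * wdeg u') * sh (\<lambda>z. sh (?f ?ac) z ?v) u' w'
        + sg (fst c * wdeg ?u) * br brk (\<lambda>z. sh (?f c) z ?v) ?u w'
        + sg (fst b * (wdeg ?u + wdeg ?w)) * br brk (\<lambda>y. sh (?f b) y v') ?u ?w"
    proof -
      have "sg (fst c * wdeg u') * (sg (fst b * (fst ?ac + (wdeg u' + wdeg w'))) * x)
          = sg (fst b * (wdeg ?u + wdeg ?w)) * (sg (fst c * wdeg u') * x)"
        "sg (fst b * (fst a + (wdeg u' + wdeg ?w))) * x = sg (fst b * (wdeg ?u + wdeg ?w)) * x"
        "sg (fst c * wdeg ?u) * (sg (fst b * (fst c + (wdeg ?u + wdeg w'))) * x)
          = sg (fst b * (wdeg ?u + wdeg ?w)) * (sg (fst c * wdeg ?u) * x)" for x :: 'k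
        by (auto simp: sg_def)
      then show ?thesis
        unfolding br.simps(3)[of brk "\<lambda>y. sh \<chi> y ?v" a u' c w'] R2a R2b R2c
          br.simps(3)[of brk "\<lambda>y. sh (?f b) y v'" a u' c w'] distrib_left
        by (simp only: add_ac)
    qed
    \<comment> \<open>As in \<open>sh_assoc\<close>, the terms beginning with \<open>c\<close> must
      be assembled from two parts before the induction hypothesis \<open>Ic\<close> applies.\<close>
    have C: "sg (fst c * (fst a + wdeg u' + wdeg ?v)) * sh (\<lambda>x. br brk (?f c) (a # x) w') u' ?v
        + sg (fst b * wdeg ?u) * (sg (fst c * (fst b + wdeg ?u + wdeg v'))
            * sh (\<lambda>x. br brk (?f c) (b # x) w') ?u v')
      = sg (fst c * (wdeg ?u + wdeg ?v)) * br brk (\<lambda>y. sh (?f c) ?u y) ?v w'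
        + sg (fst c * (wdeg ?u + wdeg ?v)) * (sg (wdeg ?v * wdeg w')
            * br brk (\<lambda>y. sh (?f c) y ?v) ?u w')"
      unfolding distrib_left[symmetric] Ic[symmetric]
        sh.simps(3)[of "\<lambda>x. br brk (?f c) x w'" a u' b v']
      by (simp add: algebra_simps)
    \<comment> \<open>Both sides have sign exponents of equal total parity; once \<open>even\<close>
      is distributed over sums and products, this is a propositional question for
      \<open>argo\<close>.\<close>
    have S: "sg (fst b * wdeg ?u) * (sg (wdeg v' * wdeg ?w) * x)
        = sg (wdeg ?v * wdeg ?w) * (sg (fst b * (wdeg ?u + wdeg ?w)) * x)"
      "sg (fst c * (wdeg u' + wdeg ?v)) * (sg (wdeg ?v * wdeg w') * x)
        = sg (wdeg ?v * wdeg ?w) * (sg (fst c * wdeg u') * x)"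
      "sg (fst b * wdeg ?u) * (sg (fst c * (wdeg ?u + wdeg v')) * x)
        = sg (fst c * wdeg v' + (fst b + fst c) * wdeg ?u) * x"
      "sg (fst c * (wdeg ?u + wdeg ?v)) * x = sg (fst c * wdeg ?v + fst c * wdeg ?u) * x"
      "sg (fst c * (wdeg ?u + wdeg ?v)) * (sg (wdeg ?v * wdeg w') * x)
        = sg (wdeg ?v * wdeg ?w) * (sg (fst c * wdeg ?u) * x)" for x :: 'k
      by (rule sg_sg_eq; simp only: even_add even_mult_iff wdeg_simps; argo)+
    have "sh (\<lambda>x. br brk \<chi> x ?w) ?u ?v
      = sg (fst c * (wdeg u' + wdeg ?v)) * (sg (wdeg ?v * wdeg w') * sh (\<lambda>z. sh (?f ?ac) z ?v) u' w')
      + br brk (\<lambda>y. sh (?f a) u' y) ?v ?w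
      + sg (wdeg ?v * wdeg ?w) * br brk (\<lambda>y. sh (?f a) y ?v) u' ?w
      + sg (fst b * wdeg ?u) * (sg (fst c * (wdeg ?u + wdeg v')) * sh (\<lambda>y. sh (?f ?bc) ?u y) v' w')
      + sg (fst b * wdeg ?u) * br brk (\<lambda>y. sh (?f b) ?u y) v' ?w
      + sg (fst b * wdeg ?u) * (sg (wdeg v' * wdeg ?w) * br brk (\<lambda>y. sh (?f b) y v') ?u ?w)
      + (sg (fst c * (wdeg ?u + wdeg ?v)) * br brk (\<lambda>y. sh (?f c) ?u y) ?v w'
        + sg (fst c * (wdeg ?u + wdeg ?v)) * (sg (wdeg ?v * wdeg w')
            * br brk (\<lambda>y. sh (?f c) y ?v) ?u w'))"
      unfolding sh.simps(3)[of "\<lambda>x. br brk \<chi> x ?w" a u' b v'] L1 L2 Ia Ib C[symmetric]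
        sh_perm[of "?f ?ac" w' u' ?v] sh_assoc[of "?f ?bc" w' ?u v']
        distrib_left[of "sg (fst b * wdeg ?u) :: 'k"]
      by (simp only: add_ac)
    also have "\<dots> = br brk (\<lambda>y. sh \<chi> ?u y) ?v ?w
        + sg (wdeg ?v * wdeg ?w) * br brk (\<lambda>y. sh \<chi> y ?v) ?u ?w"
      unfolding S(1,2,3,5) S(4)[of "br brk (\<lambda>y. sh (?f c) ?u y) ?v w'"] R1 R2
        distrib_left[of "sg (wdeg ?v * wdeg ?w) :: 'k"]
      by (simp only: add_ac)
    finally show ?thesis unfolding e .
  qed
qed

text \<open>Corresponding shuffles differ by an exchange of the bracketed pair, and its Koszul sign
  cancels against the one in \<open>[a, b] = - sg (fst a * fst b) [b, a]\<close>. This transfers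
  well-definedness of the bracket from its first argument to the second.\<close>

lemma br_antisym:
  "\<lbrakk>\<And>a b p q. \<lbrakk>P a; P b\<rbrakk> \<Longrightarrow>
      \<chi> (p @ bl brk a b # q) = - sg (fst a * fst b) * \<chi> (p @ bl brk b a # q);
    list_all P v; list_all P w\<rbrakk>
   \<Longrightarrow> br brk \<chi> v w = - sg (wdeg v * wdeg w) * br brk \<chi> w v"
proof (induction brk \<chi> v w rule: br.induct)
  case (3 brk \<chi> a v b w)
  have P: "P a" "P b" "list_all P v" "list_all P w" using "3.prems" by auto
  have *: "\<chi> (c # p @ bl brk x y # q) = - sg (fst x * fst y) * \<chi> (c # p @ bl brk y x # q)"
    if "P x" "P y" for c x y p q
    using "3.prems"(1)[OF that, of "c # p" q] by simp
  have IH1: "br brk (\<lambda>z. \<chi> (a # z)) v (b # w)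
      = - sg (wdeg v * wdeg (b # w)) * br brk (\<lambda>z. \<chi> (a # z)) (b # w) v"
    by (rule "3.IH"(1), rule *, assumption+) (use P in simp_all)
  have IH2: "br brk (\<lambda>z. \<chi> (b # z)) (a # v) w
      = - sg (wdeg (a # v) * wdeg w) * br brk (\<lambda>z. \<chi> (b # z)) w (a # v)"
    by (rule "3.IH"(2), rule *, assumption+) (use P in simp_all)
  have "(\<lambda>z. \<chi> (bl brk a b # z)) = (\<lambda>z. - sg (fst a * fst b) * \<chi> (bl brk b a # z))"
    using "3.prems"(1)[OF P(1,2), of "[]"] by auto
  then have S: "sh (\<lambda>z. \<chi> (bl brk a b # z)) v w
      = - sg (fst a * fst b) * (sg (wdeg v * wdeg w) * sh (\<lambda>z. \<chi> (bl brk b a # z)) w v)"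
    by (simp only: sh_mult sh_commute[of _ v w])
  show ?case
    unfolding br.simps(3) IH1 IH2 S
    by (cases "even (fst a)"; cases "even (fst b)"; cases "even (wdeg v)"; cases "even (wdeg w)";
         simp add: sg_def)
qed simp_all

fun cutf :: "('v letter list \<Rightarrow> 'v letter list \<Rightarrow> 'k::field) \<Rightarrow> 'v letter list \<Rightarrow> 'k" where
  "cutf \<beta> [] = \<beta> [] []"
| "cutf \<beta> (a # z) = \<beta> [] (a # z) + cutf (\<lambda>p. \<beta> (a # p)) z"

lemma cutf_add: "cutf (\<lambda>p q. f p q + g p q) z = cutf f z + cutf g z"
  by (induction z arbitrary: f g) (simp_all add: algebra_simps)

lemma cutf_mult: "cutf (\<lambda>p q. c * f p q) z = c * cutf f z"
  by (induction z arbitrary: f) (simp_all add: algebra_simps)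

lemma cutf_zero: "cutf (\<lambda>p q. 0) z = 0"
  using cutf_mult[of 0 "\<lambda>_ _. 0" z] by simp

lemma cutf_cong: "(\<And>p q. p @ q = z \<Longrightarrow> f p q = g p q) \<Longrightarrow> cutf f z = cutf g z"
proof (induction z arbitrary: f g)
  case (Cons a z)
  have "cutf (\<lambda>p. f (a # p)) z = cutf (\<lambda>p. g (a # p)) z"
    by (rule Cons.IH) (simp add: Cons.prems)
  then show ?case by (simp add: Cons.prems)
qed simp

lemma cutf_Nil_right:
  "cutf (\<lambda>p q. if q = [] then f p else 0) z = f z"
  by (induction z arbitrary: f) (simp_all)

lemma cutf_Nil_left:
  "cutf (\<lambda>p q. if p = [] then f q else 0) z = f z"
  by (cases z) (simp_all add: cutf_zero)

text \<open>Deconcatenation is multiplicative for the shuffle product.\<close>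

lemma sh_cutf:
  "sh (cutf \<beta>) v w = cutf (\<lambda>v1 v2. cutf (\<lambda>w1 w2.
     sg (wdeg w1 * wdeg v2) * sh (\<lambda>p. sh (\<beta> p) v2 w2) v1 w1) w) v"
proof (induction "length v + length w" arbitrary: \<beta> v w rule: less_induct)
  case less
  show ?case
  proof (cases "v = [] \<or> w = []")
    case True
    then show ?thesis by auto
  next
    case False
    then obtain a v' b w' where e: "v = a # v'" "w = b # w'"
      by (metis neq_Nil_conv)
    let ?v = "a # v'" and ?w = "b # w'"
    let ?f = "\<lambda>q p. \<beta> (q # p)"
    have Ia: "sh (cutf (?f a)) v' ?w = cutf (\<lambda>v1 v2. cutf (\<lambda>w1 w2.
        sg (wdeg w1 * wdeg v2) * sh (\<lambda>p. sh (?f a p) v2 w2) v1 w1) ?w) v'"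
     and Ib: "sh (cutf (?f b)) ?v w' = cutf (\<lambda>v1 v2. cutf (\<lambda>w1 w2.
        sg (wdeg w1 * wdeg v2) * sh (\<lambda>p. sh (?f b p) v2 w2) v1 w1) w') ?v"
      by (intro less; simp add: e)+
    \<comment> \<open>The first piece is empty, or begins with \<open>a\<close>, or begins with
      \<open>b\<close>.\<close>
    have L: "sh (cutf \<beta>) ?v ?w
        = sh (\<beta> []) ?v ?w + sh (cutf (?f a)) v' ?w + sg (fst b * wdeg ?v) * sh (cutf (?f b)) ?v w'"
      by (simp add: sh.simps(3)[of "cutf \<beta>"] sh.simps(3)[of "\<beta> []"] sh_add distrib_left)
    have b: "sg (fst b * wdeg ?v) * sh (cutf (?f b)) ?v w'
      = cutf (\<lambda>w1 w2. sg (wdeg (b # w1) * wdeg ?v) * sh (?f b w1) ?v w2) w'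
      + cutf (\<lambda>v1 v2. cutf (\<lambda>w1 w2. sg (wdeg (b # w1) * wdeg v2) *
           (sg (fst b * wdeg (a # v1)) * sh (\<lambda>p. sh (?f b p) v2 w2) (a # v1) w1)) w') v'"
      unfolding Ib cutf.simps(2) distrib_left cutf_mult[symmetric]
      by (intro arg_cong2[of _ _ _ _ "(+)"] cutf_cong)
         (auto simp: sg_def)
    have m: "cutf (\<lambda>w1 w2. sg (wdeg w1 * wdeg v2) * sh (\<lambda>p. sh (\<beta> p) v2 w2) (a # v1) w1) ?w
      = cutf (\<lambda>w1 w2. sg (wdeg w1 * wdeg v2) * sh (\<lambda>p. sh (?f a p) v2 w2) v1 w1) ?w
      + cutf (\<lambda>w1 w2. sg (wdeg (b # w1) * wdeg v2) *
           (sg (fst b * wdeg (a # v1)) * sh (\<lambda>p. sh (?f b p) v2 w2) (a # v1) w1)) w'" for v1 v2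
      by (simp add: sh.simps(3)[of _ a v1 b] distrib_left cutf_add)
    have n: "cutf (\<lambda>w1 w2. sg (wdeg w1 * wdeg ?v) * sh (\<lambda>p. sh (\<beta> p) ?v w2) [] w1) ?w
      = sh (\<beta> []) ?v ?w + cutf (\<lambda>w1 w2. sg (wdeg (b # w1) * wdeg ?v) * sh (?f b w1) ?v w2) w'"
      by simp
    show ?thesis
      unfolding e L Ia b cutf.simps(2)[of _ a v'] n m cutf_add by (simp only: add_ac)
  qed
qed

text \<open>The bracketed letter lies in the first or in the second piece of a deconcatenation.\<close>

lemma br_cutf:
  "br brk (cutf \<beta>) v w = cutf (\<lambda>v1 v2. cutf (\<lambda>w1 w2. sg (wdeg w1 * wdeg v2) *
     (br brk (\<lambda>p. sh (\<beta> p) v2 w2) v1 w1 + sh (\<lambda>p. br brk (\<beta> p) v2 w2) v1 w1)) w) v"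
proof (induction "length v + length w" arbitrary: \<beta> v w rule: less_induct)
  case less
  show ?case
  proof (cases "v = [] \<or> w = []")
    case True
    then show ?thesis by (auto simp: cutf_zero sh_zero)
  next
    case False
    then obtain a v' b w' where e: "v = a # v'" "w = b # w'"
      by (metis neq_Nil_conv)
    let ?v = "a # v'" and ?w = "b # w'" and ?ab = "bl brk a b"
    let ?f = "\<lambda>q p. \<beta> (q # p)"
    let ?R = "\<lambda>\<beta> v1 v2 w1 w2. br brk (\<lambda>p. sh (\<beta> p) v2 w2) v1 w1 + sh (\<lambda>p. br brk (\<beta> p) v2 w2) v1 w1"
    have Ia: "br brk (cutf (?f a)) v' ?w = cutf (\<lambda>v1 v2. cutf (\<lambda>w1 w2.
        sg (wdeg w1 * wdeg v2) * ?R (?f a) v1 v2 w1 w2) ?w) v'"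
     and Ib: "br brk (cutf (?f b)) ?v w' = cutf (\<lambda>v1 v2. cutf (\<lambda>w1 w2.
        sg (wdeg w1 * wdeg v2) * ?R (?f b) v1 v2 w1 w2) w') ?v"
      by (intro less; simp add: e)+
    have L: "br brk (cutf \<beta>) ?v ?w = br brk (\<beta> []) ?v ?w + sg (fst b * wdeg v') * sh (cutf (?f ?ab)) v' w'
        + br brk (cutf (?f a)) v' ?w + sg (fst b * wdeg ?v) * br brk (cutf (?f b)) ?v w'"
      by (simp add: br.simps(3)[of _ "cutf \<beta>"] br.simps(3)[of _ "\<beta> []"] br_add sh_add distrib_left)
    have b: "sg (fst b * wdeg ?v) * br brk (cutf (?f b)) ?v w'
      = cutf (\<lambda>w1 w2. sg (wdeg (b # w1) * wdeg ?v) * br brk (?f b w1) ?v w2) w'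
      + cutf (\<lambda>v1 v2. cutf (\<lambda>w1 w2. sg (wdeg (b # w1) * wdeg v2) *
           (sg (fst b * wdeg (a # v1)) * ?R (?f b) (a # v1) v2 w1 w2)) w') v'"
      unfolding Ib cutf.simps(2) distrib_left[of "sg (fst b * wdeg ?v)"] cutf_mult[symmetric]
      by (intro arg_cong2[of _ _ _ _ "(+)"] cutf_cong)
         (auto simp: sg_def)
    have ab: "sg (fst b * wdeg v') * sh (cutf (?f ?ab)) v' w'
      = cutf (\<lambda>v1 v2. cutf (\<lambda>w1 w2. sg (wdeg (b # w1) * wdeg v2) *
           (sg (fst b * wdeg v1) * sh (\<lambda>p. sh (?f ?ab p) v2 w2) v1 w1)) w') v'"
      unfolding sh_cutf cutf_mult[symmetric]
      by (intro cutf_cong) (auto simp: sg_def)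
    have m: "cutf (\<lambda>w1 w2. sg (wdeg w1 * wdeg v2) * ?R \<beta> (a # v1) v2 w1 w2) ?w
      = cutf (\<lambda>w1 w2. sg (wdeg w1 * wdeg v2) * ?R (?f a) v1 v2 w1 w2) ?w
      + cutf (\<lambda>w1 w2. sg (wdeg (b # w1) * wdeg v2) *
           (sg (fst b * wdeg v1) * sh (\<lambda>p. sh (?f ?ab p) v2 w2) v1 w1)) w'
      + cutf (\<lambda>w1 w2. sg (wdeg (b # w1) * wdeg v2) *
           (sg (fst b * wdeg (a # v1)) * ?R (?f b) (a # v1) v2 w1 w2)) w'" for v1 v2
      by (simp add: sh.simps(3)[of _ a v1 b] br.simps(3)[of _ _ a v1 b] distrib_left cutf_add)
    have n: "cutf (\<lambda>w1 w2. sg (wdeg w1 * wdeg ?v) * ?R \<beta> [] ?v w1 w2) ?w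
      = br brk (\<beta> []) ?v ?w + cutf (\<lambda>w1 w2. sg (wdeg (b # w1) * wdeg ?v) * br brk (?f b w1) ?v w2) w'"
      by simp
    show ?thesis
      unfolding e L Ia b ab cutf.simps(2)[of _ a v'] n m cutf_add by (simp only: add_ac)
  qed
qed

section \<open>Functionals on quotients of free spaces\<close>

definition pair :: "('a \<Rightarrow> 'k::field) \<Rightarrow> ('a \<Rightarrow>\<^sub>0 'k) \<Rightarrow> 'k" where
  "pair \<chi> p = (\<Sum>w\<in>Poly_Mapping.keys p. Poly_Mapping.lookup p w * \<chi> w)"

lemma pair_superset:
  "\<lbrakk>finite S; Poly_Mapping.keys p \<subseteq> S\<rbrakk> \<Longrightarrow> pair \<chi> p = (\<Sum>w\<in>S. Poly_Mapping.lookup p w * \<chi> w)"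
  unfolding pair_def by (rule sum.mono_neutral_left) (auto simp: in_keys_iff)

lemma pair_add: "pair \<chi> (p + q) = pair \<chi> p + pair \<chi> q"
proof -
  let ?S = "Poly_Mapping.keys p \<union> Poly_Mapping.keys q"
  have "finite ?S" "Poly_Mapping.keys (p + q) \<subseteq> ?S"
    by (simp_all add: keys_add)
  then show ?thesis
    by (simp add: pair_superset[of ?S] lookup_add distrib_right sum.distrib)
qed

lemma pair_fscale: "pair \<chi> (fscale c p) = c * pair \<chi> p"
proof -
  have "Poly_Mapping.keys (fscale c p) \<subseteq> Poly_Mapping.keys p"
    by (auto simp: in_keys_iff)
  then show ?thesis
    by (simp add: pair_superset[of "Poly_Mapping.keys p"] sum_distrib_left mult.assoc)
qed

lemma pair_0 [simp]: "pair \<chi> 0 = 0"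
  by (simp add: pair_def)

lemma pair_single [simp]: "pair \<chi> (Poly_Mapping.single w c) = c * \<chi> w"
  by (cases "c = 0") (simp_all add: pair_def)

lemma pair_uminus: "pair \<chi> (- p) = - pair \<chi> p"
  using pair_fscale[of \<chi> "- 1" p] by simp

lemma pair_diff: "pair \<chi> (p - q) = pair \<chi> p - pair \<chi> q"
  using pair_add[of \<chi> p "- q"] by (simp add: pair_uminus)

lemma pair_sum: "pair \<chi> (\<Sum>i\<in>I. f i) = (\<Sum>i\<in>I. pair \<chi> (f i))"
  by (induction I rule: infinite_finite_induct) (simp_all add: pair_add)

lemma pair_fun_add: "pair (\<lambda>w. f w + g w) p = pair f p + pair g p"
  by (simp add: pair_def distrib_left sum.distrib)

lemma pair_fun_mult: "pair (\<lambda>w. c * f w) p = c * pair f p"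
  by (simp add: pair_def sum_distrib_left mult.left_commute)

lemma pair_cong: "(\<And>w. w \<in> Poly_Mapping.keys p \<Longrightarrow> f w = g w) \<Longrightarrow> pair f p = pair g p"
  by (simp add: pair_def)

lemma pair_swap: "pair (\<lambda>w. pair (\<lambda>z. f w z) q) p = pair (\<lambda>z. pair (\<lambda>w. f w z) p) q"
  unfolding pair_def sum_distrib_left
  by (subst sum.swap) (simp add: mult.left_commute)

definition lext :: "('a \<Rightarrow> ('b \<Rightarrow>\<^sub>0 'k::field)) \<Rightarrow> ('a \<Rightarrow>\<^sub>0 'k) \<Rightarrow> ('b \<Rightarrow>\<^sub>0 'k)" where
  "lext G p = (\<Sum>w\<in>Poly_Mapping.keys p. fscale (Poly_Mapping.lookup p w) (G w))"

lemma pair_lext: "pair \<chi> (lext G p) = pair (\<lambda>w. pair \<chi> (G w)) p"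
  by (simp add: lext_def pair_sum pair_fscale pair_def[of "\<lambda>w. pair \<chi> (G w)"])

lemma lookup_lext: "Poly_Mapping.lookup (lext G p) z = pair (\<lambda>w. Poly_Mapping.lookup (G w) z) p"
  by (simp add: lext_def lookup_sum pair_def)

lemma keys_fscale: "Poly_Mapping.keys (fscale c p) \<subseteq> Poly_Mapping.keys p"
  by (auto simp: in_keys_iff)

lemma keys_sum_subset: "(\<And>i. i \<in> I \<Longrightarrow> Poly_Mapping.keys (f i) \<subseteq> A) \<Longrightarrow> Poly_Mapping.keys (\<Sum>i\<in>I. f i) \<subseteq> A"
proof (induction I rule: infinite_finite_induct)
  case (insert i I)
  then have "Poly_Mapping.keys (f i + sum f I) \<subseteq> A"
    by (intro subset_trans[OF keys_add]) simp
  then show ?case using insert.hyps by simp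
qed auto

lemma keys_lext: "(\<And>w. w \<in> Poly_Mapping.keys p \<Longrightarrow> Poly_Mapping.keys (G w) \<subseteq> A) \<Longrightarrow> Poly_Mapping.keys (lext G p) \<subseteq> A"
  unfolding lext_def by (intro keys_sum_subset subset_trans[OF keys_fscale])

lemma lext_single: "lext G (Poly_Mapping.single w 1) = G w"
  by (rule poly_mapping_eqI) (simp add: lext_def)

lemma pair_span: "\<lbrakk>\<And>e. e \<in> E \<Longrightarrow> pair \<chi> e = 0; p \<in> free.span E\<rbrakk> \<Longrightarrow> pair \<chi> p = 0"
  by (rotate_tac 1, induction rule: free.span_induct_alt) (auto simp: pair_add pair_fscale)

lemma linear_eq_pair:
  assumes "Vector_Spaces.linear fscale ((*) :: 'k::field \<Rightarrow> _) g"
  shows "g p = pair (\<lambda>w. g (Poly_Mapping.single w 1)) p"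
proof -
  interpret Vector_Spaces.linear fscale "(*)" g by (rule assms)
  have "lext (\<lambda>w. Poly_Mapping.single w 1) p = p"
    by (rule poly_mapping_eqI)
       (simp add: lookup_lext pair_def lookup_single when_def in_keys_iff if_distrib cong: if_cong)
  then have "g p = g (lext (\<lambda>w. Poly_Mapping.single w 1) p)" by simp
  also have "\<dots> = pair (\<lambda>w. g (Poly_Mapping.single w 1)) p"
    by (simp add: lext_def pair_def sum scale)
  finally show ?thesis .
qed

text \<open>A basis of the span of \<open>E\<close> stays independent when \<open>p\<close> is
  added; the coordinate of \<open>p\<close>, extended to the whole space, vanishes on
  \<open>E\<close> but not at \<open>p\<close>.\<close>

lemma span_separation:
  fixes p :: "'a \<Rightarrow>\<^sub>0 'k::field"
  assumes "p \<notin> free.span E"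
  obtains \<chi> where "\<And>e. e \<in> E \<Longrightarrow> pair \<chi> e = 0" "pair \<chi> p \<noteq> 0"
proof -
  interpret vector_space_pair "fscale :: 'k \<Rightarrow> ('a \<Rightarrow>\<^sub>0 'k) \<Rightarrow> _" "(*) :: 'k \<Rightarrow> 'k \<Rightarrow> 'k"
    by unfold_locales (auto simp: algebra_simps)
  obtain B where B: "B \<subseteq> E" "free.independent B" "E \<subseteq> free.span B"
    by (rule free.maximal_independent_subset)
  have "free.span B \<subseteq> free.span E"
    by (rule free.span_mono) (rule B)
  with assms have pB: "p \<notin> free.span B" by blast
  then have "free.independent (insert p B)"
    using B free.independent_insertI by blast
  then obtain g where g: "Vector_Spaces.linear fscale (*) g"
      "\<forall>x\<in>insert p B. g x = (if x = p then 1 else 0)"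
    using linear_independent_extend[of "insert p B" "\<lambda>x. if x = p then 1 else 0"] by blast
  let ?\<chi> = "\<lambda>w. g (Poly_Mapping.single w 1)"
  have eq: "g q = pair ?\<chi> q" for q
    by (rule linear_eq_pair) (rule g)
  have "pair ?\<chi> b = 0" if "b \<in> B" for b
  proof -
    have "b \<noteq> p" using that pB free.span_base by blast
    then have "g b = 0" using g(2) that by auto
    then show ?thesis by (simp only: eq[of b, symmetric])
  qed
  then have "pair ?\<chi> e = 0" if "e \<in> E" for e
    by (rule pair_span[of B]) (use B(3) that in auto)
  moreover have "pair ?\<chi> p \<noteq> 0"
    using g(2) by (simp only: eq[of p, symmetric]) simp
  ultimately show ?thesis by (rule that)
qed

lemma tcls_eq_iff: "tcls E p = tcls E q \<longleftrightarrow> p - q \<in> free.span E"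
proof
  assume "tcls E p = tcls E q"
  moreover have "p \<in> tcls E p" by (simp add: tcls_def free.span_zero)
  ultimately show "p - q \<in> free.span E" by (simp add: tcls_def)
next
  assume *: "p - q \<in> free.span E"
  have "r - q \<in> free.span E \<longleftrightarrow> r - p \<in> free.span E" for r
    using free.span_add[OF _ *, of "r - p"] free.span_diff[OF _ *, of "r - q"] by auto
  then show "tcls E p = tcls E q" by (simp add: tcls_def)
qed

lemma tcls_self: "p \<in> tcls E p"
  by (simp add: tcls_def free.span_zero)

lemma tcls_mem: "q \<in> tcls E p \<Longrightarrow> tcls E q = tcls E p"
  by (simp add: tcls_eq_iff) (simp add: tcls_def)

lemma gadd_tcls: "gadd (gquot A E) (tcls E p) (tcls E q) = tcls E (p + q)"
proof -
  have "r \<in> tcls E (p + q) \<longleftrightarrow> (\<exists>x y. r = x + y \<and> x \<in> tcls E p \<and> y \<in> tcls E q)" for r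
  proof
    assume "r \<in> tcls E (p + q)"
    then have "r = (r - q) + q \<and> r - q \<in> tcls E p \<and> q \<in> tcls E q"
      using tcls_self by (simp add: tcls_def algebra_simps)
    then show "\<exists>x y. r = x + y \<and> x \<in> tcls E p \<and> y \<in> tcls E q" by blast
  next
    assume "\<exists>x y. r = x + y \<and> x \<in> tcls E p \<and> y \<in> tcls E q"
    then obtain x y where r: "r = x + y" "x - p \<in> free.span E" "y - q \<in> free.span E"
      by (auto simp: tcls_def)
    have "r - (p + q) = (x - p) + (y - q)" by (simp add: r(1))
    also have "\<dots> \<in> free.span E" by (intro free.span_add r)
    finally show "r \<in> tcls E (p + q)" by (simp add: tcls_def)
  qed
  then show ?thesis by (simp add: gquot_def) blast
qed

lemma gscale_tcls: "gscale (gquot A E) c (tcls E p) = tcls E (fscale c p)"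
proof -
  have "tcls E (fscale c q) = tcls E (fscale c p)" if "q \<in> tcls E p" for q
  proof -
    have "fscale c (q - p) \<in> free.span E"
      using that by (intro free.span_scale) (simp add: tcls_def)
    then show ?thesis by (simp add: tcls_eq_iff free.scale_right_diff_distrib)
  qed
  then have "(\<Union>q\<in>tcls E p. tcls E (fscale c q)) = tcls E (fscale c p)"
    using tcls_self by blast
  then show ?thesis by (simp add: gquot_def)
qed

lemma gcarrier_gquot: "gcarrier (gquot A E) = {tcls E p |p. Poly_Mapping.keys p \<subseteq> A}"
  by (simp add: gquot_def)

lemma comp_gquot: "comp (gquot A E) d = {tcls E p |p. Poly_Mapping.keys p \<subseteq> {w \<in> A. wdeg w = d}}"
  by (simp add: gquot_def)

definition rel_on :: "'a set \<Rightarrow> ('a \<Rightarrow>\<^sub>0 'k::field) set \<Rightarrow> bool" where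
  "rel_on A E \<longleftrightarrow> (\<forall>e\<in>E. Poly_Mapping.keys e \<subseteq> A)"

text \<open>The linear functionals on the quotient, given by their values on words. The value 0
  outside \<open>A\<close> makes this description unique and lets relations be stated for all
  lists.\<close>

definition adm :: "'a set \<Rightarrow> ('a \<Rightarrow>\<^sub>0 'k::field) set \<Rightarrow> ('a \<Rightarrow> 'k) \<Rightarrow> bool" where
  "adm A E \<chi> \<longleftrightarrow> (\<forall>e\<in>E. pair \<chi> e = 0) \<and> (\<forall>w. w \<notin> A \<longrightarrow> \<chi> w = 0)"

lemma adm_pair_eq: "\<lbrakk>adm A E \<chi>; tcls E p = tcls E q\<rbrakk> \<Longrightarrow> pair \<chi> p = pair \<chi> q"
  using pair_span[of E \<chi> "p - q"] by (auto simp: adm_def tcls_eq_iff pair_diff)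

lemma adm_off: "\<lbrakk>adm A E \<chi>; w \<notin> A\<rbrakk> \<Longrightarrow> \<chi> w = 0"
  by (simp add: adm_def)

lemma pair_restrict:
  "Poly_Mapping.keys p \<subseteq> A \<Longrightarrow> pair (\<lambda>w. if w \<in> A then \<chi> w else 0) p = pair \<chi> p"
  by (rule pair_cong) auto

lemma tcls_eqI:
  assumes "rel_on A E" "Poly_Mapping.keys p \<subseteq> A" "Poly_Mapping.keys q \<subseteq> A"
    and "\<And>\<chi>. adm A E \<chi> \<Longrightarrow> pair \<chi> p = pair \<chi> q"
  shows "tcls E p = tcls E q"
proof (rule ccontr)
  assume "tcls E p \<noteq> tcls E q"
  then have "p - q \<notin> free.span E" by (simp add: tcls_eq_iff)
  then obtain \<chi> where \<chi>: "\<And>e. e \<in> E \<Longrightarrow> pair \<chi> e = 0" "pair \<chi> (p - q) \<noteq> 0"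
    using span_separation by blast
  \<comment> \<open>The separating functional is cut off outside \<open>A\<close>. The relations and
    both representatives live on \<open>A\<close>, so their pairings do not change.\<close>
  let ?\<chi> = "\<lambda>w. if w \<in> A then \<chi> w else 0"
  have "adm A E ?\<chi>"
    using assms(1) \<chi>(1) by (auto simp: adm_def rel_on_def pair_restrict)
  then have "pair ?\<chi> p = pair ?\<chi> q" by (rule assms(4))
  then show False using \<chi>(2) assms(2,3) by (simp add: pair_restrict pair_diff)
qed

definition ev :: "('a \<Rightarrow> 'k::field) \<Rightarrow> ('a \<Rightarrow>\<^sub>0 'k) set \<Rightarrow> 'k" where
  "ev \<chi> C = pair \<chi> (SOME p. p \<in> C)"

lemma ev_tcls: "adm A E \<chi> \<Longrightarrow> ev \<chi> (tcls E p) = pair \<chi> p"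
  unfolding ev_def by (rule adm_pair_eq, assumption, rule tcls_mem, rule someI, rule tcls_self)

lemma formal_induct [consumes 1, case_names zero single add scale]:
  fixes p :: "'a \<Rightarrow>\<^sub>0 'k::field"
  assumes "Poly_Mapping.keys p \<subseteq> A" and "P 0"
    and "\<And>w. w \<in> A \<Longrightarrow> P (Poly_Mapping.single w 1)"
    and "\<And>p q. \<lbrakk>Poly_Mapping.keys p \<subseteq> A; Poly_Mapping.keys q \<subseteq> A; P p; P q\<rbrakk> \<Longrightarrow> P (p + q)"
    and "\<And>c p. \<lbrakk>Poly_Mapping.keys p \<subseteq> A; P p\<rbrakk> \<Longrightarrow> P (fscale c p)"
  shows "P p"
proof -
  let ?m = "\<lambda>w. fscale (Poly_Mapping.lookup p w) (Poly_Mapping.single w 1)"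
  have "P (sum ?m S) \<and> Poly_Mapping.keys (sum ?m S) \<subseteq> A" if "finite S" "S \<subseteq> A" for S
    using that
  proof (induction S)
    case (insert w S)
    have k: "Poly_Mapping.keys (Poly_Mapping.single w (1::'k)) \<subseteq> A" using insert by simp
    have k': "Poly_Mapping.keys (?m w) \<subseteq> A" by (rule subset_trans[OF keys_fscale k])
    have "P (?m w)" using insert k by (intro assms) auto
    moreover have "P (sum ?m S)" "Poly_Mapping.keys (sum ?m S) \<subseteq> A" using insert by auto
    ultimately have "P (?m w + sum ?m S) \<and> Poly_Mapping.keys (?m w + sum ?m S) \<subseteq> A"
      using k' by (intro conjI assms(4) subset_trans[OF keys_add]) simp_all
    then show ?case
      using insert.hyps by simp
  qed (use assms(2) in simp)
  then have "P (sum ?m (Poly_Mapping.keys p))" using assms(1) by simp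
  moreover have "sum ?m (Poly_Mapping.keys p) = p"
    by (rule poly_mapping_eqI)
       (simp add: lookup_sum lookup_single when_def if_distrib in_keys_iff cong: if_cong)
  ultimately show ?thesis by simp
qed

lemma lext_add: "lext G (p + q) = lext G p + lext G q"
  by (rule poly_mapping_eqI) (simp add: lookup_lext pair_add lookup_add)

lemma lext_fscale: "lext G (fscale c p) = fscale c (lext G p)"
  by (rule poly_mapping_eqI) (simp add: lookup_lext pair_fscale)

lemma lext_0 [simp]: "lext G 0 = 0"
  by (simp add: lext_def)

lemma glinear_zero:
  assumes "glinear (gquot A E) (gquot A' E') f"
  shows "f (tcls E 0) = tcls E' 0"
proof -
  have c: "tcls E 0 \<in> gcarrier (gquot A E)"
    unfolding gcarrier_gquot by (rule CollectI, rule exI[of _ 0]) simp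
  then have "f (tcls E 0) \<in> gcarrier (gquot A' E')"
    using assms by (simp add: glinear_def)
  then obtain r where r: "f (tcls E 0) = tcls E' r" by (auto simp: gcarrier_gquot)
  have "f (gscale (gquot A E) 0 (tcls E 0)) = gscale (gquot A' E') 0 (f (tcls E 0))"
    using assms c by (simp add: glinear_def)
  then show ?thesis by (simp add: r gscale_tcls)
qed

lemma tcls_in_gcarrier: "Poly_Mapping.keys p \<subseteq> A \<Longrightarrow> tcls E p \<in> gcarrier (gquot A E)"
  by (auto simp: gcarrier_gquot)

text \<open>Makes a map selected by \<open>SOME\<close> computable: its values on words determine it
  on every class.\<close>

lemma glinear_tcls:
  assumes f: "glinear (gquot A E) (gquot A' E') f"
    and G: "\<And>w. w \<in> A \<Longrightarrow> f (tcls E (Poly_Mapping.single w 1)) = tcls E' (G w)"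
    and p: "Poly_Mapping.keys p \<subseteq> A"
  shows "f (tcls E p) = tcls E' (lext G p)"
  using p
proof (induction rule: formal_induct)
  case zero
  then show ?case using glinear_zero[OF f] by simp
next
  case (single w)
  then show ?case by (simp add: G lext_single)
next
  case (add p q)
  then have "f (gadd (gquot A E) (tcls E p) (tcls E q)) = gadd (gquot A' E') (f (tcls E p)) (f (tcls E q))"
    using f by (simp add: glinear_def tcls_in_gcarrier)
  then show ?case using add by (simp add: gadd_tcls lext_add)
next
  case (scale c p)
  then have "f (gscale (gquot A E) c (tcls E p)) = gscale (gquot A' E') c (f (tcls E p))"
    using f by (simp add: glinear_def tcls_in_gcarrier)
  then show ?case using scale by (simp add: gscale_tcls lext_fscale)
qed

text \<open>Well-definedness in transposed form: \<open>resp\<close> asks that functionals stay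
  admissible when pulled back along \<open>G\<close>. The images of two representatives of one class
  then have equal pairings, hence equal classes by \<open>tcls_eqI\<close>.\<close>

lemma glinear_exists:
  assumes A: "rel_on A E" "rel_on A' E'"
    and G: "\<And>w. w \<in> A \<Longrightarrow> Poly_Mapping.keys (G w) \<subseteq> A'"
    and resp: "\<And>\<chi>. adm A' E' \<chi> \<Longrightarrow> adm A E (\<lambda>w. if w \<in> A then pair \<chi> (G w) else 0)"
  shows "\<exists>f. glinear (gquot A E) (gquot A' E') f
    \<and> (\<forall>w\<in>A. f (tcls E (Poly_Mapping.single w 1)) = tcls E' (G w))"
proof -
  define G' where "G' w = (if w \<in> A then G w else 0)" for w
  define f where "f C = tcls E' (lext G' (SOME p. p \<in> C))" for C
  have k: "Poly_Mapping.keys (lext G' p) \<subseteq> A'" for p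
    by (rule keys_lext) (simp add: G'_def G)
  have pG: "pair \<chi> (lext G' p) = pair (\<lambda>w. if w \<in> A then pair \<chi> (G w) else 0) p" for \<chi> p
    unfolding pair_lext by (rule pair_cong) (simp add: G'_def)
  have f: "f (tcls E p) = tcls E' (lext G' p)" for p
    unfolding f_def
  proof (rule tcls_eqI[OF A(2) k k])
    fix \<chi> assume \<chi>: "adm A' E' \<chi>"
    have "tcls E (SOME q. q \<in> tcls E p) = tcls E p"
      by (rule tcls_mem, rule someI, rule tcls_self)
    then show "pair \<chi> (lext G' (SOME q. q \<in> tcls E p)) = pair \<chi> (lext G' p)"
      unfolding pG by (rule adm_pair_eq[OF resp[OF \<chi>]])
  qed
  have "glinear (gquot A E) (gquot A' E') f"
    unfolding glinear_def gcarrier_gquot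
    using tcls_in_gcarrier[OF k, of E'] by (auto simp: f gadd_tcls gscale_tcls lext_add lext_fscale gcarrier_gquot)
  moreover have "\<forall>w\<in>A. f (tcls E (Poly_Mapping.single w 1)) = tcls E' (G w)"
    by (simp add: f lext_single G'_def)
  ultimately show ?thesis by blast
qed

section \<open>Koszul signs and sums over shuffles\<close>

lemma prod_list_sg: "(\<Prod>j\<leftarrow>l. (-1) powi (c * d j)) = (sg (c * sum_list (map d l)) :: 'k::field)"
  by (induction l) (simp_all add: powi_eq_sg distrib_left sg_add)

lemma ksign_Cons: "ksign d (i # is) = sg (d i * (\<Sum>j\<leftarrow>filter (\<lambda>j. j < i) is. d j)) * ksign d is"
  by (simp add: prod_list_sg)

declare ksign.simps(2) [simp del]

lemma ksign_sorted: "sorted_wrt (<) is \<Longrightarrow> ksign d is = 1"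
proof (induction "is")
  case (Cons i "is")
  then have "filter (\<lambda>j. j < i) is = []"
    by (intro filter_False) (auto dest: order.asym)
  with Cons show ?case by (simp add: ksign_Cons)
qed simp

lemma sorted_wrt_filter_iff: "sorted_wrt R (filter P xs) \<longleftrightarrow> sorted_wrt (\<lambda>x y. P x \<longrightarrow> P y \<longrightarrow> R x y) xs"
  by (induction xs) auto

text \<open>A permutation is recorded by the list of values of its inverse. That \<sigma> increases
  on both blocks means that each block occurs in increasing order in this list, which is thus a
  shuffle of two intervals. Sums over permutations become sums over shuffles, which obey a
  recursion.\<close>

lemma bij_betw_Bat:
  "bij_betw (\<lambda>\<sigma>. map (inv \<sigma>) [0..<p + q]) (Bat p q) (shuffles [0..<p] [p..<p + q])"
  unfolding bij_betw_def
proof (intro conjI equalityI subsetI inj_onI)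
  let ?n = "p + q"
  fix \<sigma> \<tau> assume st: "\<sigma> \<in> Bat p q" "\<tau> \<in> Bat p q" and eq: "map (inv \<sigma>) [0..<?n] = map (inv \<tau>) [0..<?n]"
  have s: "\<sigma> permutes {..<?n}" and t: "\<tau> permutes {..<?n}"
    using st by (auto simp: Bat_def)
  have "inv \<sigma> i = inv \<tau> i" for i
  proof (cases "i < ?n")
    case True
    then show ?thesis using eq by (auto simp: map_eq_conv)
  next
    case False
    then show ?thesis
      using permutes_not_in[OF permutes_inv[OF s], of i] permutes_not_in[OF permutes_inv[OF t], of i]
      by simp
  qed
  then have "inv \<sigma> = inv \<tau>" ..
  then show "\<sigma> = \<tau>"
    by (metis permutes_inv_inv s t)
next
  let ?n = "p + q"
  fix zs assume "zs \<in> (\<lambda>\<sigma>. map (inv \<sigma>) [0..<?n]) ` Bat p q"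
  then obtain \<sigma> where s: "\<sigma> permutes {..<?n}" "strict_mono_on {..<p} \<sigma>" "strict_mono_on {p..<?n} \<sigma>"
    and zs: "zs = map (inv \<sigma>) [0..<?n]"
    by (auto simp: Bat_def)
  have i: "inv \<sigma> permutes {..<?n}" by (rule permutes_inv[OF s(1)])
  have set: "set zs = {..<?n}"
    using permutes_image[OF i] by (simp add: zs atLeast_upt[symmetric] atLeast0LessThan)
  \<comment> \<open>Monotonicity is given for \<sigma> rather than for its inverse; two entries of
    one block in the wrong order would contradict it.\<close>
  have lt: "inv \<sigma> a < inv \<sigma> b" if "a < b" "b < ?n" "inv \<sigma> a < p \<longleftrightarrow> inv \<sigma> b < p" for a b
  proof (rule ccontr)
    assume "\<not> inv \<sigma> a < inv \<sigma> b"
    moreover have "inv \<sigma> a \<noteq> inv \<sigma> b"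
      using that permutes_inj[OF i] by (auto dest: injD)
    ultimately have l: "inv \<sigma> b < inv \<sigma> a" by simp
    have "inv \<sigma> a < ?n" "inv \<sigma> b < ?n"
      using permutes_in_image[OF i] that by auto
    then have "\<sigma> (inv \<sigma> b) < \<sigma> (inv \<sigma> a)"
      using l that s(2,3) by (cases "inv \<sigma> a < p") (auto simp: strict_mono_on_def)
    then show False
      using that by (simp add: permutes_inverses[OF s(1)])
  qed
  have "sorted_wrt (\<lambda>x y. (x < p \<longleftrightarrow> y < p) \<longrightarrow> x < y) zs"
    unfolding zs sorted_wrt_iff_nth_less
  proof (intro allI impI)
    fix a b
    assume "a < b" "b < length (map (inv \<sigma>) [0..<?n])"
      "(map (inv \<sigma>) [0..<?n] ! a < p) = (map (inv \<sigma>) [0..<?n] ! b < p)"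
    then show "map (inv \<sigma>) [0..<?n] ! a < map (inv \<sigma>) [0..<?n] ! b"
      using lt[of a b] by simp
  qed
  then have f1: "sorted_wrt (<) (filter (\<lambda>x. x < p) zs)"
    and f2: "sorted_wrt (<) (filter (\<lambda>x. \<not> x < p) zs)"
    unfolding sorted_wrt_filter_iff by (rule sorted_wrt_mono_rel[rotated]; simp)+
  have g1: "filter (\<lambda>x. x < p) zs = [0..<p]"
    by (rule strict_sorted_equal[OF _ f1]) (auto simp: set)
  have g2: "filter (\<lambda>x. \<not> x < p) zs = [p..<?n]"
    by (rule strict_sorted_equal[OF _ f2]) (auto simp: set)
  show "zs \<in> shuffles [0..<p] [p..<?n]"
    using partition_in_shuffles[of zs "\<lambda>x. x < p"] unfolding g1 g2 .
next
  let ?n = "p + q"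
  fix zs assume zs: "zs \<in> shuffles [0..<p] [p..<?n]"
  have set: "set zs = {..<?n}"
    unfolding set_shuffles[OF zs] by (simp add: lessThan_atLeast0 ivl_disj_un_two)
  have dist: "distinct zs" by (rule distinct_disjoint_shuffles[OF _ _ _ zs]) auto
  have len: "length zs = ?n" using length_shuffles[OF zs] by simp
  have "filter (\<lambda>x. x < p) zs = filter (\<lambda>x. x \<in> set [0..<p]) zs"
    "filter (\<lambda>x. \<not> x < p) zs = filter (\<lambda>x. x \<notin> set [0..<p]) zs"
    by (rule filter_cong; simp)+
  then have fl: "filter (\<lambda>x. x < p) zs = [0..<p]" "filter (\<lambda>x. \<not> x < p) zs = [p..<?n]"
    using filter_shuffles_disjoint1[OF _ zs] by simp_all
  define \<tau> where "\<tau> i = (if i < ?n then zs ! i else i)" for i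
  have "bij_betw \<tau> {..<?n} {..<?n} \<longleftrightarrow> bij_betw ((!) zs) {..<?n} {..<?n}"
    by (rule bij_betw_cong) (simp add: \<tau>_def)
  also have "\<dots>"
    by (rule bij_betw_nth[OF dist]) (simp_all add: len set)
  finally have "bij_betw \<tau> {..<?n} {..<?n}" .
  then have t: "\<tau> permutes {..<?n}"
    by (rule bij_imp_permutes) (simp add: \<tau>_def)
  define \<sigma> where "\<sigma> = inv \<tau>"
  have s: "\<sigma> permutes {..<?n}" and inv: "inv \<sigma> = \<tau>"
    using permutes_inv[OF t] permutes_inv_inv[OF t] by (simp_all add: \<sigma>_def)
  have lt: "\<sigma> a < \<sigma> b" if "a < b" "b < ?n" "a < p \<longleftrightarrow> b < p" for a b
  proof (rule ccontr)
    assume "\<not> \<sigma> a < \<sigma> b"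
    moreover have "\<sigma> a \<noteq> \<sigma> b" using that permutes_inj[OF s] by (auto dest: injD)
    ultimately have l: "\<sigma> b < \<sigma> a" by simp
    have n: "\<sigma> a < ?n" "\<sigma> b < ?n" using permutes_in_image[OF s] that by auto
    have "\<tau> (\<sigma> a) = a" "\<tau> (\<sigma> b) = b"
      unfolding \<sigma>_def by (simp_all add: permutes_inverses[OF t])
    then have nth: "zs ! \<sigma> a = a" "zs ! \<sigma> b = b"
      using n by (simp_all add: \<tau>_def)
    have w: "sorted_wrt (\<lambda>x y. x < p \<longrightarrow> y < p \<longrightarrow> x < y) zs"
      "sorted_wrt (\<lambda>x y. \<not> x < p \<longrightarrow> \<not> y < p \<longrightarrow> x < y) zs"
      unfolding sorted_wrt_filter_iff[symmetric] fl by simp_all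
    have "b < a"
      using sorted_wrt_nth_less[OF w(1) l] sorted_wrt_nth_less[OF w(2) l] n that len
      unfolding nth by auto
    then show False using that by simp
  qed
  have "\<sigma> \<in> Bat p q"
    using s lt by (auto simp: Bat_def strict_mono_on_def)
  moreover have "zs = map (inv \<sigma>) [0..<?n]"
    unfolding inv by (rule nth_equalityI) (simp_all add: len \<tau>_def)
  ultimately show "zs \<in> (\<lambda>\<sigma>. map (inv \<sigma>) [0..<?n]) ` Bat p q" by blast
qed

lemma mset_shuffles: "zs \<in> shuffles xs ys \<Longrightarrow> mset zs = mset xs + mset ys"
  by (induction xs ys arbitrary: zs rule: shuffles.induct) auto

lemma sum_shuffles:
  assumes "x \<noteq> y"
  shows "(\<Sum>zs\<in>shuffles (x # xs) (y # ys). f zs)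
    = (\<Sum>zs\<in>shuffles xs (y # ys). f (x # zs)) + (\<Sum>zs\<in>shuffles (x # xs) ys. f (y # zs))"
proof -
  have "(#) x ` shuffles xs (y # ys) \<inter> (#) y ` shuffles (x # xs) ys = {}"
    using assms by auto
  then show ?thesis
    by (simp add: sum.union_disjoint sum.reindex)
qed

lemma ksign_shuffle_left:
  assumes "zs \<in> shuffles xs ys" "\<forall>i\<in>set xs \<union> set ys. x < i"
  shows "ksign d (x # zs) = ksign d zs"
proof -
  have "filter (\<lambda>j. j < x) zs = []"
    using assms(2) set_shuffles[OF assms(1)] by (intro filter_False ballI) (auto dest: order.asym)
  then show ?thesis by (simp add: ksign_Cons)
qed

lemma ksign_shuffle_right:
  assumes zs: "zs \<in> shuffles xs ys" and "\<forall>i\<in>set xs. i < y" "\<forall>i\<in>set ys. y < i"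
  shows "ksign d (y # zs) = sg (d y * sum_list (map d xs)) * ksign d zs"
proof -
  have "mset (filter (\<lambda>j. j < y) zs) = mset (filter (\<lambda>j. j < y) (xs @ ys))"
    using mset_shuffles[OF zs] by simp
  also have "filter (\<lambda>j. j < y) (xs @ ys) = xs"
    using assms(2,3) by (auto simp: filter_empty_conv filter_id_conv)
  finally have "sum_list (map d (filter (\<lambda>j. j < y) zs)) = sum_list (map d xs)"
    by (metis mset_map sum_mset_sum_list)
  then show ?thesis by (simp add: ksign_Cons)
qed

lemma wdeg_map: "wdeg (map Z xs) = sum_list (map (\<lambda>i. fst (Z i)) xs)"
  by (simp add: wdeg_def o_def)

text \<open>Matches the signed sum with the recursion \<open>sh\<close>: an index of
  \<open>xs\<close> in front is the smallest and costs no sign, an index of \<open>ys\<close> in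
  front has passed all of \<open>xs\<close>.\<close>

lemma sum_shuffles_sh:
  "\<lbrakk>sorted_wrt (<) xs; sorted_wrt (<) ys; \<forall>x\<in>set xs. \<forall>y\<in>set ys. x < y\<rbrakk> \<Longrightarrow>
   (\<Sum>zs\<in>shuffles xs ys. ksign (\<lambda>i. fst (Z i)) zs * \<chi> (map Z zs)) = sh \<chi> (map Z xs) (map Z ys)"
proof (induction xs ys arbitrary: \<chi> rule: shuffles.induct)
  case (3 x xs y ys)
  let ?k = "ksign (\<lambda>i. fst (Z i))"
  have "(\<Sum>zs\<in>shuffles xs (y # ys). ?k (x # zs) * \<chi> (map Z (x # zs)))
      = (\<Sum>zs\<in>shuffles xs (y # ys). ?k zs * \<chi> (Z x # map Z zs))"
    using "3.prems" by (intro sum.cong refl) (subst ksign_shuffle_left, auto)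
  moreover have "(\<Sum>zs\<in>shuffles (x # xs) ys. ?k (y # zs) * \<chi> (map Z (y # zs)))
      = sg (fst (Z y) * wdeg (map Z (x # xs)))
        * (\<Sum>zs\<in>shuffles (x # xs) ys. ?k zs * \<chi> (Z y # map Z zs))"
    unfolding sum_distrib_left wdeg_map using "3.prems"
    by (intro sum.cong refl) (subst ksign_shuffle_right, auto simp: mult.assoc)
  ultimately show ?case
    using "3.prems" "3.IH"(1)[of "\<lambda>z. \<chi> (Z x # z)"] "3.IH"(2)[of "\<lambda>z. \<chi> (Z y # z)"]
    by (subst sum_shuffles) (auto simp: sh.simps(3))
qed (simp_all add: ksign_sorted)

lemma permute_list_map_nth: "permute_list f w = map ((!) w) (map f [0..<length w])"
  by (simp add: permute_list_def o_def)

lemma pair_bat: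
  assumes "p \<le> length w"
  shows "pair \<chi> (bat p w) = sh \<chi> (take p w) (drop p w)"
proof -
  let ?q = "length w - p"
  have n: "p + ?q = length w" using assms by simp
  have t: "map ((!) w) [0..<p] = take p w"
    using assms by (intro nth_equalityI) auto
  have d: "map ((!) w) [p..<length w] = drop p w"
    using assms by (intro nth_equalityI) auto
  have "pair \<chi> (bat p w) = (\<Sum>\<sigma>\<in>Bat p ?q. ksign (\<lambda>i. fst (w ! i)) (map (inv \<sigma>) [0..<p + ?q])
      * \<chi> (map ((!) w) (map (inv \<sigma>) [0..<p + ?q])))"
    by (simp add: bat_def pair_sum bat_sign_def n permute_list_map_nth)
  also have "\<dots> = (\<Sum>zs\<in>shuffles [0..<p] [p..<p + ?q]. ksign (\<lambda>i. fst (w ! i)) zs * \<chi> (map ((!) w) zs))"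
    by (rule sum.reindex_bij_betw[OF bij_betw_Bat])
  also have "\<dots> = sh \<chi> (take p w) (drop p w)"
    by (subst sum_shuffles_sh) (auto simp: n t d)
  finally show ?thesis .
qed

text \<open>The inner sum over k in the bracket of \<H> for one shuffle, given as a list of indices;
  \<open>p\<close> separates the indices of the first word from those of the second.\<close>

definition ctr :: "('v \<Rightarrow> 'v \<Rightarrow> 'v) \<Rightarrow> nat \<Rightarrow> (nat \<Rightarrow> 'v letter) \<Rightarrow> ('v letter list \<Rightarrow> 'k::field) \<Rightarrow> nat list \<Rightarrow> 'k"
where
  "ctr brk p Z \<chi> is = (\<Sum>k<length is - 1. if is ! k < p \<and> p \<le> is ! Suc k
     then \<chi> (map Z (take k is) @ bl brk (Z (is ! k)) (Z (is ! Suc k)) # map Z (drop (k + 2) is))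
     else 0)"

lemma ctr_Cons: "ctr brk p Z \<chi> (i # j # is)
   = (if i < p \<and> p \<le> j then \<chi> (bl brk (Z i) (Z j) # map Z is) else 0)
     + ctr brk p Z (\<lambda>z. \<chi> (Z i # z)) (j # is)"
  unfolding ctr_def by (simp add: sum.lessThan_Suc_shift del: sum.lessThan_Suc cong: if_cong)

lemma ctr_Cons': "is \<noteq> [] \<Longrightarrow> ctr brk p Z \<chi> (i # is)
   = (if i < p \<and> p \<le> hd is then \<chi> (bl brk (Z i) (Z (hd is)) # map Z (tl is)) else 0)
     + ctr brk p Z (\<lambda>z. \<chi> (Z i # z)) is"
  by (cases "is") (simp_all add: ctr_Cons)

lemma ctr_eq_0: "(\<forall>i\<in>set is. p \<le> i) \<or> (\<forall>i\<in>set is. i < p) \<Longrightarrow> ctr brk p Z \<chi> is = 0"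
  unfolding ctr_def
proof (intro sum.neutral ballI)
  fix k assume P: "(\<forall>i\<in>set is. p \<le> i) \<or> (\<forall>i\<in>set is. i < p)" and "k \<in> {..<length is - 1}"
  then have "is ! k \<in> set is" "is ! Suc k \<in> set is" by auto
  with P show "(if is ! k < p \<and> p \<le> is ! Suc k
      then \<chi> (map Z (take k is) @ bl brk (Z (is ! k)) (Z (is ! Suc k)) # map Z (drop (k + 2) is))
      else 0) = 0"
    by (meson linorder_not_less)
qed

lemma sum_shuffles_br:
  fixes \<chi> :: "'v letter list \<Rightarrow> 'k::field"
  shows "\<lbrakk>sorted_wrt (<) xs; sorted_wrt (<) ys; \<forall>x\<in>set xs. x < p; \<forall>y\<in>set ys. p \<le> y\<rbrakk> \<Longrightarrow>
   (\<Sum>zs\<in>shuffles xs ys. ksign (\<lambda>i. fst (Z i)) zs * ctr brk p Z \<chi> zs)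
     = br brk \<chi> (map Z xs) (map Z ys)"
proof (induction xs ys arbitrary: \<chi> rule: shuffles.induct)
  case (3 x xs y ys)
  let ?k = "ksign (\<lambda>i. fst (Z i))"
  let ?b = "bl brk (Z x) (Z y)"
  have xy: "\<forall>x\<in>set xs. \<forall>y\<in>set ys. x < y" "x < p" "p \<le> y" "x < y"
    using "3.prems" by (auto intro: order.strict_trans2)
  \<comment> \<open>The pair in front is bracketed only if the next index belongs to the second
    word. It is then \<open>y\<close>; the shuffles continuing with an index of \<open>xs\<close>
    drop out.\<close>
  have first: "(\<Sum>zs\<in>shuffles xs (y # ys). ?k zs *
        (if p \<le> hd zs then \<chi> (bl brk (Z x) (Z (hd zs)) # map Z (tl zs)) else 0))
      = sg (fst (Z y) * wdeg (map Z xs)) * sh (\<lambda>z. \<chi> (?b # z)) (map Z xs) (map Z ys)"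
  proof -
    have "(\<Sum>zs\<in>shuffles xs (y # ys). ?k zs *
        (if p \<le> hd zs then \<chi> (bl brk (Z x) (Z (hd zs)) # map Z (tl zs)) else 0))
      = (\<Sum>zs\<in>shuffles xs ys. ?k (y # zs) * \<chi> (?b # map Z zs))"
    proof (cases xs)
      case Nil
      then show ?thesis using xy by simp
    next
      case (Cons x' xs')
      then have "x' \<noteq> y" "\<not> p \<le> x'" using "3.prems" by auto
      then show ?thesis using xy by (simp add: Cons sum_shuffles del: shuffles.simps)
    qed
    also have "\<dots> = sg (fst (Z y) * wdeg (map Z xs))
        * (\<Sum>zs\<in>shuffles xs ys. ?k zs * \<chi> (?b # map Z zs))"
      unfolding sum_distrib_left wdeg_map using "3.prems"
      by (intro sum.cong refl) (subst ksign_shuffle_right, auto simp: mult.assoc)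
    finally show ?thesis
      using "3.prems" xy by (subst (asm) sum_shuffles_sh) auto
  qed
  have "(\<Sum>zs\<in>shuffles xs (y # ys). ?k (x # zs) * ctr brk p Z \<chi> (x # zs))
      = (\<Sum>zs\<in>shuffles xs (y # ys). ?k zs *
        (if p \<le> hd zs then \<chi> (bl brk (Z x) (Z (hd zs)) # map Z (tl zs)) else 0))
      + (\<Sum>zs\<in>shuffles xs (y # ys). ?k zs * ctr brk p Z (\<lambda>z. \<chi> (Z x # z)) zs)"
    unfolding sum.distrib[symmetric]
  proof (rule sum.cong[OF refl])
    fix zs assume zs: "zs \<in> shuffles xs (y # ys)"
    then have "zs \<noteq> []" using length_shuffles by fastforce
    moreover have "?k (x # zs) = (?k zs :: 'k)"
      using "3.prems" xy by (intro ksign_shuffle_left[OF zs]) auto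
    ultimately show "?k (x # zs) * ctr brk p Z \<chi> (x # zs) = ?k zs *
        (if p \<le> hd zs then \<chi> (bl brk (Z x) (Z (hd zs)) # map Z (tl zs)) else 0)
        + ?k zs * ctr brk p Z (\<lambda>z. \<chi> (Z x # z)) zs"
      using xy by (simp add: ctr_Cons' distrib_left)
  qed
  moreover have "(\<Sum>zs\<in>shuffles (x # xs) ys. ?k (y # zs) * ctr brk p Z \<chi> (y # zs))
      = sg (fst (Z y) * wdeg (map Z (x # xs)))
        * (\<Sum>zs\<in>shuffles (x # xs) ys. ?k zs * ctr brk p Z (\<lambda>z. \<chi> (Z y # z)) zs)"
    unfolding sum_distrib_left
  proof (rule sum.cong[OF refl])
    fix zs assume zs: "zs \<in> shuffles (x # xs) ys"
    then have "zs \<noteq> []" using length_shuffles by fastforce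
    moreover have "?k (y # zs) = sg (fst (Z y) * wdeg (map Z (x # xs))) * (?k zs :: 'k)"
      unfolding wdeg_map using "3.prems" xy by (intro ksign_shuffle_right[OF zs]) auto
    ultimately show "?k (y # zs) * ctr brk p Z \<chi> (y # zs) = sg (fst (Z y) * wdeg (map Z (x # xs)))
        * (?k zs * ctr brk p Z (\<lambda>z. \<chi> (Z y # z)) zs)"
      using xy by (simp add: ctr_Cons' mult.assoc)
  qed
  ultimately show ?case
    using xy "3.prems" "3.IH"(1)[of "\<lambda>z. \<chi> (Z x # z)"] "3.IH"(2)[of "\<lambda>z. \<chi> (Z y # z)"]
    by (subst sum_shuffles) (auto simp: br.simps(3) first add.assoc)
qed (auto simp: ctr_eq_0)

lemma pair_bracket_word: "pair \<chi> (bracket_word brk v w) = br brk \<chi> v w"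
proof -
  let ?p = "length v" and ?q = "length w" and ?vw = "v @ w"
  let ?Z = "(!) ?vw" and ?is = "\<lambda>\<sigma>. map (inv \<sigma>) [0..<length v + length w]"
  have c: "(\<Sum>k | Suc k < ?p + ?q \<and> inv \<sigma> k < ?p \<and> ?p \<le> inv \<sigma> (Suc k).
        let u = permute_list (inv \<sigma>) ?vw in bat_sign \<sigma> ?vw *
        \<chi> (take k u @ (fst (u ! k) + fst (u ! Suc k), brk (snd (u ! k)) (snd (u ! Suc k))) # drop (k + 2) u))
    = ksign (\<lambda>i. fst (?Z i)) (?is \<sigma>) * ctr brk ?p ?Z \<chi> (?is \<sigma>)" for \<sigma>
  proof -
    have S: "{k. Suc k < ?p + ?q \<and> inv \<sigma> k < ?p \<and> ?p \<le> inv \<sigma> (Suc k)}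
        = {k \<in> {..<?p + ?q - 1}. inv \<sigma> k < ?p \<and> ?p \<le> inv \<sigma> (Suc k)}"
      by auto
    show ?thesis
      unfolding S ctr_def sum_distrib_left
      by (subst sum.inter_filter, simp, rule sum.cong)
         (auto simp: Let_def bat_sign_def permute_list_map_nth bl_def take_map drop_map)
  qed
  have "pair \<chi> (bracket_word brk v w)
      = (\<Sum>\<sigma>\<in>Bat ?p ?q. ksign (\<lambda>i. fst (?Z i)) (?is \<sigma>) * ctr brk ?p ?Z \<chi> (?is \<sigma>))"
    unfolding c[symmetric] by (simp add: bracket_word_def Let_def pair_sum)
  also have "\<dots> = (\<Sum>zs\<in>shuffles [0..<?p] [?p..<?p + ?q]. ksign (\<lambda>i. fst (?Z i)) zs * ctr brk ?p ?Z \<chi> zs)"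
    by (rule sum.reindex_bij_betw[OF bij_betw_Bat])
  also have "\<dots> = br brk \<chi> (map ?Z [0..<?p]) (map ?Z [?p..<?p + ?q])"
    by (rule sum_shuffles_br) auto
  also have "map ?Z [0..<?p] = v"
    by (rule nth_equalityI) (auto simp: nth_append)
  also have "map ?Z [?p..<?p + ?q] = w"
    by (rule nth_equalityI) (auto simp: nth_append)
  finally show ?thesis .
qed

section \<open>Functionals respecting the relations\<close>

definition okl :: "('k, 'v) gspace \<Rightarrow> 'v letter \<Rightarrow> bool" where
  "okl V a \<longleftrightarrow> snd a \<in> comp V (fst a)"

lemma words_iff: "w \<in> words V \<longleftrightarrow> w \<noteq> [] \<and> list_all (okl V) w"
  by (auto simp: words_def okl_def list_all_iff)

definition gclosed :: "('k, 'v) gspace \<Rightarrow> bool" where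
  "gclosed V \<longleftrightarrow> (\<forall>d. \<forall>x\<in>comp V d. \<forall>y\<in>comp V d. gadd V x y \<in> comp V d)
     \<and> (\<forall>d c. \<forall>x\<in>comp V d. gscale V c x \<in> comp V d)"

definition mlin :: "('k::field, 'v) gspace \<Rightarrow> ('v letter list \<Rightarrow> 'k) \<Rightarrow> bool" where
  "mlin V \<chi> \<longleftrightarrow> (\<forall>u v d x. x \<in> comp V d \<longrightarrow>
     (\<forall>y\<in>comp V d. \<chi> (u @ (d, gadd V x y) # v) = \<chi> (u @ (d, x) # v) + \<chi> (u @ (d, y) # v))
     \<and> (\<forall>c. \<chi> (u @ (d, gscale V c x) # v) = c * \<chi> (u @ (d, x) # v)))"

text \<open>A homogeneous letter may be exchanged for another of the same degree. Outside
  \<open>A\<close> all terms of a multilinearity relation therefore vanish together, which is why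
  \<open>mlin\<close> can be stated for all lists.\<close>

definition slot_closed :: "('k, 'v) gspace \<Rightarrow> 'v letter list set \<Rightarrow> bool" where
  "slot_closed V A \<longleftrightarrow> (\<forall>u v d x y. x \<in> comp V d \<longrightarrow> y \<in> comp V d \<longrightarrow>
     u @ (d, x) # v \<in> A \<longrightarrow> u @ (d, y) # v \<in> A)"

lemma slot_closed_words: "slot_closed V (words V)"
  by (auto simp: slot_closed_def words_iff okl_def)

lemma slot_closed_words2: "slot_closed V (words2 V)"
  by (auto simp: slot_closed_def words2_def words_iff okl_def)

lemma ml_rels_pair_iff:
  assumes V: "gclosed V" and A: "slot_closed V A" and off: "\<And>w. w \<notin> A \<Longrightarrow> \<chi> w = 0"
  shows "(\<forall>e\<in>ml_rels V A. pair \<chi> e = 0) \<longleftrightarrow> mlin V \<chi>"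
proof
  assume R: "\<forall>e\<in>ml_rels V A. pair \<chi> e = 0"
  show "mlin V \<chi>"
    unfolding mlin_def
  proof (intro allI impI conjI ballI)
    fix u v d x c assume x: "x \<in> comp V d"
    have sx: "gscale V c x \<in> comp V d" using V x by (simp add: gclosed_def)
    show "\<chi> (u @ (d, gscale V c x) # v) = c * \<chi> (u @ (d, x) # v)"
    proof (cases "u @ (d, x) # v \<in> A")
      case True
      then have "Poly_Mapping.single (u @ (d, gscale V c x) # v) 1 - Poly_Mapping.single (u @ (d, x) # v) c
          \<in> ml_rels V A"
        using x unfolding ml_rels_def by blast
      then show ?thesis using R by (auto simp: pair_diff dest!: bspec)
    next
      case False
      then have "u @ (d, gscale V c x) # v \<notin> A"
        using A x sx unfolding slot_closed_def by blast
      then show ?thesis using False by (simp add: off)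
    qed
    fix y assume y: "y \<in> comp V d"
    have sxy: "gadd V x y \<in> comp V d" using V x y by (simp add: gclosed_def)
    show "\<chi> (u @ (d, gadd V x y) # v) = \<chi> (u @ (d, x) # v) + \<chi> (u @ (d, y) # v)"
    proof (cases "u @ (d, x) # v \<in> A")
      case True
      then have "Poly_Mapping.single (u @ (d, gadd V x y) # v) 1
        - Poly_Mapping.single (u @ (d, x) # v) 1 - Poly_Mapping.single (u @ (d, y) # v) 1 \<in> ml_rels V A"
        using x y unfolding ml_rels_def by blast
      then show ?thesis using R by (auto simp: pair_diff pair_add algebra_simps dest!: bspec)
    next
      case False
      then have "u @ (d, gadd V x y) # v \<notin> A" "u @ (d, y) # v \<notin> A"
        using A x y sxy unfolding slot_closed_def by blast+
      then show ?thesis using False by (simp add: off)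
    qed
  qed
next
  assume "mlin V \<chi>"
  then show "\<forall>e\<in>ml_rels V A. pair \<chi> e = 0"
    unfolding ml_rels_def mlin_def by (auto simp: pair_diff)
qed

lemma keys_minus_subset: "Poly_Mapping.keys (p - q) \<subseteq> Poly_Mapping.keys p \<union> Poly_Mapping.keys (q :: 'a \<Rightarrow>\<^sub>0 'k::field)"
  by (auto simp: in_keys_iff lookup_minus)

lemma keys_single_subset: "w \<in> A \<Longrightarrow> Poly_Mapping.keys (Poly_Mapping.single w c) \<subseteq> A"
  by (simp add: keys_single)

lemma rel_on_ml_rels:
  assumes "gclosed V" "slot_closed V A"
  shows "rel_on A (ml_rels V A :: ('k::field, 'v) formal set)"
  unfolding rel_on_def
proof
  fix e :: "('k, 'v) formal" assume "e \<in> ml_rels V A"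
  then consider
    (a) u v d x y where "e = Poly_Mapping.single (u @ (d, gadd V x y) # v) 1
        - Poly_Mapping.single (u @ (d, x) # v) 1 - Poly_Mapping.single (u @ (d, y) # v) 1"
      "x \<in> comp V d" "y \<in> comp V d" "u @ (d, x) # v \<in> A"
  | (s) u v d c x where
      "e = Poly_Mapping.single (u @ (d, gscale V c x) # v) 1 - Poly_Mapping.single (u @ (d, x) # v) c"
      "x \<in> comp V d" "u @ (d, x) # v \<in> A"
    unfolding ml_rels_def by blast
  then show "Poly_Mapping.keys e \<subseteq> A"
  proof cases
    case a
    then have "gadd V x y \<in> comp V d" using assms by (simp add: gclosed_def)
    then have "u @ (d, gadd V x y) # v \<in> A" "u @ (d, y) # v \<in> A"
      using a assms(2) unfolding slot_closed_def by blast+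
    then show ?thesis
      using a unfolding a(1)
      by (intro subset_trans[OF keys_minus_subset] Un_least keys_single_subset) auto
  next
    case s
    then have "gscale V c x \<in> comp V d" using assms by (simp add: gclosed_def)
    then have "u @ (d, gscale V c x) # v \<in> A"
      using s assms(2) unfolding slot_closed_def by blast
    then show ?thesis
      using s unfolding s(1)
      by (intro subset_trans[OF keys_minus_subset] Un_least keys_single_subset) auto
  qed
qed

lemma keys_bat:
  assumes "w \<in> words V" "p \<le> length w"
  shows "Poly_Mapping.keys (bat p w) \<subseteq> words V"
  unfolding bat_def
proof (intro keys_sum_subset keys_single_subset)
  fix \<sigma> assume "\<sigma> \<in> Bat p (length w - p)"
  then have "\<sigma> permutes {..<length w}" using assms(2) by (simp add: Bat_def)
  then have "set (permute_list (inv \<sigma>) w) = set w"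
    by (intro set_permute_list permutes_inv)
  then show "permute_list (inv \<sigma>) w \<in> words V"
    using assms(1) by (auto simp: words_iff list_all_iff simp flip: set_empty)
qed

lemma rel_on_Hrel:
  assumes "gclosed V" shows "rel_on (words V) (Hrel V :: ('k::field, 'v) formal set)"
  unfolding rel_on_def
proof
  fix e :: "('k, 'v) formal" assume "e \<in> Hrel V"
  then consider "e \<in> ml_rels V (words V)" | p w where "e = bat p w" "w \<in> words V" "p < length w"
    unfolding Hrel_def by blast
  then show "Poly_Mapping.keys e \<subseteq> words V"
  proof cases
    case 1
    then show ?thesis
      using rel_on_ml_rels[OF assms slot_closed_words] by (auto simp: rel_on_def)
  next
    case 2
    then show ?thesis using keys_bat[of w V p] by simp
  qed
qed

lemma rel_on_Srel:
  assumes "gclosed V" shows "rel_on (words V) (Srel V :: ('k::field, 'v) formal set)"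
  unfolding rel_on_def
proof
  fix e :: "('k, 'v) formal" assume "e \<in> Srel V"
  then consider "e \<in> ml_rels V (words V)" | u v a b where
    "e = Poly_Mapping.single (u @ [a, b] @ v) 1 - Poly_Mapping.single (u @ [b, a] @ v) ((-1) powi (fst a * fst b))"
    "u @ [a, b] @ v \<in> words V"
    unfolding Srel_def by blast
  then show "Poly_Mapping.keys e \<subseteq> words V"
  proof cases
    case 1
    then show ?thesis
      using rel_on_ml_rels[OF assms slot_closed_words] by (auto simp: rel_on_def)
  next
    case 2
    then have "u @ [b, a] @ v \<in> words V" by (simp add: words_iff)
    then show ?thesis
      using 2 unfolding 2(1)
      by (intro subset_trans[OF keys_minus_subset] Un_least keys_single_subset) auto
  qed
qed

lemma sh_off_words:
  assumes "\<And>w. w \<notin> words V \<Longrightarrow> \<chi> w = 0" "u @ v \<notin> words V"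
  shows "sh \<chi> u v = 0"
proof -
  have "sh \<chi> u v = sh (\<lambda>_. 0) u v"
  proof (rule sh_cong)
    fix z assume z: "mset z = mset u + mset v"
    then have "set z = set (u @ v)" by (metis mset_append set_mset_mset)
    then have "z \<notin> words V"
      using assms(2) by (auto simp: words_iff list_all_iff simp flip: set_empty)
    then show "\<chi> z = 0" by (rule assms(1))
  qed
  then show ?thesis by (simp add: sh_zero)
qed

text \<open>By \<open>pair_bat\<close> the \<open>bat\<close> relations say that \<chi> vanishes on
  shuffles of nonempty words. For lists with invalid letters this is automatic, as every
  rearrangement is invalid too (\<open>sh_off_words\<close>).\<close>

lemma adm_Hrel_iff:
  fixes \<chi> :: "'v letter list \<Rightarrow> 'k::field"
  assumes "gclosed V"
  shows "adm (words V) (Hrel V) \<chi> \<longleftrightarrow> (\<forall>w. w \<notin> words V \<longrightarrow> \<chi> w = 0) \<and> mlin V \<chi>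
    \<and> (\<forall>u v. u \<noteq> [] \<longrightarrow> v \<noteq> [] \<longrightarrow> sh \<chi> u v = 0)" (is "_ \<longleftrightarrow> ?off \<and> ?ml \<and> ?sh")
proof (cases ?off)
  case True
  have "(\<forall>e\<in>{bat p w |p w. w \<in> words V \<and> 0 < p \<and> p < length w}. pair \<chi> e = 0) \<longleftrightarrow> ?sh"
  proof
    assume R: "\<forall>e\<in>{bat p w |p w. w \<in> words V \<and> 0 < p \<and> p < length w}. pair \<chi> e = 0"
    show ?sh
    proof (intro allI impI)
      fix u v :: "'v letter list" assume uv: "u \<noteq> []" "v \<noteq> []"
      show "sh \<chi> u v = 0"
      proof (cases "u @ v \<in> words V")
        case True
        then have "bat (length u) (u @ v) \<in> {bat p w |p w. w \<in> words V \<and> 0 < p \<and> p < length w}"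
          using uv by (intro CollectI exI[of _ "length u"] exI[of _ "u @ v"]) simp
        then have "pair \<chi> (bat (length u) (u @ v)) = 0" by (rule R[rule_format])
        then show ?thesis by (simp add: pair_bat)
      next
        case False
        then show ?thesis using True by (intro sh_off_words) auto
      qed
    qed
  next
    assume sh: ?sh
    have "pair \<chi> (bat p w) = 0" if "0 < p" "p < length w" for p w
      using that sh[rule_format, of "take p w" "drop p w"] by (cases w) (auto simp: pair_bat)
    then show "\<forall>e\<in>{bat p w |p w. w \<in> words V \<and> 0 < p \<and> p < length w}. pair \<chi> e = 0"
      by blast
  qed
  then show ?thesis
    using True ml_rels_pair_iff[OF assms slot_closed_words, of \<chi>] unfolding adm_def Hrel_def
    by (simp add: ball_Un)
qed (auto simp: adm_def)

lemma adm_Srel_iff: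
  fixes \<chi> :: "'v letter list \<Rightarrow> 'k::field"
  assumes "gclosed V"
  shows "adm (words V) (Srel V) \<chi> \<longleftrightarrow> (\<forall>w. w \<notin> words V \<longrightarrow> \<chi> w = 0) \<and> mlin V \<chi>
    \<and> (\<forall>u v a b. \<chi> (u @ a # b # v) = sg (fst a * fst b) * \<chi> (u @ b # a # v))"
  (is "_ \<longleftrightarrow> ?off \<and> ?ml \<and> ?sw")
proof (cases ?off)
  case True
  have "(\<forall>e\<in>{Poly_Mapping.single (u @ [a, b] @ v) 1
        - Poly_Mapping.single (u @ [b, a] @ v) ((-1) powi (fst a * fst b))
      |u v a b. u @ [a, b] @ v \<in> words V}. pair \<chi> e = 0) \<longleftrightarrow> ?sw"
  proof
    assume R: "\<forall>e\<in>{Poly_Mapping.single (u @ [a, b] @ v) 1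
        - Poly_Mapping.single (u @ [b, a] @ v) ((-1) powi (fst a * fst b))
      |u v a b. u @ [a, b] @ v \<in> words V}. pair \<chi> e = 0"
    show ?sw
    proof (intro allI)
      fix u v a b
      show "\<chi> (u @ a # b # v) = sg (fst a * fst b) * \<chi> (u @ b # a # v)"
      proof (cases "u @ [a, b] @ v \<in> words V")
        case True
        then have "pair \<chi> (Poly_Mapping.single (u @ [a, b] @ v) 1
          - Poly_Mapping.single (u @ [b, a] @ v) ((-1) powi (fst a * fst b))) = 0" using R by blast
        then show ?thesis by (simp add: pair_diff powi_eq_sg)
      next
        case False
        then have "u @ a # b # v \<notin> words V" "u @ b # a # v \<notin> words V" by (auto simp: words_iff)
        then show ?thesis using True by simp
      qed
    qed
  next
    assume sw: ?sw
    show "\<forall>e\<in>{Poly_Mapping.single (u @ [a, b] @ v) 1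
        - Poly_Mapping.single (u @ [b, a] @ v) ((-1) powi (fst a * fst b))
      |u v a b. u @ [a, b] @ v \<in> words V}. pair \<chi> e = 0"
    proof
      fix e :: "('k, 'v) formal"
      assume "e \<in> {Poly_Mapping.single (u @ [a, b] @ v) 1
        - Poly_Mapping.single (u @ [b, a] @ v) ((-1) powi (fst a * fst b))
        |u v a b. u @ [a, b] @ v \<in> words V}"
      then obtain u v a b where e: "e = Poly_Mapping.single (u @ [a, b] @ v) 1
        - Poly_Mapping.single (u @ [b, a] @ v) ((-1) powi (fst a * fst b))" by blast
      have "\<chi> (u @ [a, b] @ v) = sg (fst a * fst b) * \<chi> (u @ [b, a] @ v)"
        using sw[rule_format, of u a b v] by simp
      then show "pair \<chi> e = 0"
        by (simp only: e pair_diff pair_single powi_eq_sg mult_1 diff_self)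
    qed
  qed
  then show ?thesis
    using True ml_rels_pair_iff[OF assms slot_closed_words, of \<chi>] unfolding adm_def Srel_def
    by (simp add: ball_Un)
qed (auto simp: adm_def)

lemma adm_T2rel_iff:
  assumes "gclosed V"
  shows "adm (words2 V) (T2rel V) \<chi> \<longleftrightarrow> (\<forall>w. w \<notin> words2 V \<longrightarrow> \<chi> w = 0) \<and> mlin V \<chi>"
  using ml_rels_pair_iff[OF assms slot_closed_words2, of \<chi>] unfolding adm_def T2rel_def by auto

lemma rel_on_T2rel: "gclosed V \<Longrightarrow> rel_on (words2 V) (T2rel V)"
  unfolding T2rel_def by (rule rel_on_ml_rels[OF _ slot_closed_words2])

text \<open>One statement for both kinds of multilinearity relations: \<open>c1 = c2 = 1\<close>
  gives additivity, \<open>c2 = 0\<close> compatibility with scalars.\<close>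

lemma sh_slot:
  assumes "fst a1 = fst a" "fst a2 = fst a"
  shows "(\<And>p q. \<chi> (p @ a # q) = c1 * \<chi> (p @ a1 # q) + c2 * \<chi> (p @ a2 # q)) \<Longrightarrow>
    sh \<chi> (u @ a # v) w = c1 * sh \<chi> (u @ a1 # v) w + c2 * sh \<chi> (u @ a2 # v) w"
proof (induction "length u + length w" arbitrary: \<chi> u w rule: less_induct)
  case less
  show ?case
  proof (cases w)
    case Nil
    then show ?thesis using less.prems by simp
  next
    case (Cons b w')
    have w: "sh (\<lambda>z. \<chi> (b # z)) (u @ a # v) w'
        = c1 * sh (\<lambda>z. \<chi> (b # z)) (u @ a1 # v) w' + c2 * sh (\<lambda>z. \<chi> (b # z)) (u @ a2 # v) w'"
      by (rule less.hyps) (use less.prems[of "b # _"] in \<open>simp_all add: Cons\<close>)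
    show ?thesis
    proof (cases u)
      case Nil
      have "(\<lambda>z. \<chi> (a # z)) = (\<lambda>z. c1 * \<chi> (a1 # z) + c2 * \<chi> (a2 # z))"
        using less.prems[of "[]"] by auto
      then show ?thesis
        using w by (simp add: Nil Cons sh.simps(3) sh_add sh_mult assms distrib_left mult.left_commute)
    next
      case (Cons e u')
      have "sh (\<lambda>z. \<chi> (e # z)) (u' @ a # v) w
        = c1 * sh (\<lambda>z. \<chi> (e # z)) (u' @ a1 # v) w + c2 * sh (\<lambda>z. \<chi> (e # z)) (u' @ a2 # v) w"
        by (rule less.hyps) (use less.prems[of "e # _"] in \<open>simp_all add: Cons\<close>)
      then show ?thesis
        using w \<open>w = b # w'\<close>
        by (simp add: Cons sh.simps(3) assms distrib_left mult.left_commute add_ac)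
    qed
  qed
qed

text \<open>As in \<open>sh_slot\<close>, with a second hypothesis for the case that the letter in
  the slot is itself bracketed.\<close>

lemma br_slot:
  assumes "fst a1 = fst a" "fst a2 = fst a"
  shows "\<lbrakk>\<And>p q. \<chi> (p @ a # q) = c1 * \<chi> (p @ a1 # q) + c2 * \<chi> (p @ a2 # q);
    \<And>p q b. b \<in> set w \<Longrightarrow> \<chi> (p @ bl brk a b # q)
      = c1 * \<chi> (p @ bl brk a1 b # q) + c2 * \<chi> (p @ bl brk a2 b # q)\<rbrakk> \<Longrightarrow>
    br brk \<chi> (u @ a # v) w = c1 * br brk \<chi> (u @ a1 # v) w + c2 * br brk \<chi> (u @ a2 # v) w"
proof (induction "length u + length w" arbitrary: \<chi> u w rule: less_induct)
  case less
  show ?case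
  proof (cases w)
    case Nil
    then show ?thesis by simp
  next
    case (Cons b w')
    have w: "br brk (\<lambda>z. \<chi> (b # z)) (u @ a # v) w' = c1 * br brk (\<lambda>z. \<chi> (b # z)) (u @ a1 # v) w'
        + c2 * br brk (\<lambda>z. \<chi> (b # z)) (u @ a2 # v) w'"
      by (rule less.hyps)
         (use less.prems(1)[of "b # _"] less.prems(2)[of _ "b # _"] in \<open>simp_all add: Cons\<close>)
    show ?thesis
    proof (cases u)
      case Nil
      have "(\<lambda>z. \<chi> (a # z)) = (\<lambda>z. c1 * \<chi> (a1 # z) + c2 * \<chi> (a2 # z))"
        using less.prems(1)[of "[]"] by auto
      moreover have "(\<lambda>z. \<chi> (bl brk a b # z))
          = (\<lambda>z. c1 * \<chi> (bl brk a1 b # z) + c2 * \<chi> (bl brk a2 b # z))"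
        using less.prems(2)[of b "[]"] Cons by auto
      ultimately show ?thesis
        using w by (simp add: Nil Cons br.simps(3) sh_add sh_mult br_add br_mult assms distrib_left
            mult.left_commute)
    next
      case (Cons e u')
      have "br brk (\<lambda>z. \<chi> (e # z)) (u' @ a # v) w = c1 * br brk (\<lambda>z. \<chi> (e # z)) (u' @ a1 # v) w
        + c2 * br brk (\<lambda>z. \<chi> (e # z)) (u' @ a2 # v) w"
        by (rule less.hyps)
           (use less.prems(1)[of "e # _"] less.prems(2)[of _ "e # _"] in \<open>simp_all add: Cons\<close>)
      moreover have "sh (\<lambda>z. \<chi> (bl brk e b # z)) (u' @ a # v) w'
        = c1 * sh (\<lambda>z. \<chi> (bl brk e b # z)) (u' @ a1 # v) w'
        + c2 * sh (\<lambda>z. \<chi> (bl brk e b # z)) (u' @ a2 # v) w'"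
        by (rule sh_slot[OF assms]) (use less.prems(1)[of "bl brk e b # _"] in simp)
      ultimately show ?thesis
        using w \<open>w = b # w'\<close>
        by (simp add: Cons br.simps(3) assms distrib_left mult.left_commute add_ac)
    qed
  qed
qed

section \<open>Deconcatenation against functionals that vanish on shuffles\<close>

lemma cutf_eq_take_drop: "cutf f z = (\<Sum>j\<leftarrow>[0..<Suc (length z)]. f (take j z) (drop j z))"
proof (induction z arbitrary: f)
  case (Cons a z)
  have "[0..<Suc (length (a # z))] = 0 # map Suc [0..<Suc (length z)]"
    by (simp only: map_Suc_upt length_Cons) (simp add: upt_conv_Cons del: upt_Suc)
  then show ?case by (simp add: Cons.IH o_def del: upt_Suc)
qed simp

definition splits :: "'v letter list \<Rightarrow> ('v letter list \<times> 'v letter list) list" where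
  "splits w = map (\<lambda>j. (take j w, drop j w)) [1..<length w]"

text \<open>The recursion of \<open>cutf\<close> and its product formulas require empty pieces,
  \<delta> excludes them; for functionals vanishing on empty pieces both sums agree.\<close>

lemma sum_splits_eq_cutf:
  assumes "\<And>q. f [] q = (0::'k::field)" "\<And>p. f p [] = 0"
  shows "(\<Sum>(U, V)\<leftarrow>splits w. f U V) = cutf f w"
proof (cases w)
  case (Cons a z)
  have "[0..<Suc (length w)] = 0 # [1..<Suc (length w)]"
    by (simp add: upt_conv_Cons del: upt_Suc)
  also have "[1..<Suc (length w)] = [1..<length w] @ [length w]"
    by (rule upt_Suc_append) (simp add: Cons)
  finally have "[0..<Suc (length w)] = 0 # [1..<length w] @ [length w]" .
  then show ?thesis
    by (simp add: cutf_eq_take_drop splits_def assms o_def del: upt_Suc)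
qed (simp add: splits_def assms)

lemma splits_mem: "(U, V) \<in> set (splits w) \<Longrightarrow> U @ V = w \<and> U \<noteq> [] \<and> V \<noteq> []"
  by (auto simp: splits_def)

lemma cutf_Nil_right': "cutf (\<lambda>p q. if q = [] then f p q else 0) z = f z []"
  using cutf_Nil_right[of "\<lambda>p. f p []" z] by (simp cong: if_cong)

lemma cutf_Nil_left': "cutf (\<lambda>p q. if p = [] then f p q else 0) z = f [] z"
  using cutf_Nil_left[of "f []" z] by (simp cong: if_cong)

lemma sh_br_swap:
  "sh (\<lambda>p. br brk (\<beta> p) v2 w2) v1 w1 = br brk (\<lambda>q. sh (\<lambda>p. \<beta> p q) v1 w1) v2 w2"
  by (induction "\<lambda>p. br brk (\<beta> p) v2 w2" v1 w1 arbitrary: \<beta> rule: sh.induct)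
     (simp_all add: sh.simps(3) br_add br_mult)

text \<open>As \<open>\<gamma>\<close> vanishes on shuffles in each argument, the terms of \<open>br_cutf\<close> survive only when one
  of the four pieces is empty.\<close>

lemma br_cutf_primitive:
  fixes \<gamma> :: "'v letter list \<Rightarrow> 'v letter list \<Rightarrow> 'k::field"
  assumes N1: "\<And>q. \<gamma> [] q = 0" and N2: "\<And>p. \<gamma> p [] = 0"
    and S1: "\<And>u v q. u \<noteq> [] \<Longrightarrow> v \<noteq> [] \<Longrightarrow> sh (\<lambda>p. \<gamma> p q) u v = 0"
    and S2: "\<And>u v p. u \<noteq> [] \<Longrightarrow> v \<noteq> [] \<Longrightarrow> sh (\<gamma> p) u v = 0"
  shows "br brk (cutf (\<lambda>p q. sg (wdeg p) * \<gamma> p q)) v w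
    = cutf (\<lambda>v1 v2. sg (wdeg w * wdeg v2 + wdeg v1 + wdeg w) * br brk (\<lambda>p. \<gamma> p v2) v1 w
        + sg (wdeg v1) * br brk (\<gamma> v1) v2 w) v
    + cutf (\<lambda>w1 w2. sg (wdeg v + wdeg w1) * br brk (\<lambda>p. \<gamma> p w2) v w1
        + sg (wdeg w1 * wdeg v + wdeg w1) * br brk (\<gamma> w1) v w2) w"
proof -
  let ?b = "\<lambda>p q. sg (wdeg p) * \<gamma> p q"
  \<comment> \<open>\<open>S2\<close> forces \<open>v2\<close> or \<open>w2\<close> to be empty. If
    both are, the case is counted twice, but \<open>N2\<close> makes it 0.\<close>
  have b1: "br brk (\<lambda>p. sh (?b p) v2 w2) v1 w1
      = (if w2 = [] then sg (wdeg v1 + wdeg w1) * br brk (\<lambda>p. \<gamma> p v2) v1 w1 else 0)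
      + (if v2 = [] then sg (wdeg v1 + wdeg w1) * br brk (\<lambda>p. \<gamma> p w2) v1 w1 else 0)" for v1 v2 w1 w2
  proof -
    have "br brk (\<lambda>p. sh (?b p) v2 w2) v1 w1 = sg (wdeg v1 + wdeg w1) * br brk (\<lambda>p. sh (\<gamma> p) v2 w2) v1 w1"
      using br_sg[of brk 1 "\<lambda>p. sh (\<gamma> p) v2 w2" v1 w1] by (simp add: sh_mult)
    then show ?thesis by (auto simp: S2 N2 br_zero)
  qed
  \<comment> \<open>Shuffling and bracketing concern different arguments of \<gamma> here, so they
    may be interchanged (\<open>sh_br_swap\<close>) and \<open>S1\<close> applies to
    \<open>v1\<close> and \<open>w1\<close>.\<close>
  have b2: "sh (\<lambda>p. br brk (?b p) v2 w2) v1 w1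
      = (if w1 = [] then sg (wdeg v1 + wdeg w1) * br brk (\<gamma> v1) v2 w2 else 0)
      + (if v1 = [] then sg (wdeg v1 + wdeg w1) * br brk (\<gamma> w1) v2 w2 else 0)" for v1 v2 w1 w2
  proof -
    have "sh (\<lambda>p. br brk (?b p) v2 w2) v1 w1 = sg (wdeg v1 + wdeg w1) * sh (\<lambda>p. br brk (\<gamma> p) v2 w2) v1 w1"
      using sh_sg[of 1 "\<lambda>p. br brk (\<gamma> p) v2 w2" v1 w1] by (simp add: br_mult)
    then have "sh (\<lambda>p. br brk (?b p) v2 w2) v1 w1
        = sg (wdeg v1 + wdeg w1) * br brk (\<lambda>q. sh (\<lambda>p. \<gamma> p q) v1 w1) v2 w2"
      by (simp only: sh_br_swap)
    moreover have "\<gamma> [] = (\<lambda>_. 0)" using N1 by auto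
    ultimately show ?thesis by (auto simp: S1 N1 br_zero)
  qed
  let ?s = "\<lambda>v1 v2 w1 w2. sg (wdeg w1 * wdeg v2) :: 'k"
  have "br brk (cutf ?b) v w
    = cutf (\<lambda>v1 v2. cutf (\<lambda>w1 w2. if w2 = []
        then sg (wdeg w1 * wdeg v2) * (sg (wdeg v1 + wdeg w1) * br brk (\<lambda>p. \<gamma> p v2) v1 w1) else 0) w) v
    + cutf (\<lambda>v1 v2. if v2 = [] then cutf (\<lambda>w1 w2.
        sg (wdeg w1 * wdeg v2) * (sg (wdeg v1 + wdeg w1) * br brk (\<lambda>p. \<gamma> p w2) v1 w1)) w else 0) v
    + (cutf (\<lambda>v1 v2. cutf (\<lambda>w1 w2. if w1 = []
        then sg (wdeg w1 * wdeg v2) * (sg (wdeg v1 + wdeg w1) * br brk (\<gamma> v1) v2 w2) else 0) w) v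
    + cutf (\<lambda>v1 v2. if v1 = [] then cutf (\<lambda>w1 w2.
        sg (wdeg w1 * wdeg v2) * (sg (wdeg v1 + wdeg w1) * br brk (\<gamma> w1) v2 w2)) w else 0) v)"
    unfolding br_cutf b1 b2 cutf_add[symmetric]
    by (intro cutf_cong) (auto simp: cutf_add[symmetric] cutf_zero distrib_left intro!: cutf_cong)
  also have "\<dots> = cutf (\<lambda>v1 v2. sg (wdeg w * wdeg v2 + wdeg v1 + wdeg w) * br brk (\<lambda>p. \<gamma> p v2) v1 w) v
     + cutf (\<lambda>w1 w2. sg (wdeg v + wdeg w1) * br brk (\<lambda>p. \<gamma> p w2) v w1) w
     + (cutf (\<lambda>v1 v2. sg (wdeg v1) * br brk (\<gamma> v1) v2 w) v
     + cutf (\<lambda>w1 w2. sg (wdeg w1 * wdeg v + wdeg w1) * br brk (\<gamma> w1) v w2) w)"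
    unfolding cutf_Nil_right' cutf_Nil_left' by (simp add: sg_add mult.assoc add.assoc)
  finally show ?thesis by (simp only: cutf_add add_ac)
qed

lemma cutf_slot:
  "\<lbrakk>\<And>p q r. \<beta> (p @ a # q) r = c1 * \<beta> (p @ a1 # q) r + c2 * \<beta> (p @ a2 # q) r;
    \<And>p q r. \<beta> r (p @ a # q) = c1 * \<beta> r (p @ a1 # q) + c2 * \<beta> r (p @ a2 # q)\<rbrakk> \<Longrightarrow>
   cutf \<beta> (u @ a # v) = c1 * cutf \<beta> (u @ a1 # v) + c2 * cutf \<beta> (u @ a2 # v)"
proof (induction u arbitrary: \<beta>)
  case Nil
  have "(\<lambda>p. \<beta> (a # p)) = (\<lambda>p q. c1 * \<beta> (a1 # p) q + c2 * \<beta> (a2 # p) q)"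
    using Nil.prems(1)[of "[]"] by (auto simp: fun_eq_iff)
  then show ?case
    using Nil.prems(2)[of "[]" "[]"] by (simp add: cutf_add cutf_mult distrib_left)
next
  case (Cons b u)
  have "cutf (\<lambda>p. \<beta> (b # p)) (u @ a # v)
      = c1 * cutf (\<lambda>p. \<beta> (b # p)) (u @ a1 # v) + c2 * cutf (\<lambda>p. \<beta> (b # p)) (u @ a2 # v)"
    by (rule Cons.IH) (use Cons.prems(1)[of "b # _"] Cons.prems(2) in simp_all)
  then show ?case
    using Cons.prems(2)[of "[]" "b # u"] by (simp add: distrib_left)
qed

text \<open>Of all deconcatenations of a shuffle only v \<otimes> w and w \<otimes> v survive, and
  the symmetry \<open>anti\<close>, in degrees lowered by 1, makes them cancel. This is the reason
  why \<delta> has to be symmetrized in order to live on \<H>.\<close>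

lemma sh_cutf_primitive:
  fixes \<gamma> :: "'v letter list \<Rightarrow> 'v letter list \<Rightarrow> 'k::field"
  assumes N1: "\<And>q. \<gamma> [] q = 0" and N2: "\<And>p. \<gamma> p [] = 0"
    and S1: "\<And>u v q. u \<noteq> [] \<Longrightarrow> v \<noteq> [] \<Longrightarrow> sh (\<lambda>p. \<gamma> p q) u v = 0"
    and S2: "\<And>u v p. u \<noteq> [] \<Longrightarrow> v \<noteq> [] \<Longrightarrow> sh (\<gamma> p) u v = 0"
    and anti: "\<And>p q. \<gamma> p q = sg ((wdeg p - 1) * (wdeg q - 1)) * \<gamma> q p"
    and ne: "v \<noteq> []" "w \<noteq> []"
  shows "sh (cutf (\<lambda>p q. sg (wdeg p) * \<gamma> p q)) v w = 0"
proof -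
  let ?b = "\<lambda>p q. sg (wdeg p) * \<gamma> p q"
  have i: "sh (\<lambda>p. ?b p q) v1 w1 = sg (wdeg v1 + wdeg w1) * sh (\<lambda>p. \<gamma> p q) v1 w1" for q v1 w1
    using sh_sg[of 1 "\<lambda>p. \<gamma> p q" v1 w1] by simp
  \<comment> \<open>The survivors have \<open>v1\<close> and \<open>w2\<close> empty, or
    \<open>w1\<close> and \<open>v2\<close> empty, each side then consisting of one whole
    word.\<close>
  have b: "sg (wdeg w1 * wdeg v2) * sh (\<lambda>p. sh (?b p) v2 w2) v1 w1
    = (if w2 = [] then if v1 = [] then sg (wdeg w1 * wdeg v2) * ?b w1 v2 else 0 else 0)
    + (if w1 = [] then if v2 = [] then ?b v1 w2 else 0 else 0)"
    if "v1 @ v2 = v" "w1 @ w2 = w" for v1 v2 w1 w2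
  proof -
    have "sh (?b p) v2 w2 = (if w2 = [] then ?b p v2 else if v2 = [] then ?b p w2 else 0)" for p
      by (simp add: sh_mult S2)
    then have "sh (\<lambda>p. sh (?b p) v2 w2) v1 w1 = (if w2 = [] then sh (\<lambda>p. ?b p v2) v1 w1
        else if v2 = [] then sh (\<lambda>p. ?b p w2) v1 w1 else 0)"
      by (simp add: sh_zero)
    also have "sh (\<lambda>p. ?b p v2) v1 w1 = (if v1 = [] then ?b w1 v2 else if w1 = [] then ?b v1 v2 else 0)"
      unfolding i by (simp add: S1)
    also have "sh (\<lambda>p. ?b p w2) v1 w1 = (if v1 = [] then ?b w1 w2 else if w1 = [] then ?b v1 w2 else 0)"
      unfolding i by (simp add: S1)
    finally show ?thesis using ne that N1 N2 by (auto split: if_splits)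
  qed
  have "sh (cutf ?b) v w = cutf (\<lambda>v1 v2. cutf (\<lambda>w1 w2.
      (if w2 = [] then if v1 = [] then sg (wdeg w1 * wdeg v2) * ?b w1 v2 else 0 else 0)
    + (if w1 = [] then if v2 = [] then ?b v1 w2 else 0 else 0)) w) v"
    unfolding sh_cutf by (intro cutf_cong b)
  also have "\<dots> = cutf (\<lambda>v1 v2. if v1 = [] then sg (wdeg w * wdeg v2) * ?b w v2 else 0) v
    + cutf (\<lambda>v1 v2. if v2 = [] then ?b v1 w else 0) v"
    unfolding cutf_add cutf_Nil_right' cutf_Nil_left' ..
  also have "\<dots> = sg (wdeg w * wdeg v) * ?b w v + ?b v w"
    unfolding cutf_Nil_right' cutf_Nil_left' ..
  also have "\<dots> = 0"
    by (subst anti[of w v]) (simp add: sg_def)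
  finally show ?thesis .
qed

section \<open>The maps on \<open>S\<^sup>+(\<H>[1])\<close>\<close>

text \<open>\<open>V\<close> is G[1], on which the bracket has degree 0. Linearity is recorded in
  the first argument; for the second it is obtained from antisymmetry.\<close>

locale graded_bracket =
  fixes V :: "('k::field, 'v) gspace" and brk :: "'v \<Rightarrow> 'v \<Rightarrow> 'v"
  assumes gclosed: "gclosed V"
    and brk_comp: "\<lbrakk>x \<in> comp V m; y \<in> comp V n\<rbrakk> \<Longrightarrow> brk x y \<in> comp V (m + n)"
    and brk_add: "\<lbrakk>x \<in> comp V m; y \<in> comp V m; z \<in> comp V n\<rbrakk>
      \<Longrightarrow> brk (gadd V x y) z = gadd V (brk x z) (brk y z)"
    and brk_scale: "\<lbrakk>x \<in> comp V m; z \<in> comp V n\<rbrakk> \<Longrightarrow> brk (gscale V c x) z = gscale V c (brk x z)"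
    and brk_anti: "\<lbrakk>x \<in> comp V m; y \<in> comp V n\<rbrakk> \<Longrightarrow> brk x y = gscale V (- sg (m * n)) (brk y x)"
begin

abbreviation "admH \<equiv> adm (words V) (Hrel V)"

definition dgw :: "'v letter list \<Rightarrow> int" where
  "dgw w = wdeg w - 1"

text \<open>\<open>wdeg v - 1\<close> is the degree x of \<open>v\<close> in H[1]: the transpose is
  that of \<open>\<ell>\<^sub>2\<close>, with its sign (-1)^x, and not of the bare bracket.\<close>

definition Bw :: "('v letter list \<Rightarrow> 'k) \<Rightarrow> 'v letter list \<Rightarrow> 'v letter list \<Rightarrow> 'k" where
  "Bw \<chi> v w = sg (wdeg v - 1) * br brk \<chi> v w"

lemma okl_bl: "\<lbrakk>okl V a; okl V b\<rbrakk> \<Longrightarrow> okl V (bl brk a b)"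
  by (simp add: okl_def bl_def brk_comp)

lemma admH_off: "admH \<chi> \<Longrightarrow> w \<notin> words V \<Longrightarrow> \<chi> w = 0"
  by (rule adm_off)

lemma admH_Nil: "admH \<chi> \<Longrightarrow> \<chi> [] = 0"
  by (rule adm_off) (auto simp: words_iff)

lemma admH_mlin: "admH \<chi> \<Longrightarrow> mlin V \<chi>"
  by (simp add: adm_Hrel_iff[OF gclosed])

lemma admH_sh: "\<lbrakk>admH \<chi>; u \<noteq> []; v \<noteq> []\<rbrakk> \<Longrightarrow> sh \<chi> u v = 0"
  by (simp add: adm_Hrel_iff[OF gclosed])

lemma admH_add: "admH f \<Longrightarrow> admH g \<Longrightarrow> admH (\<lambda>w. f w + g w)"
  unfolding adm_def by (simp add: pair_fun_add)

lemma admH_mult: "admH f \<Longrightarrow> admH (\<lambda>w. c * f w)"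
  unfolding adm_def by (simp add: pair_fun_mult)

lemma admH_sg:
  assumes "admH f" shows "admH (\<lambda>w. sg (n * dgw w) * f w)"
proof -
  have "sh (\<lambda>w. sg (n * dgw w) * f w) u v = sg (n * (wdeg u + wdeg v - 1)) * sh f u v" for u v
    by (subst sh_mult[symmetric], rule sh_cong_wdeg) (simp add: dgw_def)
  then show ?thesis
    using assms unfolding adm_Hrel_iff[OF gclosed] mlin_def
    by (auto simp: dgw_def distrib_left mult.left_commute)
qed

sublocale brace_cobrace dgw Bw "\<lambda>w. w \<in> words V" splits admH
proof
  show "Bw (\<lambda>Z. f Z + g Z) X Y = Bw f X Y + Bw g X Y" for f g X Y
    by (simp add: Bw_def br_add distrib_left)
  show "Bw (\<lambda>Z. c * f Z) X Y = c * Bw f X Y" for c f X Y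
    by (simp add: Bw_def br_mult)
  show "Bw f X Y = Bw g X Y" if "\<And>Z. dgw Z = dgw X + dgw Y + 1 \<Longrightarrow> f Z = g Z" for f g X Y
    unfolding Bw_def using that by (subst br_cong_wdeg[of X Y f g]) (auto simp: dgw_def)
  show "Bw f X Y = Bw g X Y" if "X \<in> words V" "Y \<in> words V"
    "\<And>Z. \<lbrakk>Z \<in> words V; dgw Z = dgw X + dgw Y + 1\<rbrakk> \<Longrightarrow> f Z = g Z" for f g X Y
  proof -
    have "br brk f X Y = br brk g X Y"
      by (rule br_cong[of "okl V"]) (use that okl_bl in \<open>auto simp: words_iff dgw_def\<close>)
    then show ?thesis by (simp add: Bw_def)
  qed
  show "dgw U + dgw W = dgw X - 1" if "(U, W) \<in> set (splits X)" for U W X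
    using splits_mem[OF that] by (auto simp: dgw_def)
  show "U \<in> words V \<and> W \<in> words V" if "(U, W) \<in> set (splits X)" "X \<in> words V" for U W X
    using splits_mem[OF that(1)] that(2) by (auto simp: words_iff)
  show "admH (\<lambda>P. f P + g P)" if "admH f" "admH g" for f g
    using that by (rule admH_add)
  show "admH (\<lambda>P. c * f P)" if "admH f" for c f
    using that by (rule admH_mult)
  show "admH (\<lambda>P. sg (n * dgw P) * f P)" if "admH f" for n f
    using that by (rule admH_sg)
  show "admH (\<lambda>Z. \<Sum>(P, Q)\<leftarrow>splits Z. sg (dgw P + 1) * \<gamma> P Q)"
    if g1: "\<And>Q. admH (\<lambda>P. \<gamma> P Q)" and g2: "\<And>P. admH (\<gamma> P)"
      and sym: "\<And>P Q. \<gamma> P Q = sg (dgw P * dgw Q) * \<gamma> Q P" for \<gamma>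
  proof -
    let ?b = "\<lambda>p q. sg (wdeg p) * \<gamma> p q"
    have N: "\<gamma> [] q = 0" "\<gamma> p [] = 0" for p q
      using admH_Nil[OF g1] admH_Nil[OF g2] by auto
    have eq: "(\<lambda>Z. \<Sum>(P, Q)\<leftarrow>splits Z. sg (dgw P + 1) * \<gamma> P Q) = cutf ?b"
      by (rule ext, subst sum_splits_eq_cutf) (simp_all add: N dgw_def)
    have off: "cutf ?b z = 0" if "z \<notin> words V" for z
    proof -
      have "cutf ?b z = cutf (\<lambda>_ _. 0) z"
      proof (rule cutf_cong)
        fix p q assume "p @ q = z"
        then have "p \<notin> words V \<or> q \<notin> words V" using that by (auto simp: words_iff)
        then show "?b p q = 0" using admH_off[OF g1, of p q] admH_off[OF g2, of q p] by auto
      qed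
      then show ?thesis by (simp add: cutf_zero)
    qed
    have m1: "\<gamma> (p @ (d, gadd V x y) # q) r = \<gamma> (p @ (d, x) # q) r + \<gamma> (p @ (d, y) # q) r"
      "\<gamma> r (p @ (d, gadd V x y) # q) = \<gamma> r (p @ (d, x) # q) + \<gamma> r (p @ (d, y) # q)"
      "\<gamma> (p @ (d, gscale V c x) # q) r = c * \<gamma> (p @ (d, x) # q) r"
      "\<gamma> r (p @ (d, gscale V c x) # q) = c * \<gamma> r (p @ (d, x) # q)"
      if "x \<in> comp V d" "y \<in> comp V d" for p q r d x y c
      using admH_mlin[OF g1, of r] admH_mlin[OF g2, of r] that by (simp_all add: mlin_def)
    have "mlin V (cutf ?b)"
      unfolding mlin_def
    proof (intro allI impI conjI ballI)
      fix u v d x y c assume xy: "x \<in> comp V d"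
      show "cutf ?b (u @ (d, gscale V c x) # v) = c * cutf ?b (u @ (d, x) # v)"
        using cutf_slot[of ?b "(d, gscale V c x)" c "(d, x)" 0 "(d, x)" u v]
        by (simp add: m1(3,4)[OF xy xy] mult.left_commute)
      assume y: "y \<in> comp V d"
      show "cutf ?b (u @ (d, gadd V x y) # v) = cutf ?b (u @ (d, x) # v) + cutf ?b (u @ (d, y) # v)"
        using cutf_slot[of ?b "(d, gadd V x y)" 1 "(d, x)" 1 "(d, y)" u v]
        by (simp add: m1(1,2)[OF xy y] distrib_left)
    qed
    moreover have "sh (cutf ?b) u v = 0" if "u \<noteq> []" "v \<noteq> []" for u v
      by (rule sh_cutf_primitive[OF N admH_sh[OF g1] admH_sh[OF g2] sym[unfolded dgw_def] that])
    ultimately show ?thesis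
      unfolding eq adm_Hrel_iff[OF gclosed] using off by blast
  qed
  fix \<gamma> X Y
  assume g1: "\<And>Q. admH (\<lambda>P. \<gamma> P Q)" and g2: "\<And>P. admH (\<gamma> P)"
  have N: "\<gamma> [] q = 0" "\<gamma> p [] = 0" for p q
    using admH_Nil[OF g1] admH_Nil[OF g2] by auto
  have 1: "Bw (\<lambda>Z. \<Sum>(P, Q)\<leftarrow>splits Z. sg (dgw P + 1) * \<gamma> P Q) X Y
      = sg (wdeg X - 1) * br brk (cutf (\<lambda>p q. sg (wdeg p) * \<gamma> p q)) X Y"
    unfolding Bw_def by (subst sum_splits_eq_cutf) (simp_all add: N dgw_def)
  have 2: "br brk (cutf (\<lambda>p q. sg (wdeg p) * \<gamma> p q)) X Y
    = cutf (\<lambda>v1 v2. sg (wdeg Y * wdeg v2 + wdeg v1 + wdeg Y) * br brk (\<lambda>p. \<gamma> p v2) v1 Y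
        + sg (wdeg v1) * br brk (\<gamma> v1) v2 Y) X
    + cutf (\<lambda>w1 w2. sg (wdeg X + wdeg w1) * br brk (\<lambda>p. \<gamma> p w2) X w1
        + sg (wdeg w1 * wdeg X + wdeg w1) * br brk (\<gamma> w1) X w2) Y"
    by (rule br_cutf_primitive) (use N admH_sh[OF g1] admH_sh[OF g2] in auto)
  have 3: "(\<Sum>(U, W)\<leftarrow>splits X. sg (dgw U + 1) *
          (sg (dgw W * dgw Y) * Bw (\<lambda>Z. \<gamma> Z W) U Y + sg (dgw U) * Bw (\<lambda>Z. \<gamma> U Z) W Y))
     = cutf (\<lambda>U W. sg (dgw U + 1) *
          (sg (dgw W * dgw Y) * Bw (\<lambda>Z. \<gamma> Z W) U Y + sg (dgw U) * Bw (\<lambda>Z. \<gamma> U Z) W Y)) X"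
    by (rule sum_splits_eq_cutf) (simp_all add: Bw_def N br_zero)
  have 4: "(\<Sum>(U, W)\<leftarrow>splits Y. sg (dgw U + 1) *
          (Bw (\<lambda>Z. \<gamma> Z W) X U + sg ((dgw X + 1) * dgw U) * Bw (\<lambda>Z. \<gamma> U Z) X W))
     = cutf (\<lambda>U W. sg (dgw U + 1) *
          (Bw (\<lambda>Z. \<gamma> Z W) X U + sg ((dgw X + 1) * dgw U) * Bw (\<lambda>Z. \<gamma> U Z) X W)) Y"
    by (rule sum_splits_eq_cutf) (simp_all add: Bw_def N br_zero)
  \<comment> \<open>For each cut of \<open>X\<close> the terms of \<open>br_cutf_primitive\<close>
    are the negatives of those in \<open>key\<close>; likewise for \<open>Y\<close> below. Only the
    signs have to be compared.\<close>
  have X: "sg (wdeg X - 1) * cutf (\<lambda>v1 v2. sg (wdeg Y * wdeg v2 + wdeg v1 + wdeg Y)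
          * br brk (\<lambda>p. \<gamma> p v2) v1 Y + sg (wdeg v1) * br brk (\<gamma> v1) v2 Y) X
      + cutf (\<lambda>U W. sg (dgw U + 1) *
          (sg (dgw W * dgw Y) * Bw (\<lambda>Z. \<gamma> Z W) U Y + sg (dgw U) * Bw (\<lambda>Z. \<gamma> U Z) W Y)) X
      = cutf (\<lambda>_ _. 0) X"
    unfolding cutf_mult[symmetric] cutf_add[symmetric]
  proof (rule cutf_cong)
    fix U W assume "U @ W = X"
    then have X: "wdeg X = wdeg U + wdeg W" by auto
    show "sg (wdeg X - 1) * (sg (wdeg Y * wdeg W + wdeg U + wdeg Y)
          * br brk (\<lambda>p. \<gamma> p W) U Y + sg (wdeg U) * br brk (\<gamma> U) W Y)
      + sg (dgw U + 1) * (sg (dgw W * dgw Y) * Bw (\<lambda>Z. \<gamma> Z W) U Y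
          + sg (dgw U) * Bw (\<lambda>Z. \<gamma> U Z) W Y) = 0"
      unfolding X Bw_def dgw_def
      by (cases "even (wdeg U)"; cases "even (wdeg W)"; cases "even (wdeg Y)"; simp add: sg_def)
  qed
  have Y: "sg (wdeg X - 1) * cutf (\<lambda>w1 w2. sg (wdeg X + wdeg w1) * br brk (\<lambda>p. \<gamma> p w2) X w1
        + sg (wdeg w1 * wdeg X + wdeg w1) * br brk (\<gamma> w1) X w2) Y
      + sg (dgw X) * cutf (\<lambda>U W. sg (dgw U + 1) *
          (Bw (\<lambda>Z. \<gamma> Z W) X U + sg ((dgw X + 1) * dgw U) * Bw (\<lambda>Z. \<gamma> U Z) X W)) Y
      = cutf (\<lambda>_ _. 0) Y"
    unfolding cutf_mult[symmetric] cutf_add[symmetric]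
    by (rule cutf_cong) (auto simp: Bw_def dgw_def sg_def)
  have sum_0: "\<lbrakk>s * a + c = 0; s * b + d = 0\<rbrakk> \<Longrightarrow> s * (a + b) + c + d = 0" for s a b c d :: 'k
    by (simp add: distrib_left eq_neg_iff_add_eq_0[symmetric])
  show "Bw (\<lambda>Z. \<Sum>(P, Q)\<leftarrow>splits Z. sg (dgw P + 1) * \<gamma> P Q) X Y
      + (\<Sum>(U, W)\<leftarrow>splits X. sg (dgw U + 1) *
          (sg (dgw W * dgw Y) * Bw (\<lambda>Z. \<gamma> Z W) U Y + sg (dgw U) * Bw (\<lambda>Z. \<gamma> U Z) W Y))
      + sg (dgw X) * (\<Sum>(U, W)\<leftarrow>splits Y. sg (dgw U + 1) *
          (Bw (\<lambda>Z. \<gamma> Z W) X U + sg ((dgw X + 1) * dgw U) * Bw (\<lambda>Z. \<gamma> U Z) X W)) = 0"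
    unfolding 1 2 3 4 by (rule sum_0[OF X[unfolded cutf_zero] Y[unfolded cutf_zero]])
qed

end

section \<open>The explicit sum for \<ell>\<close>

lemma ksign_map_Suc: "ksign d (map Suc is) = ksign (\<lambda>m. d (Suc m)) is"
proof (induction "is")
  case (Cons i "is")
  have "filter (\<lambda>j. j < Suc i) (map Suc is) = map Suc (filter (\<lambda>j. j < i) is)"
    by (simp add: filter_map o_def)
  then show ?case by (simp add: ksign_Cons Cons.IH o_def)
qed simp

text \<open>A second source of \<open>brace\<close>, on the letters of S^+(H[1]): there
  \<open>\<ell>\<^sub>2(X, Y)\<close> is a single letter and the transpose merely evaluates, whereas
  on words it is a sum. \<open>el_hletter\<close> relates the two. \<open>field_type\<close> fixes
  the field of values.\<close>

locale letter_brace =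
  fixes op :: "'v letter \<Rightarrow> 'v letter \<Rightarrow> 'v letter" and ok :: "'v letter \<Rightarrow> bool"
    and field_type :: "'k::field itself"
  assumes fst_op: "fst (op X Y) = fst X + fst Y + 1"
    and ok_op: "\<lbrakk>ok X; ok Y\<rbrakk> \<Longrightarrow> ok (op X Y)"
begin

sublocale brace fst "\<lambda>\<chi> X Y. \<chi> (op X Y) :: 'k" ok
  by standard (auto simp: fst_op ok_op)

definition sterm :: "('v letter list \<Rightarrow> 'k) \<Rightarrow> 'v letter list \<Rightarrow> nat \<Rightarrow> nat \<Rightarrow> 'k" where
  "sterm \<psi> Xs i j = (let rest = filter (\<lambda>m. m \<noteq> i \<and> m \<noteq> j) [0..<length Xs] in
     ksign (\<lambda>m. fst (Xs ! m)) (i # j # rest) * \<psi> (op (Xs ! i) (Xs ! j) # map ((!) Xs) rest))"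

definition sterm1 :: "'v letter \<Rightarrow> ('v letter list \<Rightarrow> 'k) \<Rightarrow> 'v letter list \<Rightarrow> nat \<Rightarrow> 'k" where
  "sterm1 X \<psi> L j = (let rest = filter (\<lambda>m. m \<noteq> j) [0..<length L] in
     ksign (\<lambda>m. fst (L ! m)) (j # rest) * \<psi> (op X (L ! j) # map ((!) L) rest))"

lemma upt_Suc_map: "[0..<Suc n] = 0 # map Suc [0..<n]"
  by (simp add: map_Suc_upt upt_conv_Cons del: upt_Suc)

text \<open>The sum has the bracket in front, \<open>ad\<close> leaves it at the place of the
  bracketed letter; graded symmetry of \<psi> moves it there.\<close>

lemma sterm1_sum:
  "(\<And>X Y P A. \<psi> (P @ X # Y # A) = sg (fst X * fst Y) * \<psi> (P @ Y # X # A)) \<Longrightarrow>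
   (\<Sum>j<length L. sterm1 X \<psi> L j) = ad X \<psi> L"
proof (induction L arbitrary: \<psi>)
  case (Cons Y L)
  let ?L = "Y # L"
  have 0: "sterm1 X \<psi> ?L 0 = \<psi> (op X Y # L)"
  proof -
    have r: "filter (\<lambda>m. m \<noteq> 0) [0..<length ?L] = map Suc [0..<length L]"
      by (simp add: upt_Suc_map filter_map o_def del: upt_Suc)
    have "sorted_wrt (<) (0 # map Suc [0..<length L])"
      by (simp add: sorted_wrt_map)
    then have "ksign (\<lambda>m. fst (?L ! m)) (0 # map Suc [0..<length L]) = (1 :: 'k)"
      by (rule ksign_sorted)
    then show ?thesis unfolding sterm1_def r Let_def by (simp add: o_def map_nth)
  qed
  have S: "sterm1 X \<psi> ?L (Suc j) = sg ((fst X + 1) * fst Y) * sterm1 X (\<lambda>z. \<psi> (Y # z)) L j" for j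
  proof -
    let ?r = "filter (\<lambda>m. m \<noteq> j) [0..<length L]"
    have r: "filter (\<lambda>m. m \<noteq> Suc j) [0..<length ?L] = 0 # map Suc ?r"
      by (simp add: upt_Suc_map filter_map o_def del: upt_Suc)
    have "ksign (\<lambda>m. fst (?L ! m)) (Suc j # 0 # map Suc ?r)
        = sg (fst (L ! j) * fst Y) * (ksign (\<lambda>m. fst (L ! m)) (j # ?r) :: 'k)"
    proof -
      have "filter (\<lambda>i. i < Suc j) (map Suc ?r) = map Suc (filter (\<lambda>i. i < j) ?r)"
        by (simp add: filter_map o_def)
      moreover have "filter (\<lambda>i. i < 0) (map Suc ?r) = []" by simp
      ultimately show ?thesis
        by (simp add: ksign_Cons ksign_map_Suc o_def distrib_left sg_add mult.assoc)
    qed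
    \<comment> \<open>The part of this sign that involves \<open>L ! j\<close> cancels against the
      Koszul sign above, leaving the sign of the derivation.\<close>
    moreover have "\<psi> (op X (L ! j) # Y # map ((!) L) ?r)
        = sg ((fst X + fst (L ! j) + 1) * fst Y) * \<psi> (Y # op X (L ! j) # map ((!) L) ?r)"
      using Cons.prems[of "[]" "op X (L ! j)" Y] by (simp add: fst_op)
    ultimately show ?thesis
      unfolding sterm1_def r Let_def by (simp add: o_def) (simp add: sg_def)
  qed
  have "(\<Sum>j<length L. sterm1 X (\<lambda>z. \<psi> (Y # z)) L j) = ad X (\<lambda>z. \<psi> (Y # z)) L"
    by (rule Cons.IH) (rule Cons.prems[of "Y # _", unfolded append_Cons])
  then show ?case
    by (simp add: sum.lessThan_Suc_shift 0 S sum_distrib_left[symmetric] del: sum.lessThan_Suc)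
qed simp

lemma sterm_sum:
  "(\<And>X Y P A. \<psi> (P @ X # Y # A) = sg (fst X * fst Y) * \<psi> (P @ Y # X # A)) \<Longrightarrow>
   (\<Sum>j<length Xs. \<Sum>i<j. sterm \<psi> Xs i j) = el \<psi> Xs"
proof (induction Xs arbitrary: \<psi>)
  case (Cons X L)
  let ?L = "X # L"
  have 0: "sterm \<psi> ?L 0 (Suc j) = sterm1 X \<psi> L j" for j
  proof -
    let ?r = "filter (\<lambda>m. m \<noteq> j) [0..<length L]"
    have r: "filter (\<lambda>m. m \<noteq> 0 \<and> m \<noteq> Suc j) [0..<length ?L] = map Suc ?r"
      by (simp add: upt_Suc_map filter_map o_def del: upt_Suc)
    have "ksign (\<lambda>m. fst (?L ! m)) (0 # Suc j # map Suc ?r)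
        = (ksign (\<lambda>m. fst (L ! m)) (j # ?r) :: 'k)"
      using ksign_map_Suc[of "\<lambda>m. fst (?L ! m)" "j # ?r"] by (subst ksign_Cons) simp
    then show ?thesis
      unfolding sterm_def sterm1_def r Let_def by (simp add: o_def)
  qed
  have S: "sterm \<psi> ?L (Suc i) (Suc j) = sg (fst X) * sterm (\<lambda>z. \<psi> (X # z)) L i j" if "i < j" for i j
  proof -
    let ?r = "filter (\<lambda>m. m \<noteq> i \<and> m \<noteq> j) [0..<length L]"
    have r: "filter (\<lambda>m. m \<noteq> Suc i \<and> m \<noteq> Suc j) [0..<length ?L] = 0 # map Suc ?r"
      by (simp add: upt_Suc_map filter_map o_def del: upt_Suc)
    have f: "filter (\<lambda>m. m < Suc k) (map Suc ?r) = map Suc (filter (\<lambda>m. m < k) ?r)" for k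
      by (simp add: filter_map o_def)
    have "ksign (\<lambda>m. fst (?L ! m)) (Suc i # Suc j # 0 # map Suc ?r)
        = sg ((fst (L ! i) + fst (L ! j)) * fst X) * (ksign (\<lambda>m. fst (L ! m)) (i # j # ?r) :: 'k)"
      using that by (simp add: ksign_Cons ksign_map_Suc f o_def distrib_left distrib_right sg_add mult_ac)
    moreover have "\<psi> (op (L ! i) (L ! j) # X # map ((!) L) ?r)
        = sg ((fst (L ! i) + fst (L ! j) + 1) * fst X) * \<psi> (X # op (L ! i) (L ! j) # map ((!) L) ?r)"
      using Cons.prems[of "[]" "op (L ! i) (L ! j)" X] by (simp add: fst_op)
    ultimately show ?thesis
      unfolding sterm_def r Let_def by (simp add: o_def) (simp add: sg_def)
  qed
  have "(\<Sum>j<length L. \<Sum>i<j. sterm (\<lambda>z. \<psi> (X # z)) L i j) = el (\<lambda>z. \<psi> (X # z)) L"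
    by (rule Cons.IH) (rule Cons.prems[of "X # _", unfolded append_Cons])
  moreover have "(\<Sum>i<Suc j. sterm \<psi> ?L i (Suc j))
      = sterm1 X \<psi> L j + sg (fst X) * (\<Sum>i<j. sterm (\<lambda>z. \<psi> (X # z)) L i j)" for j
    unfolding sum.lessThan_Suc_shift sum_distrib_left 0 by (simp add: S)
  ultimately show ?case
    using sterm1_sum[where L = L and X = X, OF Cons.prems]
    by (simp add: sum.lessThan_Suc_shift[of _ "length L"] sum.distrib sum_distrib_left[symmetric]
        del: sum.lessThan_Suc)
qed simp

lemma ad_slot_right:
  assumes "fst a1 = fst a" "fst a2 = fst a"
  shows "\<lbrakk>\<And>p q. \<psi> (p @ a # q) = c1 * \<psi> (p @ a1 # q) + c2 * \<psi> (p @ a2 # q);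
    \<And>p q. \<psi> (p @ op X a # q) = c1 * \<psi> (p @ op X a1 # q) + c2 * \<psi> (p @ op X a2 # q)\<rbrakk>
   \<Longrightarrow> ad X \<psi> (u @ a # v) = c1 * ad X \<psi> (u @ a1 # v) + c2 * ad X \<psi> (u @ a2 # v)"
proof (induction u arbitrary: \<psi>)
  case Nil
  have "(\<lambda>L. \<psi> (a # L)) = (\<lambda>L. c1 * \<psi> (a1 # L) + c2 * \<psi> (a2 # L))"
    using Nil.prems(1)[of "[]"] by auto
  then show ?case
    using Nil.prems(2)[of "[]" v] by (simp add: ad_add ad_mult assms distrib_left mult.left_commute)
next
  case (Cons Y u)
  have "ad X (\<lambda>L. \<psi> (Y # L)) (u @ a # v)
      = c1 * ad X (\<lambda>L. \<psi> (Y # L)) (u @ a1 # v) + c2 * ad X (\<lambda>L. \<psi> (Y # L)) (u @ a2 # v)"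
    by (rule Cons.IH) (use Cons.prems[of "Y # _"] in simp_all)
  then show ?case
    using Cons.prems(1)[of "op X Y # u" v] by (simp add: distrib_left mult.left_commute)
qed

lemma ad_slot_left:
  assumes "fst a1 = fst a" "fst a2 = fst a"
  shows "(\<And>p q Y. Y \<in> set L \<Longrightarrow> \<psi> (p @ op a Y # q) = c1 * \<psi> (p @ op a1 Y # q) + c2 * \<psi> (p @ op a2 Y # q))
   \<Longrightarrow> ad a \<psi> L = c1 * ad a1 \<psi> L + c2 * ad a2 \<psi> L"
proof (induction L arbitrary: \<psi>)
  case (Cons Y L)
  have "ad a (\<lambda>L. \<psi> (Y # L)) L = c1 * ad a1 (\<lambda>L. \<psi> (Y # L)) L + c2 * ad a2 (\<lambda>L. \<psi> (Y # L)) L"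
    by (rule Cons.IH) (use Cons.prems[of _ "Y # _"] in simp)
  then show ?case
    using Cons.prems[of Y "[]" L] by (simp add: assms distrib_left mult.left_commute)
qed simp

lemma el_slot:
  assumes "fst a1 = fst a" "fst a2 = fst a"
  shows "\<lbrakk>\<And>p q. \<psi> (p @ a # q) = c1 * \<psi> (p @ a1 # q) + c2 * \<psi> (p @ a2 # q);
    \<And>p q X. X \<in> set u \<Longrightarrow> \<psi> (p @ op X a # q) = c1 * \<psi> (p @ op X a1 # q) + c2 * \<psi> (p @ op X a2 # q);
    \<And>p q Y. Y \<in> set v \<Longrightarrow> \<psi> (p @ op a Y # q) = c1 * \<psi> (p @ op a1 Y # q) + c2 * \<psi> (p @ op a2 Y # q)\<rbrakk>
   \<Longrightarrow> el \<psi> (u @ a # v) = c1 * el \<psi> (u @ a1 # v) + c2 * el \<psi> (u @ a2 # v)"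
proof (induction u arbitrary: \<psi>)
  case Nil
  have "(\<lambda>L. \<psi> (a # L)) = (\<lambda>L. c1 * \<psi> (a1 # L) + c2 * \<psi> (a2 # L))"
    using Nil.prems(1)[of "[]"] by auto
  moreover have "ad a \<psi> v = c1 * ad a1 \<psi> v + c2 * ad a2 \<psi> v"
    by (rule ad_slot_left[OF assms]) (rule Nil.prems(3))
  ultimately show ?case
    by (simp add: el_add el_mult assms distrib_left mult.left_commute)
next
  case (Cons X u)
  have "el (\<lambda>L. \<psi> (X # L)) (u @ a # v)
      = c1 * el (\<lambda>L. \<psi> (X # L)) (u @ a1 # v) + c2 * el (\<lambda>L. \<psi> (X # L)) (u @ a2 # v)"
    by (rule Cons.IH)
       (use Cons.prems(1)[of "X # _"] Cons.prems(2)[of _ "X # _"] Cons.prems(3)[of _ "X # _"] in simp_all)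
  moreover have "ad X \<psi> (u @ a # v) = c1 * ad X \<psi> (u @ a1 # v) + c2 * ad X \<psi> (u @ a2 # v)"
    by (rule ad_slot_right[OF assms]) (use Cons.prems(1,2) in simp_all)
  ultimately show ?case by (simp add: distrib_left mult.left_commute)
qed

lemma ad_swap:
  "(\<And>X Y P A. \<psi> (P @ X # Y # A) = sg (fst X * fst Y) * \<psi> (P @ Y # X # A)) \<Longrightarrow>
   ad Z \<psi> (u @ X # Y # v) = sg (fst X * fst Y) * ad Z \<psi> (u @ Y # X # v)"
proof (induction u arbitrary: \<psi>)
  case Nil
  have "ad Z (\<lambda>L. \<psi> (X # Y # L)) v = sg (fst X * fst Y) * ad Z (\<lambda>L. \<psi> (Y # X # L)) v"
    using Nil[of "[]" X Y] by (simp add: ad_mult)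
  moreover have "\<psi> (op Z X # Y # v) = sg ((fst Z + fst X + 1) * fst Y) * \<psi> (Y # op Z X # v)"
    using Nil[of "[]" "op Z X" Y v] by (simp add: fst_op)
  moreover have "\<psi> (X # op Z Y # v) = sg (fst X * (fst Z + fst Y + 1)) * \<psi> (op Z Y # X # v)"
    using Nil[of "[]" X "op Z Y" v] by (simp add: fst_op)
  ultimately show ?case
    by simp (cases "even (fst X)"; cases "even (fst Y)"; cases "even (fst Z)"; simp add: sg_def)
next
  case (Cons W u)
  have "ad Z (\<lambda>L. \<psi> (W # L)) (u @ X # Y # v) = sg (fst X * fst Y) * ad Z (\<lambda>L. \<psi> (W # L)) (u @ Y # X # v)"
    by (rule Cons.IH) (rule Cons.prems[of "W # _", unfolded append_Cons])
  then show ?case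
    using Cons.prems[of "op Z W # u" X Y v] by (simp add: distrib_left mult.left_commute)
qed

text \<open>Brackets of \<open>X\<close> with other letters and those of \<open>Y\<close> with other
  letters change roles; the bracket of \<open>X\<close> with \<open>Y\<close> itself requires the
  symmetry of \<open>op\<close>, the second hypothesis.\<close>

lemma el_swap:
  "\<lbrakk>\<And>X Y P A. \<psi> (P @ X # Y # A) = sg (fst X * fst Y) * \<psi> (P @ Y # X # A);
    \<And>P A. \<psi> (P @ op X Y # A) = sg (fst X * fst Y) * \<psi> (P @ op Y X # A)\<rbrakk> \<Longrightarrow>
   el \<psi> (u @ X # Y # v) = sg (fst X * fst Y) * el \<psi> (u @ Y # X # v)"
proof (induction u arbitrary: \<psi>)
  case Nil
  have "el (\<lambda>L. \<psi> (X # Y # L)) v = sg (fst X * fst Y) * el (\<lambda>L. \<psi> (Y # X # L)) v"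
    using Nil(1)[of "[]" X Y] by (simp add: el_mult)
  then show ?case
    using Nil(2)[of "[]" v]
    by simp (cases "even (fst X)"; cases "even (fst Y)"; simp add: sg_def)
next
  case (Cons W u)
  have "el (\<lambda>L. \<psi> (W # L)) (u @ X # Y # v) = sg (fst X * fst Y) * el (\<lambda>L. \<psi> (W # L)) (u @ Y # X # v)"
    by (rule Cons.IH; rule Cons.prems[of "W # _", unfolded append_Cons])
  then show ?case
    using ad_swap[of \<psi> W u X Y v, OF Cons.prems(1)] by (simp add: distrib_left mult.left_commute)
qed

end

section \<open>Symmetry and admissibility of the transposed coproduct and cobracket\<close>

context brace_cobrace
begin

lemma adm_zero: "adm f \<Longrightarrow> adm (\<lambda>_. 0)"
  using adm_mult[of f 0] by simp

lemma adm_sg1: "adm f \<Longrightarrow> adm (\<lambda>P. sg (dg P) * f P)"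
  using adm_sg[of f 1] by simp

lemma adm_cut: "(\<And>U V. adm (\<lambda>P. f P U V)) \<Longrightarrow> adm (\<lambda>P. cut (f P) Y)"
proof -
  assume f: "\<And>U V. adm (\<lambda>P. f P U V)"
  have "adm (\<lambda>P. \<Sum>p\<leftarrow>l. f P (fst p) (snd p))" for l
    by (induction l) (auto intro: adm_add f adm_zero[OF f])
  then show ?thesis by (simp add: cut_def)
qed

lemma tsym_sym: "tsym U V \<phi> A C = sg (dg U * dg V) * tsym V U \<phi> A C"
  by (simp add: tsym_def) (simp add: sg_def)

lemma good_tens_adm1: "good \<phi> \<Longrightarrow> adm (\<lambda>P. tens P Q \<phi> A C)"
  unfolding tens_def by (rule adm_mult, rule good_adm1[of _ "[]", unfolded append_Nil])

lemma good_tens_adm2: "good \<phi> \<Longrightarrow> adm (\<lambda>P. tens Q P \<phi> A C)"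
  unfolding tens_def mult.commute[of _ "dgs A"]
  by (rule adm_sg, rule good_adm2[of _ _ "[]", unfolded append_Nil])

lemma good_tsym_adm1:
  assumes "good \<phi>" shows "adm (\<lambda>P. tsym P Q \<phi> A C)"
  unfolding tsym_def mult.commute[of _ "dg Q"]
  by (intro adm_add adm_sg good_tens_adm1 good_tens_adm2 assms)

lemma good_tsym_adm2:
  assumes "good \<phi>" shows "adm (\<lambda>P. tsym Q P \<phi> A C)"
  unfolding tsym_sym[of Q] by (intro adm_sg good_tsym_adm1 assms)

text \<open>Here the symmetrization of \<delta> enters: \<open>cut_adm\<close> applies because
  \<open>tsym\<close> is graded symmetric in the two pieces.\<close>

lemma dlt_adm: "good \<phi> \<Longrightarrow> adm (\<lambda>X. dlt X \<phi> A C)"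
  unfolding dlt_def cut_eq[symmetric]
  by (rule cut_adm[OF good_tsym_adm1 good_tsym_adm2 tsym_sym])

lemma swapsymI: "(\<And>P X Y A. f (P @ X # Y # A) = sg (dg X * dg Y) * f (P @ Y # X # A)) \<Longrightarrow> swapsym f"
  unfolding swapsym_def by blast

lemma swapsym_cut:
  assumes "\<And>U V. swapsym (\<lambda>A. f A U V)" shows "swapsym (\<lambda>A. cut (f A) Y)"
proof (rule swapsymI)
  fix P X Z A
  have "f (P @ X # Z # A) = (\<lambda>U V. sg (dg X * dg Z) * f (P @ Z # X # A) U V)"
    by (intro ext swapsymD[OF assms])
  then show "cut (f (P @ X # Z # A)) Y = sg (dg X * dg Z) * cut (f (P @ Z # X # A)) Y"
    by (simp only: cut_mult)
qed

lemma slotadm_cut: "(\<And>U V. slotadm (\<lambda>A. f A U V)) \<Longrightarrow> slotadm (\<lambda>A. cut (f A) Y)"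
  unfolding slotadm_def by (intro allI adm_cut) blast

lemma swapsym_mult: "swapsym f \<Longrightarrow> swapsym (\<lambda>A. c * f A)"
  by (rule swapsymI, subst swapsymD[where f = f]) (simp_all add: mult.left_commute)

lemma slotadm_mult: "slotadm f \<Longrightarrow> slotadm (\<lambda>A. c * f A)"
  by (simp add: slotadm_def adm_mult)

lemma swapsym_add: "swapsym f \<Longrightarrow> swapsym g \<Longrightarrow> swapsym (\<lambda>A. f A + g A)"
  by (rule swapsymI, subst swapsymD[where f = f], assumption, subst swapsymD[where f = g], assumption)
     (simp add: distrib_left)

lemma slotadm_add: "slotadm f \<Longrightarrow> slotadm g \<Longrightarrow> slotadm (\<lambda>A. f A + g A)"
  by (simp add: slotadm_def adm_add)

lemma swapsym_Cons: "swapsym f \<Longrightarrow> swapsym (\<lambda>A. f (U # A))"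
  by (rule swapsymI, rule swapsymD[of f "U # _", unfolded append_Cons])

lemma slotadm_Cons:
  assumes "slotadm f" shows "slotadm (\<lambda>A. f (U # A))"
  unfolding slotadm_def
proof (intro allI)
  fix P A show "adm (\<lambda>X. f (U # P @ X # A))"
    using assms[unfolded slotadm_def, rule_format, of "U # P" A] by simp
qed

lemma swapsym_sg: "swapsym f \<Longrightarrow> swapsym (\<lambda>A. sg (n * dgs A) * f A)"
  by (rule swapsymI, subst swapsymD[where f = f]) (simp_all add: add.left_commute mult.left_commute)

lemma slotadm_sg: "slotadm f \<Longrightarrow> slotadm (\<lambda>A. sg (n * dgs A) * f A)"
  unfolding slotadm_def
proof (intro allI)
  fix P A assume f: "\<forall>P A. adm (\<lambda>X. f (P @ X # A))"
  have "adm (\<lambda>X. sg (n * (dgs P + dgs A)) * (sg (n * dg X) * f (P @ X # A)))"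
    using f by (intro adm_mult adm_sg) blast
  moreover have "(sg (n * dgs (P @ X # A)) :: 'k) = sg (n * (dgs P + dgs A)) * sg (n * dg X)" for X
    by (simp add: sg_add distrib_left)
  ultimately show "adm (\<lambda>X. sg (n * dgs (P @ X # A)) * f (P @ X # A))"
    by (simp only: mult.assoc)
qed

lemma good_tens:
  assumes "good \<phi>"
  shows "swapsym (\<lambda>A. tens U V \<phi> A C)" "slotadm (\<lambda>A. tens U V \<phi> A C)"
    "swapsym (tens U V \<phi> A)" "slotadm (tens U V \<phi> A)"
proof -
  have g: "swapsym (\<lambda>A. \<phi> A C)" "slotadm (\<lambda>A. \<phi> A C)" "swapsym (\<phi> A)" "slotadm (\<phi> A)" for A C
    using assms by (auto simp: good_def)
  show "swapsym (\<lambda>A. tens U V \<phi> A C)" "slotadm (\<lambda>A. tens U V \<phi> A C)"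
    unfolding tens_def
    by (rule swapsym_sg, rule swapsym_Cons[of "\<lambda>A. \<phi> A (V # C)"], rule g)
       (rule slotadm_sg, rule slotadm_Cons[of "\<lambda>A. \<phi> A (V # C)"], rule g)
  show "swapsym (tens U V \<phi> A)" "slotadm (tens U V \<phi> A)"
    unfolding tens_def[abs_def]
    by (rule swapsym_mult, rule swapsym_Cons[of "\<phi> (U # A)"], rule g)
       (rule slotadm_mult, rule slotadm_Cons[of "\<phi> (U # A)"], rule g)
qed

lemma good_dlt: "good \<phi> \<Longrightarrow> good (dlt Y \<phi>)"
  by (subst good_def, unfold dlt_def[abs_def] tsym_def, intro conjI allI swapsym_cut slotadm_cut swapsym_mult slotadm_mult swapsym_add slotadm_add
      good_tens)

text \<open>Multiplication by \<delta>(X) has degree \<open>dg X - 1\<close>, of the same parity as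
  \<open>dg X + 1\<close>; the symmetry of \<phi> lets \<open>Y\<close> pass it with the
  corresponding sign.\<close>

lemma dd_dlt:
  assumes "good \<phi>"
  shows "dd Y (dlt X \<phi>) A C = sg (dg Y * (dg X + 1)) * dlt X (dd Y \<phi>) A C"
proof -
  have t: "dd Y (tens U V \<phi>) A C = sg (dg Y * (dg U + dg V)) * tens U V (dd Y \<phi>) A C" for U V
    using good_swap1[OF assms, of "[]" Y U A] good_swap2[OF assms, of _ "[]" Y V C]
    unfolding dd_def tens_def
    by simp (cases "even (dg U)"; cases "even (dg V)"; cases "even (dg Y)"; simp add: sg_def)
  have "dd Y (tsym U V \<phi>) A C = dd Y (tens U V \<phi>) A C + sg (dg U * dg V) * dd Y (tens V U \<phi>) A C" for U V
    by (simp add: dd_def tsym_def algebra_simps)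
  then have s: "dd Y (tsym U V \<phi>) A C = sg (dg Y * (dg U + dg V)) * tsym U V (dd Y \<phi>) A C" for U V
    by (simp add: t tsym_def distrib_left mult.left_commute add.commute)
  have "dd Y (dlt X \<phi>) A C = cut (\<lambda>U V. sg (dg U + 1) * dd Y (tsym U V \<phi>) A C) X"
    unfolding dlt_def[abs_def] by (simp add: cut_dd dd_mult)
  also have "\<dots> = cut (\<lambda>U V. sg (dg Y * (dg X + 1)) * (sg (dg U + 1) * tsym U V (dd Y \<phi>) A C)) X"
  proof (rule cut_cong)
    fix U V assume "dg U + dg V = dg X - 1"
    then have "(sg (dg Y * (dg U + dg V)) :: 'k) = sg (dg Y * (dg X + 1))"
      by (simp add: sg_def)
    then show "sg (dg U + 1) * dd Y (tsym U V \<phi>) A C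
        = sg (dg Y * (dg X + 1)) * (sg (dg U + 1) * tsym U V (dd Y \<phi>) A C)"
      unfolding s by (simp add: mult.left_commute)
  qed
  finally show ?thesis by (simp add: cut_mult dlt_def)
qed

lemma dd_swap:
  assumes "good \<phi>"
  shows "dd Y (dd X \<phi>) = (\<lambda>A C. sg (dg X * dg Y) * dd X (dd Y \<phi>) A C)"
proof (intro ext)
  fix A C
  show "dd Y (dd X \<phi>) A C = sg (dg X * dg Y) * dd X (dd Y \<phi>) A C"
    using good_swap1[OF assms, of "[]" X Y A C] good_swap2[OF assms, of A "[]" X Y C]
    unfolding dd_def
    by simp (cases "even (dg X)"; cases "even (dg Y)"; simp add: sg_def)
qed

lemma cop_swap: "good \<phi> \<Longrightarrow> cop \<phi> (u @ X # Y # v) = sg (dg X * dg Y) * cop \<phi> (u @ Y # X # v)"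
proof (induction u arbitrary: \<phi>)
  case Nil
  show ?case by (simp add: dd_swap[OF Nil, of Y X] cop_mult)
qed (simp add: good_dd)

text \<open>Together with \<open>kap_slotadm\<close> this says that the transposed \<kappa> respects
  the relations of S^+(H[1]), which is what makes \<kappa> well defined.\<close>

lemma kap_swap: "good \<phi> \<Longrightarrow> kap \<phi> (u @ X # Y # v) = sg (dg X * dg Y) * kap \<phi> (u @ Y # X # v)"
proof (induction u arbitrary: \<phi>)
  case Nil
  have d: "dd Y (dlt X \<phi>) = (\<lambda>A C. sg (dg Y * (dg X + 1)) * dlt X (dd Y \<phi>) A C)"
    "dd X (dlt Y \<phi>) = (\<lambda>A C. sg (dg X * (dg Y + 1)) * dlt Y (dd X \<phi>) A C)"
    by (intro ext dd_dlt[OF Nil])+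
  show ?case
    by (simp add: d dd_swap[OF Nil, of Y X] cop_mult kap_mult)
       (cases "even (dg X)"; cases "even (dg Y)"; simp add: sg_def)
next
  case (Cons Z u)
  then show ?case
    using cop_swap[OF good_dlt[OF Cons.prems, of Z], of u X Y v] good_dd[OF Cons.prems]
    by (simp add: distrib_left mult.left_commute)
qed

lemma adm_dd: "(\<And>A C. adm (\<lambda>P. f P A C)) \<Longrightarrow> adm (\<lambda>P. dd X (f P) A C)"
  unfolding dd_def by (intro adm_add adm_mult)

lemma adm_dlt: "(\<And>A C. adm (\<lambda>P. f P A C)) \<Longrightarrow> adm (\<lambda>P. dlt X (f P) A C)"
  unfolding dlt_def tsym_def tens_def by (intro adm_cut adm_add adm_mult)

lemma adm_cop: "(\<And>A C. adm (\<lambda>P. f P A C)) \<Longrightarrow> adm (\<lambda>P. cop (f P) L)"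
proof (induction L arbitrary: f)
  case (Cons X L)
  then show ?case using Cons.IH[of "\<lambda>P. dd X (f P)"] by (simp add: adm_dd)
qed simp

lemma adm_kap: "(\<And>A C. adm (\<lambda>P. f P A C)) \<Longrightarrow> adm (\<lambda>P. kap (f P) L)"
proof (induction L arbitrary: f)
  case Nil
  then show ?case using adm_zero[of "\<lambda>P. f P [] []"] by simp
next
  case (Cons X L)
  then show ?case
    using Cons.IH[of "\<lambda>P. dd X (f P)"] adm_cop[of "\<lambda>P. dlt X (f P)" L]
    by (simp add: adm_dd adm_dlt adm_add adm_mult)
qed

lemma adm_dd_letter:
  assumes "good \<phi>" shows "adm (\<lambda>X. dd X \<phi> A C)"
  unfolding dd_def
  using good_adm1[OF assms, of "[]" A C] adm_sg[OF good_adm2[OF assms, of A "[]" C], of "dgs A"]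
  by (simp add: adm_add mult.commute)

lemma cop_slotadm: "good \<phi> \<Longrightarrow> adm (\<lambda>X. cop \<phi> (u @ X # v))"
proof (induction u arbitrary: \<phi>)
  case Nil
  then show ?case by (simp add: adm_cop adm_dd_letter)
qed (simp add: good_dd)

lemma kap_slotadm: "good \<phi> \<Longrightarrow> adm (\<lambda>X. kap \<phi> (u @ X # v))"
proof (induction u arbitrary: \<phi>)
  case Nil
  then show ?case
    by (simp add: adm_add adm_cop adm_kap adm_sg1 dlt_adm adm_dd_letter)
next
  case (Cons Y u)
  then show ?case
    by (simp add: adm_add adm_mult good_dd good_dlt cop_slotadm)
qed

lemma cop_cong_ok:
  "\<lbrakk>\<And>A C. \<lbrakk>list_all ok A; list_all ok C\<rbrakk> \<Longrightarrow> f A C = g A C; list_all ok L\<rbrakk> \<Longrightarrow> cop f L = cop g L"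
proof (induction L arbitrary: f g)
  case (Cons X L)
  have "cop (dd X f) L = cop (dd X g) L"
    by (rule Cons.IH) (use Cons.prems in \<open>auto simp: dd_def\<close>)
  then show ?case by simp
qed simp

lemma dlt_cong_ok:
  assumes "\<And>A C. \<lbrakk>A \<noteq> []; C \<noteq> []; list_all ok A; list_all ok C\<rbrakk> \<Longrightarrow> f A C = g A C"
    and "ok X" "list_all ok A" "list_all ok C"
  shows "dlt X f A C = dlt X g A C"
  unfolding dlt_def cut_def tsym_def tens_def
  using assms splits_ok[of _ _ X] by (intro arg_cong[of _ _ sum_list] map_cong) auto

text \<open>\<kappa> puts one piece of the cut letter on each side, so neither side is ever empty.
  Agreement is thus required only where \<open>Phi\<close> has its proper values.\<close>

lemma kap_cong_ok:
  "\<lbrakk>\<And>A C. \<lbrakk>A \<noteq> []; C \<noteq> []; list_all ok A; list_all ok C\<rbrakk> \<Longrightarrow> f A C = g A C; list_all ok L\<rbrakk>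
   \<Longrightarrow> kap f L = kap g L"
proof (induction L arbitrary: f g)
  case (Cons X L)
  have "kap (dd X f) L = kap (dd X g) L"
    by (rule Cons.IH) (use Cons.prems in \<open>auto simp: dd_def\<close>)
  moreover have "cop (dlt X f) L = cop (dlt X g) L"
    by (intro cop_cong_ok dlt_cong_ok) (use Cons.prems in auto)
  ultimately show ?case by simp
qed simp

section \<open>Coproduct and cobracket as sums over subsets of positions\<close>

definition subterm :: "('x list \<Rightarrow> 'x list \<Rightarrow> 'k) \<Rightarrow> 'x list \<Rightarrow> nat set \<Rightarrow> 'k" where
  "subterm \<phi> L I = (let Is = filter (\<lambda>i. i \<in> I) [0..<length L]; Js = filter (\<lambda>i. i \<notin> I) [0..<length L] in
     ksign (\<lambda>i. dg (L ! i)) (Is @ Js) * \<phi> (map ((!) L) Is) (map ((!) L) Js))"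

lemma ksign_insert_min:
  "\<forall>j\<in>set us \<union> set vs. m < j \<Longrightarrow> ksign d (us @ m # vs) = (sg (d m * sum_list (map d us)) * ksign d (us @ vs) :: 'k)"
proof (induction us)
  case Nil
  then have "filter (\<lambda>j. j < m) vs = []"
    by (intro filter_False) (auto dest: order.asym)
  then show ?case by (simp add: ksign_Cons)
next
  case (Cons i us)
  then show ?case
    by (simp add: ksign_Cons)
       (simp add: sg_add distrib_left distrib_right mult_ac)
qed

text \<open>The two summands of \<open>dd\<close>: position 0 goes to the first side without a sign,
  or to the second side, passing the whole first side; all other positions are raised by 1.\<close>

lemma subterm_Cons:
  "subterm \<phi> (X # L) (insert 0 (Suc ` I)) = subterm (\<lambda>A C. \<phi> (X # A) C) L I"
  "subterm \<phi> (X # L) (Suc ` I) = subterm (\<lambda>A C. sg (dg X * dgs A) * \<phi> A (X # C)) L I"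
proof -
  let ?Is = "filter (\<lambda>i. i \<in> I) [0..<length L]" and ?Js = "filter (\<lambda>i. i \<notin> I) [0..<length L]"
  have u: "[0..<length (X # L)] = 0 # map Suc [0..<length L]"
    by (simp add: map_Suc_upt upt_conv_Cons del: upt_Suc)
  have f: "filter (\<lambda>i. i \<in> insert 0 (Suc ` I)) [0..<length (X # L)] = 0 # map Suc ?Is"
    "filter (\<lambda>i. i \<notin> insert 0 (Suc ` I)) [0..<length (X # L)] = map Suc ?Js"
    "filter (\<lambda>i. i \<in> Suc ` I) [0..<length (X # L)] = map Suc ?Is"
    "filter (\<lambda>i. i \<notin> Suc ` I) [0..<length (X # L)] = 0 # map Suc ?Js"
    unfolding u by (auto simp: filter_map o_def image_iff intro!: filter_cong)
  have k: "ksign (\<lambda>i. dg ((X # L) ! i)) (map Suc us @ 0 # map Suc vs)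
      = (sg (dg X * dgs (map ((!) L) us)) * ksign (\<lambda>i. dg (L ! i)) (us @ vs) :: 'k)" for us vs
    by (subst ksign_insert_min)
       (auto simp: map_append[symmetric] ksign_map_Suc dgs_def o_def simp del: map_append)
  have k0: "ksign (\<lambda>i. dg ((X # L) ! i)) (0 # map Suc us @ map Suc vs)
      = (ksign (\<lambda>i. dg (L ! i)) (us @ vs) :: 'k)" for us vs
    using k[of "[]" "us @ vs"] by simp
  show "subterm \<phi> (X # L) (insert 0 (Suc ` I)) = subterm (\<lambda>A C. \<phi> (X # A) C) L I"
    unfolding subterm_def f Let_def append_Cons k0 by (simp add: o_def)
  show "subterm \<phi> (X # L) (Suc ` I) = subterm (\<lambda>A C. sg (dg X * dgs A) * \<phi> A (X # C)) L I"
    unfolding subterm_def f Let_def k by (simp add: o_def)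
qed

lemma subterm_add: "subterm (\<lambda>A C. f A C + g A C) L I = subterm f L I + subterm g L I"
  by (simp add: subterm_def Let_def distrib_left)

lemma sum_Pow_Suc:
  "(\<Sum>I\<in>Pow {..<Suc n}. f I) = (\<Sum>I\<in>Pow {..<n}. f (insert 0 (Suc ` I)) + f (Suc ` I))"
proof -
  have P: "Pow {..<Suc n} = (\<lambda>I. insert 0 (Suc ` I)) ` Pow {..<n} \<union> (\<lambda>I. Suc ` I) ` Pow {..<n}"
  proof -
    have "{..<Suc n} = insert 0 (Suc ` {..<n})"
      by (simp add: lessThan_Suc_eq_insert_0)
    moreover have "Pow (Suc ` {..<n}) = (\<lambda>I. Suc ` I) ` Pow {..<n}"
      by (rule image_Pow_surj[OF refl, symmetric])
    ultimately show ?thesis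
      by (simp add: Pow_insert image_image Un_commute del: lessThan_Suc)
  qed
  have i: "inj_on (\<lambda>I. insert 0 (Suc ` I)) (Pow {..<n})"
  proof (rule inj_onI)
    fix I J :: "nat set" assume "insert 0 (Suc ` I) = insert 0 (Suc ` J)"
    then have "Suc ` I = Suc ` J" by (auto simp: set_eq_iff image_iff)
    then show "I = J" by (simp add: inj_image_eq_iff)
  qed
  have j: "inj_on (\<lambda>I. Suc ` I) (Pow {..<n})"
    by (rule inj_onI) (simp add: inj_image_eq_iff)
  have d: "(\<lambda>I. insert 0 (Suc ` I)) ` Pow {..<n} \<inter> (\<lambda>I. Suc ` I) ` Pow {..<n} = {}"
    by auto
  show ?thesis
    unfolding P by (subst sum.union_disjoint) (auto simp: d sum.reindex[OF i] sum.reindex[OF j] sum.distrib)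
qed

lemma cop_eq_subterm: "cop \<phi> L = (\<Sum>I\<in>Pow {..<length L}. subterm \<phi> L I)"
proof (induction L arbitrary: \<phi>)
  case (Cons X L)
  have "subterm (dd X \<phi>) L I = subterm \<phi> (X # L) (insert 0 (Suc ` I)) + subterm \<phi> (X # L) (Suc ` I)" for I
    unfolding subterm_Cons subterm_add[symmetric] dd_def ..
  then show ?case by (simp add: Cons.IH sum_Pow_Suc del: lessThan_Suc)
qed (simp add: subterm_def)

text \<open>The letters at positions \<open>s\<close> and \<open>s + 1\<close> are put on different sides.\<close>

fun cops :: "nat \<Rightarrow> ('x list \<Rightarrow> 'x list \<Rightarrow> 'k) \<Rightarrow> 'x list \<Rightarrow> 'k" where
  "cops 0 \<phi> (U # V # L) = cop (tsym U V \<phi>) L"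
| "cops (Suc s) \<phi> (X # L) = cops s (dd X \<phi>) L"
| "cops _ _ _ = 0"

lemma cops_eq_subterm:
  "Suc s < length L \<Longrightarrow>
   cops s \<phi> L = (\<Sum>I\<in>Pow {..<length L}. if (s \<in> I) \<noteq> (Suc s \<in> I) then subterm \<phi> L I else 0)"
proof (induction s \<phi> L rule: cops.induct)
  case (1 \<phi> U V L)
  have "subterm (tsym U V \<phi>) L I = subterm \<phi> (U # V # L) (insert 0 (Suc ` (Suc ` I)))
      + subterm \<phi> (U # V # L) (Suc ` (insert 0 (Suc ` I)))" for I
    unfolding subterm_Cons subterm_add[symmetric]
    by (simp add: tsym_def[abs_def] tens_def distrib_left sg_add mult.assoc)
  moreover have "0 \<notin> Suc ` I" "Suc 0 \<in> insert 0 (Suc ` I) \<longleftrightarrow> 0 \<in> I" "Suc 0 \<in> Suc ` I \<longleftrightarrow> 0 \<in> I" for I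
    by auto
  ultimately show ?case
    by (simp add: cop_eq_subterm sum_Pow_Suc del: lessThan_Suc image_insert) (simp only: add.commute)
next
  case (2 s \<phi> X L)
  have "subterm (dd X \<phi>) L I = subterm \<phi> (X # L) (insert 0 (Suc ` I)) + subterm \<phi> (X # L) (Suc ` I)" for I
    unfolding subterm_Cons subterm_add[symmetric] dd_def ..
  moreover have "Suc a \<in> insert 0 (Suc ` I) \<longleftrightarrow> a \<in> I" "Suc a \<in> Suc ` I \<longleftrightarrow> a \<in> I" for I a
    by auto
  ultimately show ?case
    using 2 by (simp add: sum_Pow_Suc if_distrib cong: if_cong del: lessThan_Suc image_insert)
qed auto

lemma cop_cut: "cop (\<lambda>A C. cut (\<lambda>U V. f U V A C) Y) L = cut (\<lambda>U V. cop (f U V) L) Y"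
proof (induction L arbitrary: f)
  case (Cons X L)
  have "dd X (\<lambda>A C. cut (\<lambda>U V. f U V A C) Y) = (\<lambda>A C. cut (\<lambda>U V. dd X (f U V) A C) Y)"
    by (intro ext cut_dd)
  then show ?case by (simp add: Cons.IH)
qed simp

text \<open>The recursion unrolled: the letters before position s are distributed by
  \<open>dd\<close>, each contributing its degree to the sign, and the letter at s is replaced by
  its two pieces, which then occupy positions s and s + 1.\<close>

lemma kap_eq_cops:
  "kap \<phi> L = (\<Sum>s<length L. sg (dgs (take s L)) *
     cut (\<lambda>U V. sg (dg U + 1) * cops s \<phi> (take s L @ [U, V] @ drop (Suc s) L)) (L ! s))"
proof (induction L arbitrary: \<phi>)
  case (Cons X L)
  have "cop (dlt X \<phi>) L = cut (\<lambda>U V. sg (dg U + 1) * cop (tsym U V \<phi>) L) X"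
    unfolding dlt_def[abs_def] by (simp add: cop_cut cop_mult)
  then show ?case
    by (simp add: Cons.IH sum.lessThan_Suc_shift sum_distrib_left sg_add mult.assoc del: sum.lessThan_Suc)
qed simp

end

text \<open>Adjacent transpositions suffice: \<open>m\<close> carries the entry that has to come
  first across everything before it.\<close>

lemma mset_eq_swap_invariant:
  assumes "\<And>p a b q. f (p @ a # b # q) = f (p @ b # a # q)" and "mset xs = mset ys"
  shows "f xs = f ys"
proof -
  have m: "f (r @ p @ x # q) = f (r @ x # p @ q)" for r p x q
  proof (induction p arbitrary: r)
    case (Cons a p)
    then show ?case
      using Cons.IH[of "r @ [a]"] assms(1)[of r a x "p @ q"] by simp
  qed simp
  have "f (r @ xs) = f (r @ ys)" for r
    using assms(2)
  proof (induction xs arbitrary: r ys)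
    case (Cons x xs)
    then have "x \<in> set ys" by (metis list.set_intros(1) set_mset_mset)
    then obtain p q where ys: "ys = p @ x # q" by (meson split_list)
    then have "mset xs = mset (p @ q)" using Cons.prems by simp
    from Cons.IH[OF this, of "r @ [x]"] show ?case by (simp add: ys m)
  qed simp
  from this[of "[]"] show ?thesis by simp
qed

lemma ksign_swap:
  assumes "a \<noteq> b"
  shows "ksign d (p @ a # b # q) = sg (d a * d b) * ksign d (p @ b # a # q)"
proof (induction p)
  case Nil
  have 1: "sg (d a * d b) * (sg (d b * (d a + m)) * x) = sg (d b * m) * x" for m x
    by (rule sg_sg_eq(3)) auto
  have 2: "sg (d a * (d b + m)) * x = sg (d a * d b) * (sg (d a * m) * x)" for m x
    by (simp add: distrib_left sg_add)
  show ?case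
    using assms by (cases "a < b") (simp_all add: ksign_Cons 1 2 mult.left_commute)
next
  case (Cons i p)
  have "sum_list (map d (filter (\<lambda>j. j < i) (p @ a # b # q)))
      = sum_list (map d (filter (\<lambda>j. j < i) (p @ b # a # q)))"
    by (simp add: algebra_simps)
  then show ?case
    unfolding append_Cons ksign_Cons Cons.IH by (simp add: mult.left_commute)
qed

section \<open>Multilinear functionals whose letters are classes in a quotient\<close>

lemma gshift_simps [simp]: "comp (gshift W) d = comp W (d + 1)" "gadd (gshift W) = gadd W"
  "gscale (gshift W) = gscale W" "gcarrier (gshift W) = gcarrier W"
  by (simp_all add: gshift_def)

lemma tcls_in_comp: "Poly_Mapping.keys p \<subseteq> {w \<in> A. wdeg w = d} \<Longrightarrow> tcls E p \<in> comp (gquot A E) d"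
  by (auto simp: comp_gquot)

lemma gclosed_gquot: "gclosed (gquot A E)"
  unfolding gclosed_def
proof (intro conjI allI ballI)
  fix d x y c assume x: "x \<in> comp (gquot A E) d"
  then obtain p where p: "x = tcls E p" "Poly_Mapping.keys p \<subseteq> {w \<in> A. wdeg w = d}"
    by (auto simp: comp_gquot)
  show "gscale (gquot A E) c x \<in> comp (gquot A E) d"
    unfolding p gscale_tcls by (rule tcls_in_comp, rule subset_trans[OF keys_fscale p(2)])
  assume "y \<in> comp (gquot A E) d"
  then obtain q where q: "y = tcls E q" "Poly_Mapping.keys q \<subseteq> {w \<in> A. wdeg w = d}"
    by (auto simp: comp_gquot)
  show "gadd (gquot A E) x y \<in> comp (gquot A E) d"
    unfolding p q gadd_tcls by (intro tcls_in_comp subset_trans[OF keys_add] Un_least p q)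
qed

lemma gclosed_gshift: "gclosed W \<Longrightarrow> gclosed (gshift W)"
  by (simp add: gclosed_def)

text \<open>The letters of a space built on \<open>W\<close> carry degrees that differ by \<open>s\<close> from those of the
  underlying quotient.\<close>

definition presented :: "('k, ('k::field, 'v) formal set) gspace \<Rightarrow> 'v letter list set
    \<Rightarrow> ('k, 'v) formal set \<Rightarrow> int \<Rightarrow> bool" where
  "presented W A E s \<longleftrightarrow> (\<forall>d. comp W d = comp (gquot A E) (d + s))
     \<and> gadd W = gadd (gquot A E) \<and> gscale W = gscale (gquot A E)"

lemma slot_pair:
  assumes \<chi>: "mlin W \<chi>" and W: "presented W A E s"
    and p: "Poly_Mapping.keys p \<subseteq> {w \<in> A. wdeg w = d + s}"
  shows "\<chi> (u @ (d, tcls E p) # v) = pair (\<lambda>z. \<chi> (u @ (d, tcls E (Poly_Mapping.single z 1)) # v)) p"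
  using p
proof (induction rule: formal_induct)
  case zero
  have m: "tcls E 0 \<in> comp W d" using W by (auto simp: presented_def intro!: tcls_in_comp)
  have "gscale W 0 (tcls E 0) = tcls E 0"
    using W by (simp add: presented_def gscale_tcls)
  moreover have "\<chi> (u @ (d, gscale W 0 (tcls E 0)) # v) = 0 * \<chi> (u @ (d, tcls E 0) # v)"
    using \<chi> m unfolding mlin_def by blast
  ultimately show ?case by simp
next
  case (single w)
  then show ?case by simp
next
  case (add p q)
  then have "tcls E p \<in> comp W d" "tcls E q \<in> comp W d"
    using W by (auto simp: presented_def intro!: tcls_in_comp)
  then have "\<chi> (u @ (d, gadd W (tcls E p) (tcls E q)) # v) = \<chi> (u @ (d, tcls E p) # v) + \<chi> (u @ (d, tcls E q) # v)"
    using \<chi> unfolding mlin_def by blast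
  then show ?case using add W by (simp add: presented_def gadd_tcls pair_add)
next
  case (scale c p)
  then have "tcls E p \<in> comp W d"
    using W by (auto simp: presented_def intro!: tcls_in_comp)
  then have "\<chi> (u @ (d, gscale W c (tcls E p)) # v) = c * \<chi> (u @ (d, tcls E p) # v)"
    using \<chi> unfolding mlin_def by blast
  then show ?case using scale W by (simp add: presented_def gscale_tcls pair_fscale)
qed

definition homog :: "('k::field, 'v) formal set \<Rightarrow> bool" where
  "homog E \<longleftrightarrow> (\<forall>e\<in>E. \<exists>d. \<forall>w\<in>Poly_Mapping.keys e. wdeg w = d)"

text \<open>An outer functional, read along one slot, respects the inner relations because the class
  of a relation is 0. Homogeneity enters since the slot also carries a degree, which must be the
  same for all words of the relation.\<close>

lemma slot_rel:
  assumes \<chi>: "mlin W \<chi>" and W: "presented W A E s" and E: "rel_on A E" "homog E" and e: "e \<in> E"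
  shows "pair (\<lambda>z. \<chi> (u @ (wdeg z - s, tcls E (Poly_Mapping.single z 1)) # v)) e = 0"
proof -
  obtain n where n: "\<And>w. w \<in> Poly_Mapping.keys e \<Longrightarrow> wdeg w = n"
    using E(2) e by (auto simp: homog_def)
  have k: "Poly_Mapping.keys e \<subseteq> {w \<in> A. wdeg w = (n - s) + s}"
    using E(1) e n by (auto simp: rel_on_def)
  have "pair (\<lambda>z. \<chi> (u @ (wdeg z - s, tcls E (Poly_Mapping.single z 1)) # v)) e
      = pair (\<lambda>z. \<chi> (u @ (n - s, tcls E (Poly_Mapping.single z 1)) # v)) e"
    by (rule pair_cong) (simp add: n)
  also have "\<dots> = \<chi> (u @ (n - s, tcls E e) # v)"
    by (rule slot_pair[OF \<chi> W k, symmetric])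
  also have "tcls E e = tcls E 0"
    using e by (simp add: tcls_eq_iff free.span_base)
  also have "\<chi> (u @ (n - s, tcls E 0) # v) = 0"
    using slot_pair[OF \<chi> W, of 0 "n - s" u v] by simp
  finally show ?thesis .
qed

lemma homog_ml_rels: "homog (ml_rels V A :: ('k::field, 'v) formal set)"
  unfolding homog_def
proof
  fix e :: "('k, 'v) formal" assume "e \<in> ml_rels V A"
  then consider
    (a) u v d x y where "e = Poly_Mapping.single (u @ (d, gadd V x y) # v) 1
        - Poly_Mapping.single (u @ (d, x) # v) 1 - Poly_Mapping.single (u @ (d, y) # v) 1"
  | (s) u v d c x where
      "e = Poly_Mapping.single (u @ (d, gscale V c x) # v) 1 - Poly_Mapping.single (u @ (d, x) # v) c"
    unfolding ml_rels_def by blast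
  then show "\<exists>d. \<forall>w\<in>Poly_Mapping.keys e. wdeg w = d"
  proof cases
    case a
    have "Poly_Mapping.keys e \<subseteq> {w. wdeg w = wdeg u + d + wdeg v}"
      unfolding a by (intro subset_trans[OF keys_minus_subset] Un_least keys_single_subset) auto
    then show ?thesis by blast
  next
    case s
    have "Poly_Mapping.keys e \<subseteq> {w. wdeg w = wdeg u + d + wdeg v}"
      unfolding s by (intro subset_trans[OF keys_minus_subset] Un_least keys_single_subset) auto
    then show ?thesis by blast
  qed
qed

lemma homog_Hrel: "homog (Hrel V :: ('k::field, 'v) formal set)"
  unfolding homog_def
proof
  fix e :: "('k, 'v) formal" assume "e \<in> Hrel V"
  then consider "e \<in> ml_rels V (words V)" | p w where "e = bat p w" "p < length w"
    unfolding Hrel_def by blast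
  then show "\<exists>d. \<forall>w\<in>Poly_Mapping.keys e. wdeg w = d"
  proof cases
    case 1
    then show ?thesis using homog_ml_rels by (auto simp: homog_def)
  next
    case 2
    have "Poly_Mapping.keys e \<subseteq> {z. wdeg z = wdeg w}"
      unfolding 2(1) bat_def
    proof (intro keys_sum_subset keys_single_subset CollectI)
      fix \<sigma> assume "\<sigma> \<in> Bat p (length w - p)"
      then have "inv \<sigma> permutes {..<length w}"
        using 2(2) by (simp add: Bat_def permutes_inv)
      then have "mset (permute_list (inv \<sigma>) w) = mset w" by (rule mset_permute_list)
      then show "wdeg (permute_list (inv \<sigma>) w) = wdeg w"
        using mset_wdeg[of "permute_list (inv \<sigma>) w" w "[]"] by simp
    qed
    then show ?thesis by blast
  qed
qed

lemma homog_Srel: "homog (Srel V :: ('k::field, 'v) formal set)"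
  unfolding homog_def
proof
  fix e :: "('k, 'v) formal" assume "e \<in> Srel V"
  then consider "e \<in> ml_rels V (words V)" | u v a b where
    "e = Poly_Mapping.single (u @ [a, b] @ v) 1 - Poly_Mapping.single (u @ [b, a] @ v) ((-1) powi (fst a * fst b))"
    unfolding Srel_def by blast
  then show "\<exists>d. \<forall>w\<in>Poly_Mapping.keys e. wdeg w = d"
  proof cases
    case 1
    then show ?thesis using homog_ml_rels by (auto simp: homog_def)
  next
    case 2
    have "Poly_Mapping.keys e \<subseteq> {w. wdeg w = wdeg u + fst a + fst b + wdeg v}"
      unfolding 2 by (intro subset_trans[OF keys_minus_subset] Un_least keys_single_subset) auto
    then show ?thesis by blast
  qed
qed

section \<open>The bracket of \<H> is well defined\<close>

context graded_bracket
begin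

abbreviation "H1 \<equiv> gshift (Hspace V)"

lemma presented_H1: "presented H1 (words V) (Hrel V) 1"
  by (simp add: presented_def Hspace_def)

lemma gclosed_H1: "gclosed H1"
  unfolding Hspace_def by (intro gclosed_gshift gclosed_gquot)

lemma keys_bracket_word:
  assumes "v \<in> words V" "w \<in> words V"
  shows "Poly_Mapping.keys (bracket_word brk v w :: ('k, 'v) formal) \<subseteq> {z \<in> words V. wdeg z = wdeg v + wdeg w}"
  unfolding bracket_word_def Let_def
proof (intro keys_sum_subset keys_single_subset)
  fix \<sigma> k
  assume s: "\<sigma> \<in> Bat (length v) (length w)"
    and k: "k \<in> {k. Suc k < length v + length w \<and> inv \<sigma> k < length v \<and> length v \<le> inv \<sigma> (Suc k)}"
  define u where "u = permute_list (inv \<sigma>) (v @ w)"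
  have i: "inv \<sigma> permutes {..<length (v @ w)}"
    using s by (simp add: Bat_def permutes_inv)
  have m: "mset u = mset v + mset w"
    unfolding u_def using mset_permute_list[OF i] by simp
  have ok: "list_all (okl V) u"
  proof -
    have "set u = set v \<union> set w" using m by (metis set_mset_mset set_mset_union)
    then show ?thesis using assms by (auto simp: words_iff list_all_iff)
  qed
  have l: "Suc k < length u" using k by (simp add: u_def)
  have e: "u = take k u @ u ! k # u ! Suc k # drop (k + 2) u"
    using l id_take_nth_drop[of k u] Cons_nth_drop_Suc[of "Suc k" u] by simp
  have "list_all (okl V) (take k u @ u ! k # u ! Suc k # drop (k + 2) u)"
    using ok e by simp
  then have "okl V (u ! k)" "okl V (u ! Suc k)" "list_all (okl V) (take k u)" "list_all (okl V) (drop (k + 2) u)"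
    by auto
  moreover have "wdeg u = wdeg (take k u) + (fst (u ! k) + (fst (u ! Suc k) + wdeg (drop (k + 2) u)))"
    by (subst e) simp
  ultimately show "take k (permute_list (inv \<sigma>) (v @ w)) @
      (fst (permute_list (inv \<sigma>) (v @ w) ! k) + fst (permute_list (inv \<sigma>) (v @ w) ! Suc k),
       brk (snd (permute_list (inv \<sigma>) (v @ w) ! k)) (snd (permute_list (inv \<sigma>) (v @ w) ! Suc k))) #
      drop (k + 2) (permute_list (inv \<sigma>) (v @ w)) \<in> {z \<in> words V. wdeg z = wdeg v + wdeg w}"
    using mset_wdeg[OF m] okl_bl[of "u ! k" "u ! Suc k"] unfolding u_def[symmetric]
    by (simp add: words_iff bl_def)
qed

definition bf :: "('v letter list \<Rightarrow> 'k) \<Rightarrow> 'v letter list \<Rightarrow> 'v letter list \<Rightarrow> 'k" where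
  "bf \<chi> v w = (if v \<in> words V \<and> w \<in> words V then br brk \<chi> v w else 0)"

text \<open>Multilinearity comes from \<open>br_slot\<close>. For a shuffle in the first argument,
  \<open>sh_br\<close> moves the shuffle inside, where \<chi> vanishes.\<close>

lemma admH_bf1:
  assumes \<chi>: "admH \<chi>" shows "admH (\<lambda>v. bf \<chi> v w)"
  unfolding adm_Hrel_iff[OF gclosed]
proof (intro conjI allI impI)
  show "bf \<chi> v w = 0" if "v \<notin> words V" for v
    using that by (simp add: bf_def)
  show "mlin V (\<lambda>v. bf \<chi> v w)"
    unfolding mlin_def
  proof (intro allI impI conjI ballI)
    fix u v d x c assume x: "x \<in> comp V d"
    have sx: "gscale V c x \<in> comp V d" using gclosed x by (simp add: gclosed_def)
    have "br brk \<chi> (u @ (d, gscale V c x) # v) w = c * br brk \<chi> (u @ (d, x) # v) w + 0 * br brk \<chi> (u @ (d, x) # v) w"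
      if w: "list_all (okl V) w"
    proof (rule br_slot)
      fix p q b assume "b \<in> set w"
      then have b: "snd b \<in> comp V (fst b)" using w by (auto simp: list_all_iff okl_def)
      show "\<chi> (p @ bl brk (d, gscale V c x) b # q) = c * \<chi> (p @ bl brk (d, x) b # q) + 0 * \<chi> (p @ bl brk (d, x) b # q)"
        using admH_mlin[OF \<chi>] brk_comp[OF x b] by (simp add: bl_def brk_scale[OF x b] mlin_def)
    qed (use admH_mlin[OF \<chi>] x in \<open>simp_all add: mlin_def\<close>)
    then show "bf \<chi> (u @ (d, gscale V c x) # v) w = c * bf \<chi> (u @ (d, x) # v) w"
      using x sx by (simp add: bf_def words_iff okl_def)
    fix y assume y: "y \<in> comp V d"
    have sxy: "gadd V x y \<in> comp V d" using gclosed x y by (simp add: gclosed_def)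
    have "br brk \<chi> (u @ (d, gadd V x y) # v) w = 1 * br brk \<chi> (u @ (d, x) # v) w + 1 * br brk \<chi> (u @ (d, y) # v) w"
      if w: "list_all (okl V) w"
    proof (rule br_slot)
      fix p q b assume "b \<in> set w"
      then have b: "snd b \<in> comp V (fst b)" using w by (auto simp: list_all_iff okl_def)
      show "\<chi> (p @ bl brk (d, gadd V x y) b # q) = 1 * \<chi> (p @ bl brk (d, x) b # q) + 1 * \<chi> (p @ bl brk (d, y) b # q)"
        using admH_mlin[OF \<chi>] brk_comp[OF x b] brk_comp[OF y b] by (simp add: bl_def brk_add[OF x y b] mlin_def)
    qed (use admH_mlin[OF \<chi>] x y in \<open>simp_all add: mlin_def\<close>)
    then show "bf \<chi> (u @ (d, gadd V x y) # v) w = bf \<chi> (u @ (d, x) # v) w + bf \<chi> (u @ (d, y) # v) w"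
      using x y sxy by (simp add: bf_def words_iff okl_def)
  qed
  fix u v :: "'v letter list" assume ne: "u \<noteq> []" "v \<noteq> []"
  show "sh (\<lambda>v. bf \<chi> v w) u v = 0"
  proof (cases "u @ v \<in> words V \<and> w \<in> words V")
    case True
    have "sh (\<lambda>v. bf \<chi> v w) u v = sh (\<lambda>v. br brk \<chi> v w) u v"
    proof (rule sh_cong)
      fix z assume z: "mset z = mset u + mset v"
      then have "set z = set (u @ v)" by (metis mset_append set_mset_mset)
      then have "z \<in> words V"
        using True by (auto simp: words_iff list_all_iff simp flip: set_empty)
      then show "bf \<chi> z w = br brk \<chi> z w" using True by (simp add: bf_def)
    qed
    also have "\<dots> = br brk (\<lambda>_. 0) v w + sg (wdeg v * wdeg w) * br brk (\<lambda>_. 0) u w"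
      unfolding sh_br
      by (intro arg_cong2[of _ _ _ _ "\<lambda>a b. a + sg (wdeg v * wdeg w) * b"] br_cong_wdeg admH_sh[OF \<chi>] ne)
    finally show ?thesis by (simp add: br_zero)
  next
    case False
    then show ?thesis
    proof (cases "w \<in> words V")
      case True
      then show ?thesis using False by (intro sh_off_words) (auto simp: bf_def)
    next
      case False
      then show ?thesis by (simp add: bf_def sh_zero)
    qed
  qed
qed

lemma bf_antisym:
  assumes \<chi>: "admH \<chi>"
  shows "bf \<chi> v w = - sg (wdeg v * wdeg w) * bf \<chi> w v"
proof (cases "v \<in> words V \<and> w \<in> words V")
  case True
  have "br brk \<chi> v w = - sg (wdeg v * wdeg w) * br brk \<chi> w v"
  proof (rule br_antisym[of "okl V"])
    fix a b p q assume ab: "okl V a" "okl V b"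
    then have c: "brk (snd b) (snd a) \<in> comp V (fst a + fst b)"
      using brk_comp[of "snd b" "fst b" "snd a" "fst a"] by (simp add: okl_def add.commute)
    have "brk (snd a) (snd b) = gscale V (- sg (fst a * fst b)) (brk (snd b) (snd a))"
      using ab by (intro brk_anti) (simp_all add: okl_def)
    then show "\<chi> (p @ bl brk a b # q) = - sg (fst a * fst b) * \<chi> (p @ bl brk b a # q)"
      using admH_mlin[OF \<chi>] c by (simp add: bl_def mlin_def add.commute[of "fst b"])
  qed (use True in \<open>simp_all add: words_iff\<close>)
  then show ?thesis using True by (simp add: bf_def)
qed (auto simp: bf_def)

text \<open>Antisymmetry exchanges the arguments; the sign depends on \<open>w\<close> only through
  its degree and is absorbed by \<open>admH_sg\<close>.\<close>

lemma admH_bf2: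
  assumes \<chi>: "admH \<chi>" shows "admH (\<lambda>w. bf \<chi> v w)"
proof -
  have "bf \<chi> v w = - sg (wdeg v) * (sg (wdeg v * dgw w) * bf \<chi> w v)" for w
    by (subst bf_antisym[OF \<chi>]) (simp add: dgw_def sg_def)
  moreover have "admH (\<lambda>w. - sg (wdeg v) * (sg (wdeg v * dgw w) * bf \<chi> w v))"
    by (intro admH_mult admH_sg admH_bf1 \<chi>)
  ultimately show ?thesis by (simp only:)
qed

definition bw :: "'v letter list \<Rightarrow> 'v letter list \<Rightarrow> ('k, 'v) formal" where
  "bw v w = (if v \<in> words V \<and> w \<in> words V then bracket_word brk v w else 0)"

lemma pair_bw: "pair \<chi> (bw v w) = bf \<chi> v w"
  by (simp add: bw_def bf_def pair_bracket_word)

lemma keys_bw: "Poly_Mapping.keys (bw v w) \<subseteq> words V"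
  using keys_bracket_word[of v w] by (auto simp: bw_def)

definition Fbr :: "('k, 'v) formal \<Rightarrow> ('k, 'v) formal \<Rightarrow> ('k, 'v) formal" where
  "Fbr p q = lext (\<lambda>v. lext (bw v) q) p"

lemma keys_Fbr: "Poly_Mapping.keys (Fbr p q) \<subseteq> words V"
  unfolding Fbr_def by (intro keys_lext keys_bw)

lemma pair_Fbr: "pair \<chi> (Fbr p q) = pair (\<lambda>v. pair (\<lambda>w. bf \<chi> v w) q) p"
  by (simp add: Fbr_def pair_lext pair_bw)

text \<open>The representatives are changed one argument at a time, \<open>pair_swap\<close>
  bringing the argument in question to the inside.\<close>

lemma Fbr_cong:
  assumes "tcls (Hrel V) p = tcls (Hrel V) p'" "tcls (Hrel V) q = tcls (Hrel V) q'"
  shows "tcls (Hrel V) (Fbr p q) = tcls (Hrel V) (Fbr p' q')"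
proof (rule tcls_eqI[OF rel_on_Hrel[OF gclosed] keys_Fbr keys_Fbr])
  fix \<chi> assume \<chi>: "admH \<chi>"
  have "pair \<chi> (Fbr p q) = pair (\<lambda>v. pair (\<lambda>w. bf \<chi> v w) q') p"
    unfolding pair_Fbr by (rule pair_cong, rule adm_pair_eq[OF admH_bf2[OF \<chi>] assms(2)])
  also have "\<dots> = pair (\<lambda>w. pair (\<lambda>v. bf \<chi> v w) p) q'" by (rule pair_swap)
  also have "\<dots> = pair (\<lambda>w. pair (\<lambda>v. bf \<chi> v w) p') q'"
    by (rule pair_cong, rule adm_pair_eq[OF admH_bf1[OF \<chi>] assms(1)])
  also have "\<dots> = pair \<chi> (Fbr p' q')" unfolding pair_Fbr by (rule pair_swap)
  finally show "pair \<chi> (Fbr p q) = pair \<chi> (Fbr p' q')" .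
qed

lemma Fbr_lin:
  "tcls (Hrel V) (Fbr (p + p') q) = tcls (Hrel V) (Fbr p q + Fbr p' q)"
  "tcls (Hrel V) (Fbr p (q + q')) = tcls (Hrel V) (Fbr p q + Fbr p q')"
  "tcls (Hrel V) (Fbr (fscale c p) q) = tcls (Hrel V) (fscale c (Fbr p q))"
  "tcls (Hrel V) (Fbr p (fscale c q)) = tcls (Hrel V) (fscale c (Fbr p q))"
  by (rule tcls_eqI[OF rel_on_Hrel[OF gclosed] keys_Fbr],
      (rule subset_trans[OF keys_add] subset_trans[OF keys_fscale], (intro Un_least)?; rule keys_Fbr)+,
      simp add: pair_Fbr pair_add pair_fscale pair_fun_add pair_fun_mult)+

text \<open>\<open>Hbracket\<close> is a choice, and its defining properties become available only
  through existence (\<open>Hbracket_spec\<close>). The same pattern recurs for \<ell>, \<kappa> and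
  the tensor maps.\<close>

lemma Hbracket_exists:
  "\<exists>b. (\<forall>X\<in>gcarrier (Hspace V). glinear (Hspace V) (Hspace V) (b X)) \<and>
     (\<forall>Y\<in>gcarrier (Hspace V). glinear (Hspace V) (Hspace V) (\<lambda>X. b X Y)) \<and>
     (\<forall>v\<in>words V. \<forall>w\<in>words V. b (hcls V v) (hcls V w) = tcls (Hrel V) (bracket_word brk v w))"
proof -
  define b where "b C D = tcls (Hrel V) (Fbr (SOME p. p \<in> C) (SOME q. q \<in> D))" for C D
  have some: "tcls (Hrel V) (SOME q. q \<in> tcls (Hrel V) p) = tcls (Hrel V) p" for p :: "('k, 'v) formal"
    by (rule tcls_mem, rule someI, rule tcls_self)
  have b: "b (tcls (Hrel V) p) (tcls (Hrel V) q) = tcls (Hrel V) (Fbr p q)" for p q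
    unfolding b_def by (rule Fbr_cong[OF some some])
  have c: "tcls (Hrel V) (Fbr p q) \<in> gcarrier (gquot (words V) (Hrel V))" for p q
    by (rule tcls_in_gcarrier[OF keys_Fbr])
  have "glinear (Hspace V) (Hspace V) (b X)" if "X \<in> gcarrier (Hspace V)" for X
    using that unfolding glinear_def Hspace_def gcarrier_gquot[of "words V" "Hrel V"]
    using c by (auto simp: b gadd_tcls gscale_tcls Fbr_lin gcarrier_gquot)
  moreover have "glinear (Hspace V) (Hspace V) (\<lambda>X. b X Y)" if "Y \<in> gcarrier (Hspace V)" for Y
    using that unfolding glinear_def Hspace_def gcarrier_gquot[of "words V" "Hrel V"]
    using c by (auto simp: b gadd_tcls gscale_tcls Fbr_lin gcarrier_gquot)
  moreover have "b (hcls V v) (hcls V w) = tcls (Hrel V) (bracket_word brk v w)"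
    if "v \<in> words V" "w \<in> words V" for v w
    using that by (simp add: hcls_def b Fbr_def lext_single bw_def)
  ultimately show ?thesis by blast
qed

lemmas Hbracket_spec = someI_ex[OF Hbracket_exists, folded Hbracket_def]

lemma hcls_in_gcarrier: "w \<in> words V \<Longrightarrow> hcls V w \<in> gcarrier (Hspace V)"
  unfolding hcls_def Hspace_def by (rule tcls_in_gcarrier) (simp add: keys_single)

lemma Hbracket_tcls:
  assumes p: "Poly_Mapping.keys p \<subseteq> words V" and q: "Poly_Mapping.keys q \<subseteq> words V"
  shows "Hbracket V brk (tcls (Hrel V) p) (tcls (Hrel V) q) = tcls (Hrel V) (Fbr p q)"
proof -
  have 1: "Hbracket V brk (hcls V v) (tcls (Hrel V) q) = tcls (Hrel V) (lext (bw v) q)" if v: "v \<in> words V" for v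
  proof (rule glinear_tcls[OF _ _ q])
    show "glinear (gquot (words V) (Hrel V)) (gquot (words V) (Hrel V)) (Hbracket V brk (hcls V v))"
      using Hbracket_spec hcls_in_gcarrier[OF v] by (simp add: Hspace_def)
    show "Hbracket V brk (hcls V v) (tcls (Hrel V) (Poly_Mapping.single w 1)) = tcls (Hrel V) (bw v w)"
      if "w \<in> words V" for w
      using Hbracket_spec v that by (simp add: hcls_def bw_def)
  qed
  show ?thesis
    unfolding Fbr_def
  proof (rule glinear_tcls[OF _ _ p, where f = "\<lambda>X. Hbracket V brk X (tcls (Hrel V) q)"])
    show "glinear (gquot (words V) (Hrel V)) (gquot (words V) (Hrel V)) (\<lambda>X. Hbracket V brk X (tcls (Hrel V) q))"
      using Hbracket_spec tcls_in_gcarrier[OF q, of "Hrel V"] by (simp add: Hspace_def)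
    show "Hbracket V brk (tcls (Hrel V) (Poly_Mapping.single v 1)) (tcls (Hrel V) q) = tcls (Hrel V) (lext (bw v) q)"
      if "v \<in> words V" for v
      using 1[OF that] by (simp add: hcls_def)
  qed
qed

end

lemma mlin_add:
  "\<lbrakk>mlin W \<psi>; x \<in> comp W d; y \<in> comp W d\<rbrakk> \<Longrightarrow> \<psi> (u @ (d, gadd W x y) # v) = \<psi> (u @ (d, x) # v) + \<psi> (u @ (d, y) # v)"
  unfolding mlin_def by blast

lemma mlin_scale:
  "\<lbrakk>mlin W \<psi>; x \<in> comp W d\<rbrakk> \<Longrightarrow> \<psi> (u @ (d, gscale W c x) # v) = c * \<psi> (u @ (d, x) # v)"
  unfolding mlin_def by blast

lemma mlin_Cons: "mlin W \<psi> \<Longrightarrow> mlin W (\<lambda>z. \<psi> (X # z))"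
  unfolding mlin_def by (metis append_Cons)

section \<open>The map \<ell> on S^+(H[1])\<close>

context graded_bracket
begin

lemma keys_Fbr_wdeg:
  assumes "Poly_Mapping.keys p \<subseteq> {w \<in> words V. wdeg w = m}" "Poly_Mapping.keys q \<subseteq> {w \<in> words V. wdeg w = n}"
  shows "Poly_Mapping.keys (Fbr p q) \<subseteq> {w \<in> words V. wdeg w = m + n}"
  unfolding Fbr_def
proof (intro keys_lext)
  fix v w assume "v \<in> Poly_Mapping.keys p" "w \<in> Poly_Mapping.keys q"
  then have "v \<in> words V" "wdeg v = m" "w \<in> words V" "wdeg w = n" using assms by auto
  then show "Poly_Mapping.keys (bw v w) \<subseteq> {w \<in> words V. wdeg w = m + n}"
    using keys_bracket_word[of v w] by (simp add: bw_def)
qed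

lemma okl_H1E:
  assumes "okl H1 X"
  obtains x p where "X = (x, tcls (Hrel V) p)" "Poly_Mapping.keys p \<subseteq> {w \<in> words V. wdeg w = x + 1}"
proof -
  obtain p where "snd X = tcls (Hrel V) p" "Poly_Mapping.keys p \<subseteq> {w \<in> words V. wdeg w = fst X + 1}"
    using assms by (auto simp: okl_def Hspace_def comp_gquot)
  then show ?thesis using that[of "fst X" p] by (simp add: prod_eq_iff)
qed

lemma comp_H1E:
  assumes "x \<in> comp H1 d"
  obtains p where "x = tcls (Hrel V) p" "Poly_Mapping.keys p \<subseteq> {w \<in> words V. wdeg w = d + 1}"
  using assms by (auto simp: Hspace_def comp_gquot)

lemma ell2_tcls:
  assumes "Poly_Mapping.keys p \<subseteq> words V" "Poly_Mapping.keys q \<subseteq> words V"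
  shows "ell2 V brk (x, tcls (Hrel V) p) (y, tcls (Hrel V) q)
    = (x + y + 1, gscale H1 (sg x) (tcls (Hrel V) (Fbr p q)))"
  by (simp add: ell2_def Hbracket_tcls[OF assms] powi_eq_sg)

lemma gadd_H1: "gadd H1 (tcls (Hrel V) p) (tcls (Hrel V) q) = tcls (Hrel V) (p + q)"
  by (simp add: Hspace_def gadd_tcls)

lemma gscale_H1: "gscale H1 c (tcls (Hrel V) p) = tcls (Hrel V) (fscale c p)"
  by (simp add: Hspace_def gscale_tcls)

lemma okl_ell2:
  assumes "okl H1 X" "okl H1 Y" shows "okl H1 (ell2 V brk X Y)"
proof -
  obtain x p where p: "X = (x, tcls (Hrel V) p)" "Poly_Mapping.keys p \<subseteq> {w \<in> words V. wdeg w = x + 1}"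
    by (rule okl_H1E[OF assms(1)])
  obtain y q where q: "Y = (y, tcls (Hrel V) q)" "Poly_Mapping.keys q \<subseteq> {w \<in> words V. wdeg w = y + 1}"
    by (rule okl_H1E[OF assms(2)])
  have "ell2 V brk X Y = (x + y + 1, gscale H1 (sg x) (tcls (Hrel V) (Fbr p q)))"
    unfolding p(1) q(1) by (rule ell2_tcls) (use p(2) q(2) in auto)
  moreover have "tcls (Hrel V) (Fbr p q) \<in> comp H1 (x + y + 1)"
    using keys_Fbr_wdeg[OF p(2) q(2)] unfolding gshift_simps Hspace_def
    by (intro tcls_in_comp) (simp add: add.commute add.left_commute)
  then have "gscale H1 (sg x) (tcls (Hrel V) (Fbr p q)) \<in> comp H1 (x + y + 1)"
    using gclosed_H1 unfolding gclosed_def by blast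
  ultimately show ?thesis by (simp only: okl_def fst_conv snd_conv)
qed

sublocale L: letter_brace "ell2 V brk" "okl H1" "TYPE('k)"
proof
  show "fst (ell2 V brk X Y) = fst X + fst Y + 1" for X Y
    by (simp add: ell2_def)
  show "okl H1 (ell2 V brk X Y)" if "okl H1 X" "okl H1 Y" for X Y
    using that by (rule okl_ell2)
qed

lemma ell2_add_left:
  assumes "x \<in> comp H1 d" "x' \<in> comp H1 d" "okl H1 Y"
  shows "ell2 V brk (d, gadd H1 x x') Y
    = (d + fst Y + 1, gadd H1 (snd (ell2 V brk (d, x) Y)) (snd (ell2 V brk (d, x') Y)))"
proof -
  obtain p where p: "x = tcls (Hrel V) p" "Poly_Mapping.keys p \<subseteq> {w \<in> words V. wdeg w = d + 1}"
    by (rule comp_H1E[OF assms(1)])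
  obtain p' where p': "x' = tcls (Hrel V) p'" "Poly_Mapping.keys p' \<subseteq> {w \<in> words V. wdeg w = d + 1}"
    by (rule comp_H1E[OF assms(2)])
  obtain y q where q: "Y = (y, tcls (Hrel V) q)" "Poly_Mapping.keys q \<subseteq> {w \<in> words V. wdeg w = y + 1}"
    by (rule okl_H1E[OF assms(3)])
  have k: "Poly_Mapping.keys p \<subseteq> words V" "Poly_Mapping.keys p' \<subseteq> words V" "Poly_Mapping.keys q \<subseteq> words V"
    using p p' q by auto
  have pp: "Poly_Mapping.keys (p + p') \<subseteq> words V"
    by (intro subset_trans[OF keys_add] Un_least k)
  show ?thesis
    unfolding p(1) p'(1) q(1) gadd_H1 ell2_tcls[OF k(1,3)] ell2_tcls[OF k(2,3)] ell2_tcls[OF pp k(3)] Fbr_lin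
    by (simp only: gscale_H1 gadd_H1 snd_conv fst_conv free.scale_right_distrib)
qed

lemma ell2_scale_left:
  assumes "x \<in> comp H1 d" "okl H1 Y"
  shows "ell2 V brk (d, gscale H1 c x) Y = (d + fst Y + 1, gscale H1 c (snd (ell2 V brk (d, x) Y)))"
proof -
  obtain p where p: "x = tcls (Hrel V) p" "Poly_Mapping.keys p \<subseteq> {w \<in> words V. wdeg w = d + 1}"
    by (rule comp_H1E[OF assms(1)])
  obtain y q where q: "Y = (y, tcls (Hrel V) q)" "Poly_Mapping.keys q \<subseteq> {w \<in> words V. wdeg w = y + 1}"
    by (rule okl_H1E[OF assms(2)])
  have k: "Poly_Mapping.keys p \<subseteq> words V" "Poly_Mapping.keys q \<subseteq> words V"
    using p q by auto
  have pp: "Poly_Mapping.keys (fscale c p) \<subseteq> words V"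
    by (intro subset_trans[OF keys_fscale] k)
  show ?thesis
    unfolding p(1) q(1) gscale_H1 ell2_tcls[OF k] ell2_tcls[OF pp k(2)] Fbr_lin
    by (simp only: snd_conv fst_conv gscale_H1 free.scale_scale mult.commute)
qed

text \<open>The factor (-1)^x turns antisymmetry for the degrees x + 1 and y + 1 into symmetry for
  the degrees x and y of H[1].\<close>

lemma ell2_swap:
  assumes "okl H1 X" "okl H1 Y"
  shows "ell2 V brk Y X = (fst X + fst Y + 1, gscale H1 (sg (fst X * fst Y)) (snd (ell2 V brk X Y)))"
proof -
  obtain x p where p: "X = (x, tcls (Hrel V) p)" "Poly_Mapping.keys p \<subseteq> {w \<in> words V. wdeg w = x + 1}"
    by (rule okl_H1E[OF assms(1)])
  obtain y q where q: "Y = (y, tcls (Hrel V) q)" "Poly_Mapping.keys q \<subseteq> {w \<in> words V. wdeg w = y + 1}"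
    by (rule okl_H1E[OF assms(2)])
  have k: "Poly_Mapping.keys p \<subseteq> words V" "Poly_Mapping.keys q \<subseteq> words V"
    using p(2) q(2) by auto
  have "tcls (Hrel V) (fscale (sg y) (Fbr q p)) = tcls (Hrel V) (fscale (sg (x * y)) (fscale (sg x) (Fbr p q)))"
  proof (rule tcls_eqI[OF rel_on_Hrel[OF gclosed]])
    fix \<chi> assume \<chi>: "admH \<chi>"
    have "pair \<chi> (Fbr q p) = pair (\<lambda>v. pair (\<lambda>w. bf \<chi> w v) q) p"
      unfolding pair_Fbr by (rule pair_swap)
    also have "\<dots> = pair (\<lambda>v. pair (\<lambda>w. - sg ((x + 1) * (y + 1)) * bf \<chi> v w) q) p"
    proof (intro pair_cong)
      fix v w assume "v \<in> Poly_Mapping.keys p" "w \<in> Poly_Mapping.keys q"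
      then have "wdeg v = x + 1" "wdeg w = y + 1" using p(2) q(2) by auto
      then show "bf \<chi> w v = - sg ((x + 1) * (y + 1)) * bf \<chi> v w"
        by (subst bf_antisym[OF \<chi>]) (simp only: mult.commute)
    qed
    also have "\<dots> = - sg ((x + 1) * (y + 1)) * pair \<chi> (Fbr p q)"
      by (simp only: pair_fun_mult pair_Fbr)
    finally show "pair \<chi> (fscale (sg y) (Fbr q p))
        = pair \<chi> (fscale (sg (x * y)) (fscale (sg x) (Fbr p q)))"
      unfolding pair_fscale by (simp add: sg_def)
  qed (rule subset_trans[OF keys_fscale] keys_Fbr)+
  then show ?thesis
    unfolding p(1) q(1) ell2_tcls[OF k] ell2_tcls[OF k(2,1)]
    by (simp only: gscale_H1 snd_conv fst_conv add.commute)
qed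

abbreviation "admS \<equiv> adm (words H1) (Srel H1)"

lemma admS_mlin: "admS \<psi> \<Longrightarrow> mlin H1 \<psi>"
  by (simp add: adm_Srel_iff[OF gclosed_H1])

lemma admS_swap: "admS \<psi> \<Longrightarrow> \<psi> (u @ a # b # v) = sg (fst a * fst b) * \<psi> (u @ b # a # v)"
  unfolding adm_Srel_iff[OF gclosed_H1] by blast

lemma ell2_pair: "ell2 V brk X Y = (fst X + fst Y + 1, snd (ell2 V brk X Y))"
  by (simp add: ell2_def)

lemma ell2_comp: "\<lbrakk>okl H1 X; okl H1 Y\<rbrakk> \<Longrightarrow> snd (ell2 V brk X Y) \<in> comp H1 (fst X + fst Y + 1)"
  using okl_ell2[of X Y] by (simp only: okl_def[of _ "ell2 V brk X Y"] L.fst_op)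

lemma ell2_swap_fun:
  assumes "mlin H1 \<psi>" "okl H1 X" "okl H1 Y"
  shows "\<psi> (u @ ell2 V brk Y X # v) = sg (fst X * fst Y) * \<psi> (u @ ell2 V brk X Y # v)"
  by (subst ell2_swap[OF assms(2,3)], subst (2) ell2_pair) (rule mlin_scale[OF assms(1) ell2_comp[OF assms(2,3)]])

lemma ell2_add_left_fun:
  assumes "mlin H1 \<psi>" "x \<in> comp H1 d" "y \<in> comp H1 d" "okl H1 Y"
  shows "\<psi> (u @ ell2 V brk (d, gadd H1 x y) Y # v)
    = \<psi> (u @ ell2 V brk (d, x) Y # v) + \<psi> (u @ ell2 V brk (d, y) Y # v)"
proof -
  have "snd (ell2 V brk (d, z) Y) \<in> comp H1 (d + fst Y + 1)" if "z \<in> comp H1 d" for z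
    using ell2_comp[of "(d, z)" Y] assms(4) that by (simp add: okl_def)
  then show ?thesis
    unfolding ell2_add_left[OF assms(2-4)]
    by (subst mlin_add[OF assms(1)]) (use assms(2,3) in \<open>simp_all add: ell2_def\<close>)
qed

lemma ell2_scale_left_fun:
  assumes "mlin H1 \<psi>" "x \<in> comp H1 d" "okl H1 Y"
  shows "\<psi> (u @ ell2 V brk (d, gscale H1 c x) Y # v) = c * \<psi> (u @ ell2 V brk (d, x) Y # v)"
proof -
  have "snd (ell2 V brk (d, x) Y) \<in> comp H1 (d + fst Y + 1)"
    using ell2_comp[of "(d, x)" Y] assms by (simp add: okl_def)
  then show ?thesis
    unfolding ell2_scale_left[OF assms(2,3)]
    by (subst mlin_scale[OF assms(1)]) (simp_all add: ell2_def)
qed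

lemma ell2_add_right_fun:
  assumes "mlin H1 \<psi>" "x \<in> comp H1 d" "y \<in> comp H1 d" "okl H1 X"
  shows "\<psi> (u @ ell2 V brk X (d, gadd H1 x y) # v)
    = \<psi> (u @ ell2 V brk X (d, x) # v) + \<psi> (u @ ell2 V brk X (d, y) # v)"
proof -
  have "okl H1 (d, x)" "okl H1 (d, y)" "okl H1 (d, gadd H1 x y)"
    using assms gclosed_H1 by (simp_all add: okl_def gclosed_def)
  then show ?thesis
    using ell2_swap_fun[OF assms(1) _ assms(4), of _ u v] ell2_add_left_fun[OF assms, of u v]
    by (simp add: distrib_left)
qed

lemma ell2_scale_right_fun:
  assumes "mlin H1 \<psi>" "x \<in> comp H1 d" "okl H1 X"
  shows "\<psi> (u @ ell2 V brk X (d, gscale H1 c x) # v) = c * \<psi> (u @ ell2 V brk X (d, x) # v)"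
proof -
  have "okl H1 (d, x)" "okl H1 (d, gscale H1 c x)"
    using assms gclosed_H1 by (simp_all add: okl_def gclosed_def)
  then show ?thesis
    using ell2_swap_fun[OF assms(1) _ assms(3), of _ u v] ell2_scale_left_fun[OF assms, of u c v]
    by (simp add: mult.left_commute)
qed

text \<open>Well-definedness of \<ell> in the form asked for by \<open>glinear_exists\<close>:
  multilinearity by \<open>el_slot\<close>, the commutation rule by \<open>el_swap\<close>.\<close>

lemma admS_el:
  assumes \<psi>: "admS \<psi>"
  shows "admS (\<lambda>Xs. if Xs \<in> words H1 then L.el \<psi> Xs else 0)"
  unfolding adm_Srel_iff[OF gclosed_H1]
proof (intro conjI allI impI)
  note ml = admS_mlin[OF \<psi>]
  show "(if w \<in> words H1 then L.el \<psi> w else 0) = 0" if "w \<notin> words H1" for w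
    using that by simp
  show "mlin H1 (\<lambda>Xs. if Xs \<in> words H1 then L.el \<psi> Xs else 0)"
    unfolding mlin_def
  proof (intro allI impI conjI ballI)
    fix u v d x c assume x: "x \<in> comp H1 d"
    have sx: "gscale H1 c x \<in> comp H1 d" using gclosed_H1 x unfolding gclosed_def by blast
    have "L.el \<psi> (u @ (d, gscale H1 c x) # v) = c * L.el \<psi> (u @ (d, x) # v) + 0 * L.el \<psi> (u @ (d, x) # v)"
      if "list_all (okl H1) (u @ v)"
      by (rule L.el_slot)
         (use that mlin_scale[OF ml x] ell2_scale_left_fun[OF ml x] ell2_scale_right_fun[OF ml x]
           in \<open>auto simp: list_all_iff simp del: gshift_simps\<close>)
    then show "(if u @ (d, gscale H1 c x) # v \<in> words H1 then L.el \<psi> (u @ (d, gscale H1 c x) # v) else 0)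
        = c * (if u @ (d, x) # v \<in> words H1 then L.el \<psi> (u @ (d, x) # v) else 0)"
      using x sx by (simp add: words_iff okl_def[of _ "(_, _)"] del: gshift_simps)
    fix y assume y: "y \<in> comp H1 d"
    have sxy: "gadd H1 x y \<in> comp H1 d" using gclosed_H1 x y unfolding gclosed_def by blast
    have "L.el \<psi> (u @ (d, gadd H1 x y) # v) = 1 * L.el \<psi> (u @ (d, x) # v) + 1 * L.el \<psi> (u @ (d, y) # v)"
      if "list_all (okl H1) (u @ v)"
      by (rule L.el_slot)
         (use that mlin_add[OF ml x y] ell2_add_left_fun[OF ml x y] ell2_add_right_fun[OF ml x y]
           in \<open>auto simp: list_all_iff simp del: gshift_simps\<close>)
    then show "(if u @ (d, gadd H1 x y) # v \<in> words H1 then L.el \<psi> (u @ (d, gadd H1 x y) # v) else 0)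
        = (if u @ (d, x) # v \<in> words H1 then L.el \<psi> (u @ (d, x) # v) else 0)
        + (if u @ (d, y) # v \<in> words H1 then L.el \<psi> (u @ (d, y) # v) else 0)"
      using x y sxy by (simp add: words_iff okl_def[of _ "(_, _)"] del: gshift_simps)
  qed
  fix u v a b
  show "(if u @ a # b # v \<in> words H1 then L.el \<psi> (u @ a # b # v) else 0)
      = sg (fst a * fst b) * (if u @ b # a # v \<in> words H1 then L.el \<psi> (u @ b # a # v) else 0)"
  proof (cases "u @ a # b # v \<in> words H1")
    case True
    then have ab: "okl H1 a" "okl H1 b" "u @ b # a # v \<in> words H1" by (auto simp: words_iff)
    have "L.el \<psi> (u @ a # b # v) = sg (fst a * fst b) * L.el \<psi> (u @ b # a # v)"
      by (rule L.el_swap, rule admS_swap[OF \<psi>])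
         (subst ell2_swap_fun[OF ml ab(2,1)], simp only: mult.commute)
    then show ?thesis using True ab(3) by simp
  next
    case False
    then have "u @ b # a # v \<notin> words H1" by (auto simp: words_iff)
    then show ?thesis using False by simp
  qed
qed

lemma pair_ell_word: "admS \<psi> \<Longrightarrow> pair \<psi> (ell_word V brk Xs) = L.el \<psi> Xs"
  by (subst L.sterm_sum[symmetric], rule admS_swap, assumption)
     (simp add: ell_word_def L.sterm_def Let_def pair_sum)

lemma keys_ell_word:
  assumes Xs: "Xs \<in> words H1"
  shows "Poly_Mapping.keys (ell_word V brk Xs :: ('k, ('k, 'v) formal set) formal) \<subseteq> {Z \<in> words H1. wdeg Z = wdeg Xs + 1}"
  unfolding ell_word_def Let_def
proof (intro keys_sum_subset keys_single_subset)
  fix i j assume "j \<in> {..<length Xs}" "i \<in> {..<j}"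
  then have ij: "i < j" "j < length Xs" by auto
  let ?r = "filter (\<lambda>m. m \<noteq> i \<and> m \<noteq> j) [0..<length Xs]"
  have ok: "okl H1 (Xs ! m)" if "m < length Xs" for m
    using Xs that by (auto simp: words_iff list_all_length)
  have "wdeg Xs = (\<Sum>m<length Xs. fst (Xs ! m))"
    unfolding wdeg_def by (simp add: sum_list_sum_nth atLeast0LessThan)
  also have "\<dots> = (\<Sum>m\<in>{i, j} \<union> ({..<length Xs} - {i, j}). fst (Xs ! m))"
    using ij by (intro sum.cong) auto
  also have "\<dots> = fst (Xs ! i) + fst (Xs ! j) + (\<Sum>m\<in>{..<length Xs} - {i, j}. fst (Xs ! m))"
    using ij by (subst sum.union_disjoint) auto
  also have "(\<Sum>m\<in>{..<length Xs} - {i, j}. fst (Xs ! m)) = wdeg (map ((!) Xs) ?r)"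
    unfolding wdeg_map by (subst sum_list_distinct_conv_sum_set) (auto intro!: sum.cong)
  finally have "wdeg (ell2 V brk (Xs ! i) (Xs ! j) # map ((!) Xs) ?r) = wdeg Xs + 1"
    by (simp add: ell2_def)
  moreover have "ell2 V brk (Xs ! i) (Xs ! j) # map ((!) Xs) ?r \<in> words H1"
    using ij ok by (auto simp: words_iff list_all_iff okl_ell2)
  ultimately show "ell2 V brk (Xs ! i) (Xs ! j) # map ((!) Xs) ?r \<in> {Z \<in> words H1. wdeg Z = wdeg Xs + 1}"
    by simp
qed

abbreviation "SHV \<equiv> SH V"

lemma rel_on_S: "rel_on (words H1) (Srel H1)"
  by (rule rel_on_Srel[OF gclosed_H1])

lemma ell_exists:
  "\<exists>f. glinear SHV SHV f \<and>
     (\<forall>Xs\<in>words H1. f (scls H1 Xs) = tcls (Srel H1) (ell_word V brk Xs))"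
  unfolding Splus_def scls_def
proof (rule glinear_exists[OF rel_on_S rel_on_S])
  show "Poly_Mapping.keys (ell_word V brk w :: ('k, ('k, 'v) formal set) formal) \<subseteq> words H1" if "w \<in> words H1" for w
    using keys_ell_word[OF that] by auto
  show "admS (\<lambda>w. if w \<in> words H1 then pair \<chi> (ell_word V brk w) else 0)" if "admS \<chi>" for \<chi>
    using admS_el[OF that] by (simp add: pair_ell_word[OF that] cong: if_cong)
qed

lemmas ell_spec = someI_ex[OF ell_exists, folded ell_def]

lemma ell_tcls:
  assumes "Poly_Mapping.keys p \<subseteq> words H1"
  shows "ell V brk (tcls (Srel H1) p) = tcls (Srel H1) (lext (ell_word V brk) p)"
  by (rule glinear_tcls[OF _ _ assms, where A' = "words H1"])
     (use ell_spec in \<open>simp_all add: Splus_def scls_def\<close>)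

lemma ell_comp:
  assumes "x \<in> comp SHV d" shows "ell V brk x \<in> comp SHV (d + 1)"
proof -
  obtain p where p: "x = tcls (Srel H1) p" "Poly_Mapping.keys p \<subseteq> {w \<in> words H1. wdeg w = d}"
    using assms by (auto simp: Splus_def comp_gquot)
  have "Poly_Mapping.keys (lext (ell_word V brk) p) \<subseteq> {w \<in> words H1. wdeg w = d + 1}"
    using p(2) keys_ell_word by (intro keys_lext) blast
  moreover have "ell V brk x = tcls (Srel H1) (lext (ell_word V brk) p)"
    unfolding p(1) by (rule ell_tcls) (use p(2) in auto)
  ultimately show ?thesis by (simp add: Splus_def tcls_in_comp)
qed

lemma fst_hletter: "fst (hletter V w) = dgw w"
  by (simp add: hletter_def dgw_def)

lemma hletter_okl: "w \<in> words V \<Longrightarrow> okl H1 (hletter V w)"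
  unfolding okl_def hletter_def hcls_def Hspace_def
  by (simp add: tcls_in_comp keys_single)

text \<open>The bracket of two words is one letter, namely the class of a combination of words; by
  multilinearity the value of \<psi> there is the combination of the values at the classes of these
  words, which is \<open>Bw\<close>.\<close>

lemma ell2_hletter:
  assumes \<psi>: "mlin H1 \<psi>" and vw: "v \<in> words V" "w \<in> words V"
  shows "\<psi> (u @ ell2 V brk (hletter V v) (hletter V w) # A) = Bw (\<lambda>z. \<psi> (u @ hletter V z # A)) v w"
proof -
  let ?d = "wdeg v + wdeg w - 1"
  have "ell2 V brk (hletter V v) (hletter V w) = (?d, gscale H1 (sg (wdeg v - 1)) (tcls (Hrel V) (bracket_word brk v w)))"
    unfolding hletter_def hcls_def
    using vw by (subst ell2_tcls) (simp_all add: keys_single Fbr_def lext_single bw_def)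
  moreover have k: "Poly_Mapping.keys (bracket_word brk v w :: ('k, 'v) formal) \<subseteq> {z \<in> words V. wdeg z = ?d + 1}"
    using keys_bracket_word[OF vw] by simp
  moreover have "tcls (Hrel V) (bracket_word brk v w) \<in> comp H1 ?d"
    using k by (simp add: Hspace_def tcls_in_comp)
  ultimately have "\<psi> (u @ ell2 V brk (hletter V v) (hletter V w) # A)
      = sg (wdeg v - 1) * \<psi> (u @ (?d, tcls (Hrel V) (bracket_word brk v w)) # A)"
    using mlin_scale[OF \<psi>] by simp
  also have "\<psi> (u @ (?d, tcls (Hrel V) (bracket_word brk v w)) # A)
      = pair (\<lambda>z. \<psi> (u @ (?d, tcls (Hrel V) (Poly_Mapping.single z 1)) # A)) (bracket_word brk v w)"
    by (rule slot_pair[OF \<psi> presented_H1 k])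
  also have "\<dots> = pair (\<lambda>z. \<psi> (u @ hletter V z # A)) (bracket_word brk v w)"
    using k by (intro pair_cong) (auto simp: hletter_def hcls_def)
  finally show ?thesis by (simp add: Bw_def pair_bracket_word)
qed

lemma ad_hletter:
  "\<lbrakk>mlin H1 \<psi>; v \<in> words V; set ws \<subseteq> words V\<rbrakk> \<Longrightarrow>
    L.ad (hletter V v) \<psi> (map (hletter V) ws) = ad v (\<lambda>ws. \<psi> (map (hletter V) ws)) ws"
proof (induction ws arbitrary: \<psi>)
  case (Cons w ws)
  then show ?case
    using ell2_hletter[of \<psi> v w "[]"] Cons.IH[of "\<lambda>z. \<psi> (hletter V w # z)"] mlin_Cons[of H1 \<psi>]
    by (simp add: fst_hletter)
qed simp

lemma el_hletter:
  "\<lbrakk>mlin H1 \<psi>; set ws \<subseteq> words V\<rbrakk> \<Longrightarrow>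
    L.el \<psi> (map (hletter V) ws) = el (\<lambda>ws. \<psi> (map (hletter V) ws)) ws"
proof (induction ws arbitrary: \<psi>)
  case (Cons w ws)
  then show ?case
    using ad_hletter[of \<psi> w ws] Cons.IH[of "\<lambda>z. \<psi> (hletter V w # z)"] mlin_Cons[of H1 \<psi>]
    by (simp add: fst_hletter)
qed simp

end

context brace_cobrace
begin

text \<open>\<open>kappa_word\<close> does not list positions in increasing order, as one piece
  stands behind I and the other before J. Under an adjacent exchange the Koszul sign and the value
  of \<phi> change by the same factor, so only the sets of positions count.\<close>

lemma subterm_reorder:
  assumes \<phi>: "good \<phi>" and m: "mset is = mset is'" "mset js = mset js'"
  shows "ksign (\<lambda>i. dg (Z ! i)) (is @ js) * \<phi> (map ((!) Z) is) (map ((!) Z) js)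
    = ksign (\<lambda>i. dg (Z ! i)) (is' @ js') * \<phi> (map ((!) Z) is') (map ((!) Z) js')"
proof -
  let ?k = "ksign (\<lambda>i. dg (Z ! i)) :: nat list \<Rightarrow> 'k"
  have 1: "?k ((p @ a # b # q) @ js) * \<phi> (map ((!) Z) (p @ a # b # q)) C
      = ?k ((p @ b # a # q) @ js) * \<phi> (map ((!) Z) (p @ b # a # q)) C" for p a b q C
  proof (cases "a = b")
    case False
    have "?k (p @ a # b # q @ js) = sg (dg (Z ! a) * dg (Z ! b)) * ?k (p @ b # a # q @ js)"
      by (rule ksign_swap[OF False])
    then show ?thesis
      using good_swap1[OF \<phi>, of "map ((!) Z) p" "Z ! a" "Z ! b" "map ((!) Z) q" C]
      by simp (simp add: sg_def)
  qed simp
  have 2: "?k (is' @ p @ a # b # q) * \<phi> A (map ((!) Z) (p @ a # b # q))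
      = ?k (is' @ p @ b # a # q) * \<phi> A (map ((!) Z) (p @ b # a # q))" for p a b q A
  proof (cases "a = b")
    case False
    have "?k ((is' @ p) @ a # b # q) = sg (dg (Z ! a) * dg (Z ! b)) * ?k ((is' @ p) @ b # a # q)"
      by (rule ksign_swap[OF False])
    then show ?thesis
      using good_swap2[OF \<phi>, of A "map ((!) Z) p" "Z ! a" "Z ! b" "map ((!) Z) q"]
      by simp (simp add: sg_def)
  qed simp
  have "?k (is @ js) * \<phi> (map ((!) Z) is) (map ((!) Z) js)
      = ?k (is' @ js) * \<phi> (map ((!) Z) is') (map ((!) Z) js)"
    by (rule mset_eq_swap_invariant[where f = "\<lambda>is. ?k (is @ js) * \<phi> (map ((!) Z) is) (map ((!) Z) js)", OF 1 m(1)])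
  also have "\<dots> = ?k (is' @ js') * \<phi> (map ((!) Z) is') (map ((!) Z) js')"
    by (rule mset_eq_swap_invariant[where f = "\<lambda>js. ?k (is' @ js) * \<phi> (map ((!) Z) is') (map ((!) Z) js)", OF 2 m(2)])
  finally show ?thesis .
qed

lemma subterm_eqI:
  assumes \<phi>: "good \<phi>" and I: "I \<subseteq> {..<length Z}"
    and i: "distinct is" "set is = I" and j: "distinct js" "set js = {..<length Z} - I"
  shows "ksign (\<lambda>i. dg (Z ! i)) (is @ js) * \<phi> (map ((!) Z) is) (map ((!) Z) js) = subterm \<phi> Z I"
proof -
  have "mset is = mset (filter (\<lambda>i. i \<in> I) [0..<length Z])"
    using i I by (subst set_eq_iff_mset_eq_distinct[symmetric]) auto
  moreover have "mset js = mset (filter (\<lambda>i. i \<notin> I) [0..<length Z])"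
    using j I by (subst set_eq_iff_mset_eq_distinct[symmetric]) auto
  ultimately show ?thesis
    unfolding subterm_def Let_def by (rule subterm_reorder[OF \<phi>])
qed

text \<open>The two summands of \<kappa> for a given I are the two ways of separating the pieces;
  over all I they give each subset containing exactly one of s and s + 1 once.\<close>

lemma sum_subterm_cops:
  assumes s: "Suc s < length Z"
  shows "(\<Sum>I\<in>Pow ({..<length Z} - {s, Suc s}). subterm \<phi> Z (insert s I) + subterm \<phi> Z (insert (Suc s) I))
    = cops s \<phi> Z"
proof -
  let ?P = "Pow ({..<length Z} - {s, Suc s})"
  let ?A = "{I \<in> Pow {..<length Z}. s \<in> I \<and> Suc s \<notin> I}" and ?B = "{I \<in> Pow {..<length Z}. s \<notin> I \<and> Suc s \<in> I}"
  have a: "(\<Sum>I\<in>?P. subterm \<phi> Z (insert s I)) = sum (subterm \<phi> Z) ?A"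
    using s by (intro sum.reindex_bij_witness[of _ "\<lambda>I. I - {s}" "insert s"]) auto
  have b: "(\<Sum>I\<in>?P. subterm \<phi> Z (insert (Suc s) I)) = sum (subterm \<phi> Z) ?B"
    using s by (intro sum.reindex_bij_witness[of _ "\<lambda>I. I - {Suc s}" "insert (Suc s)"]) auto
  have "cops s \<phi> Z = sum (subterm \<phi> Z) {I \<in> Pow {..<length Z}. (s \<in> I) \<noteq> (Suc s \<in> I)}"
    by (subst cops_eq_subterm[OF s]) (rule sum.inter_filter[symmetric], simp)
  also have "{I \<in> Pow {..<length Z}. (s \<in> I) \<noteq> (Suc s \<in> I)} = ?A \<union> ?B" by auto
  also have "sum (subterm \<phi> Z) (?A \<union> ?B) = sum (subterm \<phi> Z) ?A + sum (subterm \<phi> Z) ?B"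
    by (rule sum.union_disjoint) auto
  finally show ?thesis by (simp add: sum.distrib a b)
qed

end

section \<open>The formula for \<kappa> in transposed form\<close>

context graded_bracket
begin

lemma gclosed_SHV: "gclosed SHV"
  unfolding Splus_def by (rule gclosed_gquot)

lemma presented_SHV: "presented SHV (words H1) (Srel H1) 0"
  by (simp add: presented_def Splus_def)

abbreviation "admT \<equiv> adm (words2 SHV) (T2rel SHV)"

lemma admT_mlin: "admT \<phi> \<Longrightarrow> mlin SHV \<phi>"
  by (simp add: adm_T2rel_iff[OF gclosed_SHV])

lemma sletter_eq: "sletter H1 Xs = (wdeg Xs, tcls (Srel H1) (Poly_Mapping.single Xs 1))"
  by (simp add: sletter_def scls_def)

text \<open>One tensor factor is frozen, which reduces functionals on the tensor square to
  functionals on S^+(H[1]).\<close>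

definition sw1 :: "(('k, ('k, 'v) formal set) formal set letter list \<Rightarrow> 'k)
    \<Rightarrow> ('k, ('k, 'v) formal set) formal set letter \<Rightarrow> ('k, 'v) formal set letter list \<Rightarrow> 'k" where
  "sw1 \<phi> b Xs = (if Xs \<in> words H1 then \<phi> [sletter H1 Xs, b] else 0)"

definition sw2 :: "(('k, ('k, 'v) formal set) formal set letter list \<Rightarrow> 'k)
    \<Rightarrow> ('k, ('k, 'v) formal set) formal set letter \<Rightarrow> ('k, 'v) formal set letter list \<Rightarrow> 'k" where
  "sw2 \<phi> a Xs = (if Xs \<in> words H1 then \<phi> [a, sletter H1 Xs] else 0)"

lemma admS_sw1:
  assumes \<phi>: "admT \<phi>" shows "admS (sw1 \<phi> b)"
  unfolding adm_def
proof (intro conjI ballI allI impI)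
  fix e :: "('k, ('k, 'v) formal set) formal" assume e: "e \<in> Srel H1"
  have "pair (sw1 \<phi> b) e
      = pair (\<lambda>z. \<phi> ([] @ (wdeg z - 0, tcls (Srel H1) (Poly_Mapping.single z 1)) # [b])) e"
    using rel_on_S e by (intro pair_cong) (auto simp: sw1_def sletter_eq rel_on_def)
  also have "\<dots> = 0"
    by (rule slot_rel[OF admT_mlin[OF \<phi>] presented_SHV rel_on_S homog_Srel e])
  finally show "pair (sw1 \<phi> b) e = 0" .
qed (simp add: sw1_def)

lemma admS_sw2:
  assumes \<phi>: "admT \<phi>" shows "admS (sw2 \<phi> a)"
  unfolding adm_def
proof (intro conjI ballI allI impI)
  fix e :: "('k, ('k, 'v) formal set) formal" assume e: "e \<in> Srel H1"
  have "pair (sw2 \<phi> a) e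
      = pair (\<lambda>z. \<phi> ([a] @ (wdeg z - 0, tcls (Srel H1) (Poly_Mapping.single z 1)) # [])) e"
    using rel_on_S e by (intro pair_cong) (auto simp: sw2_def sletter_eq rel_on_def)
  also have "\<dots> = 0"
    by (rule slot_rel[OF admT_mlin[OF \<phi>] presented_SHV rel_on_S homog_Srel e])
  finally show "pair (sw2 \<phi> a) e = 0" .
qed (simp add: sw2_def)

abbreviation "valid A \<equiv> list_all (\<lambda>w. w \<in> words V) A"

lemma map_hletter_words: "\<lbrakk>A \<noteq> []; valid A\<rbrakk> \<Longrightarrow> map (hletter V) A \<in> words H1"
  by (simp add: words_iff[of _ H1] list_all_iff hletter_okl)

abbreviation "slet A \<equiv> sletter H1 (map (hletter V) A)"

text \<open>\<phi> on tensors of products of classes of words. S^+ has no unit, hence the value 0 on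
  empty lists; the value 0 on invalid words makes each slot a functional in
  \<open>admH\<close>.\<close>

definition Phi :: "(('k, ('k, 'v) formal set) formal set letter list \<Rightarrow> 'k)
    \<Rightarrow> 'v letter list list \<Rightarrow> 'v letter list list \<Rightarrow> 'k" where
  "Phi \<phi> A C = (if A \<noteq> [] \<and> C \<noteq> [] \<and> valid A \<and> valid C then \<phi> [slet A, slet C] else 0)"

lemma slot_admH:
  assumes \<psi>: "admS \<psi>"
  shows "admH (\<lambda>X. if X \<in> words V then \<psi> (u @ hletter V X # v) else 0)"
  unfolding adm_def
proof (intro conjI ballI allI impI)
  fix e :: "('k, 'v) formal" assume e: "e \<in> Hrel V"
  have "pair (\<lambda>X. if X \<in> words V then \<psi> (u @ hletter V X # v) else 0) e
      = pair (\<lambda>z. \<psi> (u @ (wdeg z - 1, tcls (Hrel V) (Poly_Mapping.single z 1)) # v)) e"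
    using rel_on_Hrel[OF gclosed] e
    by (intro pair_cong) (auto simp: hletter_def hcls_def rel_on_def)
  also have "\<dots> = 0"
    by (rule slot_rel[OF admS_mlin[OF \<psi>] presented_H1 rel_on_Hrel[OF gclosed] homog_Hrel e])
  finally show "pair (\<lambda>X. if X \<in> words V then \<psi> (u @ hletter V X # v) else 0) e = 0" .
qed simp

lemma admH_zero: "admH (\<lambda>_. 0)"
  by (simp add: adm_def pair_def)

lemma Phi_sw1: "Phi \<phi> A C = (if A \<noteq> [] \<and> valid A \<and> C \<noteq> [] \<and> valid C then sw1 \<phi> (slet C) (map (hletter V) A) else 0)"
  by (simp add: Phi_def sw1_def map_hletter_words)

lemma Phi_sw2: "Phi \<phi> A C = (if A \<noteq> [] \<and> valid A \<and> C \<noteq> [] \<and> valid C then sw2 \<phi> (slet A) (map (hletter V) C) else 0)"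
  by (simp add: Phi_def sw2_def map_hletter_words)

lemma good_Phi:
  assumes \<phi>: "admT \<phi>" shows "good (Phi \<phi>)"
  unfolding good_def slotadm_def
proof (intro conjI allI swapsymI)
  fix C P X Y A
  show "Phi \<phi> (P @ X # Y # A) C = sg (dgw X * dgw Y) * Phi \<phi> (P @ Y # X # A) C"
    using admS_swap[OF admS_sw1[OF \<phi>], of "slet C" "map (hletter V) P" "hletter V X" "hletter V Y" "map (hletter V) A"]
    by (auto simp: Phi_sw1 fst_hletter)
  show "Phi \<phi> A (P @ X # Y # C) = sg (dgw X * dgw Y) * Phi \<phi> A (P @ Y # X # C)"
    using admS_swap[OF admS_sw2[OF \<phi>], of "slet A" "map (hletter V) P" "hletter V X" "hletter V Y" "map (hletter V) C"]
    by (auto simp: Phi_sw2 fst_hletter)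
  show "admH (\<lambda>X. Phi \<phi> (P @ X # A) C)"
  proof (cases "valid P \<and> valid A \<and> C \<noteq> [] \<and> valid C")
    case True
    then have "(\<lambda>X. Phi \<phi> (P @ X # A) C) = (\<lambda>X. if X \<in> words V
        then sw1 \<phi> (slet C) (map (hletter V) P @ hletter V X # map (hletter V) A) else 0)"
      by (auto simp: Phi_sw1 fun_eq_iff)
    then show ?thesis by (simp only: slot_admH[OF admS_sw1[OF \<phi>]])
  next
    case False
    then have "(\<lambda>X. Phi \<phi> (P @ X # A) C) = (\<lambda>_. 0)"
      by (auto simp: Phi_sw1 fun_eq_iff)
    then show ?thesis by (simp only: admH_zero)
  qed
  show "admH (\<lambda>X. Phi \<phi> A (P @ X # C))"
  proof (cases "valid P \<and> valid C \<and> A \<noteq> [] \<and> valid A")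
    case True
    then have "(\<lambda>X. Phi \<phi> A (P @ X # C)) = (\<lambda>X. if X \<in> words V
        then sw2 \<phi> (slet A) (map (hletter V) P @ hletter V X # map (hletter V) C) else 0)"
      by (auto simp: Phi_sw2 fun_eq_iff)
    then show ?thesis by (simp only: slot_admH[OF admS_sw2[OF \<phi>]])
  next
    case False
    then have "(\<lambda>X. Phi \<phi> A (P @ X # C)) = (\<lambda>_. 0)"
      by (auto simp: Phi_sw2 fun_eq_iff)
    then show ?thesis by (simp only: admH_zero)
  qed
qed

lemma ksign_cong: "(\<And>i. i \<in> set is \<Longrightarrow> d i = d' i) \<Longrightarrow> ksign d is = ksign d' is"
proof (induction "is")
  case (Cons i "is")
  have "map d (filter (\<lambda>j. j < i) is) = map d' (filter (\<lambda>j. j < i) is)"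
    using Cons.prems by simp
  then have "sum_list (map d (filter (\<lambda>j. j < i) is)) = sum_list (map d' (filter (\<lambda>j. j < i) is))"
    by (rule arg_cong)
  then show ?case using Cons by (simp add: ksign_Cons)
qed simp

lemma okl_SHV: "Xs \<in> words H1 \<Longrightarrow> okl SHV (sletter H1 Xs)"
  by (simp add: okl_def sletter_eq Splus_def tcls_in_comp keys_single)

lemma valid_nth_words:
  "\<lbrakk>valid Z; is \<noteq> []; set is \<subseteq> {..<length Z}\<rbrakk> \<Longrightarrow> map ((!) (map (hletter V) Z)) is \<in> words H1"
  by (auto simp: words_iff[of _ H1] list_all_iff hletter_okl subset_iff)

lemma valid_split:
  assumes "valid ws" "s < length ws" "j \<in> {0<..<length (ws ! s)}"
  shows "valid (take s ws @ [take j (ws ! s), drop j (ws ! s)] @ drop (Suc s) ws)"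
proof -
  have "valid (take s ws @ ws ! s # drop (Suc s) ws)"
    using assms by (simp add: id_take_nth_drop[symmetric])
  moreover have "take j (ws ! s) @ drop j (ws ! s) \<in> words V"
    using assms by (simp add: list_all_length)
  ultimately show ?thesis
    using assms(3) by (auto simp: words_iff list_all_append simp del: append_take_drop_id)
qed

lemma keys_kappa_word:
  assumes "valid ws"
  shows "Poly_Mapping.keys (kappa_word V ws :: ('k, ('k, ('k, 'v) formal set) formal set) formal) \<subseteq> words2 SHV"
  unfolding kappa_word_def Let_def
proof (intro keys_sum_subset subset_trans[OF keys_add] Un_least keys_single_subset)
  fix s I j
  assume "s \<in> {..<length ws}" "I \<in> Pow ({..length ws} - {s, Suc s})" "j \<in> {0<..<length (ws ! s)}"
  then have s: "s < length ws" and I: "I \<subseteq> {..length ws} - {s, Suc s}" and j: "j \<in> {0<..<length (ws ! s)}" by auto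
  let ?Z = "take s ws @ [take j (ws ! s), drop j (ws ! s)] @ drop (Suc s) ws"
  have Z: "valid ?Z" by (rule valid_split[OF assms s j])
  have l: "{..<length ?Z} = {..length ws}" using s by (auto simp: min_def)
  have fin: "finite I" using I finite_subset by blast
  have w: "[sletter H1 (map ((!) (map (hletter V) ?Z)) is), sletter H1 (map ((!) (map (hletter V) ?Z)) js)] \<in> words2 SHV"
    if "is \<noteq> []" "js \<noteq> []" "set is \<subseteq> {..length ws}" "set js \<subseteq> {..length ws}" for "is" js
    using that valid_nth_words[OF Z, of "is"] valid_nth_words[OF Z, of js] unfolding l
    by (simp add: words2_def words_iff[of _ SHV] okl_SHV)
  show "[sletter H1 (map ((!) (map (hletter V) ?Z)) (sorted_list_of_set I @ [s])),
      sletter H1 (map ((!) (map (hletter V) ?Z)) (Suc s # sorted_list_of_set ({..length ws} - {s, Suc s} - I)))] \<in> words2 SHV"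
    by (rule w) (use I s fin in auto)
  show "[sletter H1 (map ((!) (map (hletter V) ?Z)) (sorted_list_of_set I @ [Suc s])),
      sletter H1 (map ((!) (map (hletter V) ?Z)) (s # sorted_list_of_set ({..length ws} - {s, Suc s} - I)))] \<in> words2 SHV"
    by (rule w) (use I s fin in auto)
qed

text \<open>Links the explicit sum with the recursion. For fixed s and a fixed cut j, the summands
  over I are the terms of the coproduct that separate the two pieces
  (\<open>sum_subterm_cops\<close>); the sum over s and j is then
  \<open>kap_eq_cops\<close>.\<close>

lemma pair_kappa_word:
  assumes \<phi>: "admT \<phi>" and ws: "valid ws"
  shows "pair \<phi> (kappa_word V ws) = kap (Phi \<phi>) ws"
proof -
  let ?P = "\<lambda>s. Pow ({..length ws} - {s, Suc s})"
  let ?Z = "\<lambda>s j. take s ws @ [take j (ws ! s), drop j (ws ! s)] @ drop (Suc s) ws"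
  let ?c = "\<lambda>s j. sg (dgs (take s ws)) * sg (dgw (take j (ws ! s)) + 1)"
  have "pair \<phi> (kappa_word V ws) = (\<Sum>s<length ws. \<Sum>I\<in>?P s. \<Sum>j\<in>{0<..<length (ws ! s)}.
      ?c s j * (subterm (Phi \<phi>) (?Z s j) (insert s I) + subterm (Phi \<phi>) (?Z s j) (insert (Suc s) I)))"
    unfolding kappa_word_def pair_sum
  proof (intro sum.cong refl)
    fix s I j assume "s \<in> {..<length ws}" "I \<in> ?P s" and j: "j \<in> {0<..<length (ws ! s)}"
    then have s: "s < length ws" and I: "I \<subseteq> {..length ws} - {s, Suc s}" by auto
    define Z where "Z = ?Z s j"
    have Z: "valid Z" unfolding Z_def by (rule valid_split[OF ws s j])
    have l: "length Z = Suc (length ws)" using s by (simp add: Z_def)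
    have l': "{..<length Z} = {..length ws}" by (auto simp: l)
    have fin: "finite I" using I finite_subset by blast
    define Is where "Is = sorted_list_of_set I"
    define Js where "Js = sorted_list_of_set ({..length ws} - {s, Suc s} - I)"
    have IJ: "set Is = I" "distinct Is" "set Js = {..length ws} - {s, Suc s} - I" "distinct Js"
      using fin by (simp_all add: Is_def Js_def)
    have d: "fst (map (hletter V) Z ! i) = dgw (Z ! i)" if "i < length Z" for i
      using that by (simp add: fst_hletter)
    have c: "(\<Sum>i<s. fst (map (hletter V) Z ! i)) = dgs (take s ws)"
    proof -
      have "(\<Sum>i<s. fst (map (hletter V) Z ! i)) = (\<Sum>i<s. dgw (take s ws ! i))"
        using s by (intro sum.cong refl) (subst d, auto simp: l, simp add: Z_def nth_append)
      then show ?thesis using s by (simp add: dgs_def sum_list_sum_nth atLeast0LessThan min_def)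
    qed
    have Zs: "Z ! s = take j (ws ! s)"
      using s by (simp add: Z_def nth_append min_def)
    \<comment> \<open>Both summands of \<open>kappa_word\<close> have this shape, with
      \<open>K = insert s I\<close> and \<open>K = insert (Suc s) I\<close>.\<close>
    have t: "ksign (\<lambda>i. fst (map (hletter V) Z ! i)) (is @ js)
        * \<phi> [sletter H1 (map ((!) (map (hletter V) Z)) is), sletter H1 (map ((!) (map (hletter V) Z)) js)]
      = subterm (Phi \<phi>) Z K"
      if "is \<noteq> []" "js \<noteq> []" "distinct is" "distinct js" "set is = K" "set js = {..<length Z} - K" "K \<subseteq> {..<length Z}"
      for "is" js K
    proof -
      have "ksign (\<lambda>i. fst (map (hletter V) Z ! i)) (is @ js) = (ksign (\<lambda>i. dgw (Z ! i)) (is @ js) :: 'k)"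
        using that by (intro ksign_cong) (auto simp: fst_hletter)
      moreover have m: "map ((!) (map (hletter V) Z)) ks = map (hletter V) (map ((!) Z) ks)"
        if "set ks \<subseteq> {..<length Z}" for ks
        using that by (auto simp: subset_iff)
      moreover have "valid (map ((!) Z) ks)" if "set ks \<subseteq> {..<length Z}" for ks
        using that Z by (auto simp: list_all_iff subset_iff)
      moreover have ss: "set is \<subseteq> {..<length Z}" "set js \<subseteq> {..<length Z}" using that by auto
      ultimately have "ksign (\<lambda>i. fst (map (hletter V) Z ! i)) (is @ js)
          * \<phi> [sletter H1 (map ((!) (map (hletter V) Z)) is), sletter H1 (map ((!) (map (hletter V) Z)) js)]
        = ksign (\<lambda>i. dgw (Z ! i)) (is @ js) * Phi \<phi> (map ((!) Z) is) (map ((!) Z) js)"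
        using that(1,2) unfolding m[OF ss(1)] m[OF ss(2)] by (simp add: Phi_def del: map_map)
      also have "\<dots> = subterm (Phi \<phi>) Z K"
        by (rule subterm_eqI[OF good_Phi[OF \<phi>]]) (use that in auto)
      finally show ?thesis .
    qed
    have 1: "ksign (\<lambda>i. fst (map (hletter V) Z ! i)) ((Is @ [s]) @ Suc s # Js)
        * \<phi> [sletter H1 (map ((!) (map (hletter V) Z)) (Is @ [s])), sletter H1 (map ((!) (map (hletter V) Z)) (Suc s # Js))]
      = subterm (Phi \<phi>) Z (insert s I)"
      by (rule t) (use IJ I s in \<open>auto simp: l'\<close>)
    have 2: "ksign (\<lambda>i. fst (map (hletter V) Z ! i)) ((Is @ [Suc s]) @ s # Js)
        * \<phi> [sletter H1 (map ((!) (map (hletter V) Z)) (Is @ [Suc s])), sletter H1 (map ((!) (map (hletter V) Z)) (s # Js))]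
      = subterm (Phi \<phi>) Z (insert (Suc s) I)"
      by (rule t) (use IJ I s in \<open>auto simp: l'\<close>)
    have cs: "fst (map (hletter V) Z ! s) = dgw (take j (ws ! s))"
      using d[of s] s by (simp add: l Zs)
    show "pair \<phi> (let Z = map (hletter V) (?Z s j);
            d = (\<lambda>i. fst (Z ! i));
            Is = sorted_list_of_set I;
            Js = sorted_list_of_set ({..length ws} - {s, Suc s} - I);
            M = (\<lambda>is. sletter H1 (map ((!) Z) is));
            c = (-1) powi (\<Sum>i<s. d i) * (-1) powi (d s + 1)
        in Poly_Mapping.single [M (Is @ [s]), M (Suc s # Js)] (c * ksign d (Is @ [s, Suc s] @ Js))
         + Poly_Mapping.single [M (Is @ [Suc s]), M (s # Js)] (c * ksign d (Is @ [Suc s, s] @ Js)))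
      = ?c s j * (subterm (Phi \<phi>) (?Z s j) (insert s I) + subterm (Phi \<phi>) (?Z s j) (insert (Suc s) I))"
      unfolding Let_def Z_def[symmetric] Is_def[symmetric] Js_def[symmetric] 1[symmetric] 2[symmetric]
        pair_add pair_single c cs powi_eq_sg
      by (simp add: distrib_left mult.assoc)
  qed
  also have "\<dots> = (\<Sum>s<length ws. \<Sum>j\<in>{0<..<length (ws ! s)}. \<Sum>I\<in>?P s.
      ?c s j * (subterm (Phi \<phi>) (?Z s j) (insert s I) + subterm (Phi \<phi>) (?Z s j) (insert (Suc s) I)))"
    by (intro sum.cong refl sum.swap)
  also have "\<dots> = (\<Sum>s<length ws. \<Sum>j\<in>{0<..<length (ws ! s)}. ?c s j * cops s (Phi \<phi>) (?Z s j))"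
  proof (intro sum.cong refl)
    fix s j assume "s \<in> {..<length ws}"
    then have l: "length (?Z s j) = Suc (length ws)" by simp
    then have "{..<length (?Z s j)} = {..length ws}" by auto
    then have "(\<Sum>I\<in>?P s. subterm (Phi \<phi>) (?Z s j) (insert s I) + subterm (Phi \<phi>) (?Z s j) (insert (Suc s) I))
        = cops s (Phi \<phi>) (?Z s j)"
      using sum_subterm_cops[of s "?Z s j" "Phi \<phi>"] l \<open>s \<in> {..<length ws}\<close> by (simp only:) simp
    then show "(\<Sum>I\<in>?P s. ?c s j * (subterm (Phi \<phi>) (?Z s j) (insert s I) + subterm (Phi \<phi>) (?Z s j) (insert (Suc s) I)))
        = ?c s j * cops s (Phi \<phi>) (?Z s j)"
      by (simp only: sum_distrib_left[symmetric])
  qed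
  also have "\<dots> = kap (Phi \<phi>) ws"
    unfolding kap_eq_cops
  proof (intro sum.cong refl)
    fix s
    have set: "set [Suc 0..<n] = {0<..<n}" for n :: nat by auto
    have "cut (\<lambda>U V. sg (dgw U + 1) * cops s (Phi \<phi>) (take s ws @ [U, V] @ drop (Suc s) ws)) (ws ! s)
        = (\<Sum>j\<in>{0<..<length (ws ! s)}. sg (dgw (take j (ws ! s)) + 1) * cops s (Phi \<phi>) (?Z s j))"
      by (simp add: cut_def splits_def o_def interv_sum_list_conv_sum_set_nat set del: set_upt)
    then show "(\<Sum>j\<in>{0<..<length (ws ! s)}. ?c s j * cops s (Phi \<phi>) (?Z s j))
        = sg (dgs (take s ws)) * cut (\<lambda>U V. sg (dgw U + 1) * cops s (Phi \<phi>) (take s ws @ [U, V] @ drop (Suc s) ws)) (ws ! s)"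
      by (simp only: sum_distrib_left mult.assoc)
  qed
  finally show ?thesis .
qed

section \<open>Extending \<kappa> from classes of words to all letters\<close>

definition rep :: "('k, 'v) formal set letter \<Rightarrow> ('k, 'v) formal" where
  "rep X = (SOME p. tcls (Hrel V) p = snd X \<and> Poly_Mapping.keys p \<subseteq> {w \<in> words V. wdeg w = fst X + 1})"

lemma rep_spec:
  assumes "okl H1 X"
  shows "tcls (Hrel V) (rep X) = snd X" "Poly_Mapping.keys (rep X) \<subseteq> {w \<in> words V. wdeg w = fst X + 1}"
proof -
  obtain x p where "X = (x, tcls (Hrel V) p)" "Poly_Mapping.keys p \<subseteq> {w \<in> words V. wdeg w = x + 1}"
    by (rule okl_H1E[OF assms])
  then have "\<exists>p. tcls (Hrel V) p = snd X \<and> Poly_Mapping.keys p \<subseteq> {w \<in> words V. wdeg w = fst X + 1}"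
    by auto
  from someI_ex[OF this] show "tcls (Hrel V) (rep X) = snd X"
    "Poly_Mapping.keys (rep X) \<subseteq> {w \<in> words V. wdeg w = fst X + 1}"
    by (simp_all add: rep_def)
qed

text \<open>If \<open>h\<close> is compatible with the relations in each argument, the choice of representatives is immaterial.\<close>

primrec exts :: "('v letter list list \<Rightarrow> 'k) \<Rightarrow> ('k, 'v) formal set letter list \<Rightarrow> 'k" where
  "exts h [] = h []"
| "exts h (X # Xs) = pair (\<lambda>w. exts (\<lambda>ws. h (w # ws)) Xs) (rep X)"

primrec extv :: "('v letter list list \<Rightarrow> ('b \<Rightarrow>\<^sub>0 'k)) \<Rightarrow> ('k, 'v) formal set letter list \<Rightarrow> ('b \<Rightarrow>\<^sub>0 'k)" where
  "extv g [] = g []"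
| "extv g (X # Xs) = lext (\<lambda>w. extv (\<lambda>ws. g (w # ws)) Xs) (rep X)"

lemma pair_extv: "pair \<chi> (extv g Xs) = exts (\<lambda>ws. pair \<chi> (g ws)) Xs"
  by (induction Xs arbitrary: g) (simp_all add: pair_lext)

lemma exts_cong:
  "\<lbrakk>list_all (okl H1) Xs; \<And>ws. valid ws \<Longrightarrow> h ws = h' ws\<rbrakk> \<Longrightarrow> exts h Xs = exts h' Xs"
proof (induction Xs arbitrary: h h')
  case (Cons X Xs)
  have "exts (\<lambda>ws. h (w # ws)) Xs = exts (\<lambda>ws. h' (w # ws)) Xs" if "w \<in> words V" for w
    by (rule Cons.IH) (use Cons.prems that in auto)
  then show ?case
    using rep_spec(2)[of X] Cons.prems(1) by (auto intro!: pair_cong)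
qed simp

lemma keys_extv:
  "\<lbrakk>list_all (okl H1) Xs; \<And>ws. valid ws \<Longrightarrow> Poly_Mapping.keys (g ws) \<subseteq> A\<rbrakk> \<Longrightarrow> Poly_Mapping.keys (extv g Xs) \<subseteq> A"
proof (induction Xs arbitrary: g)
  case (Cons X Xs)
  have "Poly_Mapping.keys (extv (\<lambda>ws. g (w # ws)) Xs) \<subseteq> A" if "w \<in> words V" for w
    by (rule Cons.IH) (use Cons.prems that in auto)
  then show ?case
    using rep_spec(2)[of X] Cons.prems(1) by (auto intro!: keys_lext)
qed simp

lemma admH_pair: "(\<And>z. admH (\<lambda>w. g w z)) \<Longrightarrow> admH (\<lambda>w. pair (g w) p)"
proof -
  assume g: "\<And>z. admH (\<lambda>w. g w z)"
  have "pair (\<lambda>w. pair (g w) p) e = 0" if "e \<in> Hrel V" for e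
    using g that by (subst pair_swap) (simp add: adm_def pair_def[of _ p])
  moreover have "pair (g w) p = 0" if "w \<notin> words V" for w
    using admH_off[OF g that] by (simp add: pair_def)
  ultimately show ?thesis by (simp add: adm_def)
qed

lemma admH_exts: "(\<And>ws. admH (\<lambda>w. h w ws)) \<Longrightarrow> admH (\<lambda>w. exts (h w) Xs)"
  by (induction Xs arbitrary: h) (simp_all add: admH_pair)

lemma exts_mult: "exts (\<lambda>ws. c * h ws) Xs = c * exts h Xs"
  by (induction Xs arbitrary: h) (simp_all add: pair_fun_mult)

lemma admH_exts_head: "slotadm h \<Longrightarrow> admH (\<lambda>w. exts (\<lambda>ws. h (w # ws)) Xs)"
proof -
  assume "slotadm h"
  then have "admH (\<lambda>w. h ([] @ w # ws))" for ws unfolding slotadm_def by blast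
  then have "admH (\<lambda>w. h (w # ws))" for ws by simp
  then show ?thesis by (rule admH_exts[of "\<lambda>w ws. h (w # ws)"])
qed

text \<open>The chosen representative of a sum need not be the sum of the chosen representatives,
  but both have the same class, and an admissible functional cannot tell them apart.\<close>

lemma exts_add_slot:
  assumes x: "x \<in> comp H1 d" "y \<in> comp H1 d"
  shows "slotadm h \<Longrightarrow> exts h (u @ (d, gadd H1 x y) # v) = exts h (u @ (d, x) # v) + exts h (u @ (d, y) # v)"
proof (induction u arbitrary: h)
  case Nil
  have o: "okl H1 (d, x)" "okl H1 (d, y)" "okl H1 (d, gadd H1 x y)"
    using x gclosed_H1 unfolding okl_def gclosed_def fst_conv snd_conv by blast+
  have "tcls (Hrel V) (rep (d, gadd H1 x y)) = gadd H1 (tcls (Hrel V) (rep (d, x))) (tcls (Hrel V) (rep (d, y)))"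
    by (simp only: rep_spec(1)[OF o(1)] rep_spec(1)[OF o(2)] rep_spec(1)[OF o(3)] snd_conv)
  then have eq: "tcls (Hrel V) (rep (d, gadd H1 x y)) = tcls (Hrel V) (rep (d, x) + rep (d, y))"
    by (simp only: gadd_H1)
  have "pair f (rep (d, gadd H1 x y)) = pair f (rep (d, x)) + pair f (rep (d, y))" if "admH f" for f
    unfolding adm_pair_eq[OF that eq] pair_add ..
  from this[OF admH_exts_head[OF Nil]] show ?case by simp
next
  case (Cons Y u)
  show ?case
    unfolding append_Cons exts.simps Cons.IH[OF slotadm_Cons[OF Cons.prems]] pair_fun_add ..
qed

lemma exts_scale_slot:
  assumes x: "x \<in> comp H1 d"
  shows "slotadm h \<Longrightarrow> exts h (u @ (d, gscale H1 c x) # v) = c * exts h (u @ (d, x) # v)"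
proof (induction u arbitrary: h)
  case Nil
  have o: "okl H1 (d, x)" "okl H1 (d, gscale H1 c x)"
    using x gclosed_H1 unfolding okl_def gclosed_def fst_conv snd_conv by blast+
  have "tcls (Hrel V) (rep (d, gscale H1 c x)) = gscale H1 c (tcls (Hrel V) (rep (d, x)))"
    by (simp only: rep_spec(1)[OF o(1)] rep_spec(1)[OF o(2)] snd_conv)
  then have eq: "tcls (Hrel V) (rep (d, gscale H1 c x)) = tcls (Hrel V) (fscale c (rep (d, x)))"
    by (simp only: gscale_H1)
  have "pair f (rep (d, gscale H1 c x)) = c * pair f (rep (d, x))" if "admH f" for f
    unfolding adm_pair_eq[OF that eq] pair_fscale ..
  from this[OF admH_exts_head[OF Nil]] show ?case by simp
next
  case (Cons Y u)
  show ?case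
    unfolding append_Cons exts.simps Cons.IH[OF slotadm_Cons[OF Cons.prems]] pair_fun_mult ..
qed

lemma exts_swap:
  assumes XY: "okl H1 X" "okl H1 Y"
  shows "swapsym h \<Longrightarrow> exts h (u @ X # Y # v) = sg (fst X * fst Y) * exts h (u @ Y # X # v)"
proof (induction u arbitrary: h)
  case Nil
  have "exts h (X # Y # v) = pair (\<lambda>w. pair (\<lambda>z. sg (fst X * fst Y) * exts (\<lambda>ws. h (z # w # ws)) v) (rep Y)) (rep X)"
    unfolding exts.simps
  proof (intro pair_cong)
    fix w z assume "w \<in> Poly_Mapping.keys (rep X)" "z \<in> Poly_Mapping.keys (rep Y)"
    then have "dgw w = fst X" "dgw z = fst Y"
      using rep_spec(2)[OF XY(1)] rep_spec(2)[OF XY(2)] by (auto simp: dgw_def)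
    then have "(\<lambda>ws. h (w # z # ws)) = (\<lambda>ws. sg (fst X * fst Y) * h (z # w # ws))"
      using swapsymD[OF Nil, of "[]" w z] by auto
    then show "exts (\<lambda>ws. h (w # z # ws)) v = sg (fst X * fst Y) * exts (\<lambda>ws. h (z # w # ws)) v"
      by (simp only: exts_mult)
  qed
  also have "\<dots> = sg (fst X * fst Y) * pair (\<lambda>w. pair (\<lambda>z. exts (\<lambda>ws. h (z # w # ws)) v) (rep Y)) (rep X)"
    by (simp only: pair_fun_mult)
  also have "pair (\<lambda>w. pair (\<lambda>z. exts (\<lambda>ws. h (z # w # ws)) v) (rep Y)) (rep X) = exts h (Y # X # v)"
    unfolding exts.simps by (rule pair_swap)
  finally show ?case by simp
next
  case (Cons Z u)
  have "exts (\<lambda>ws. h (w # ws)) (u @ X # Y # v) = sg (fst X * fst Y) * exts (\<lambda>ws. h (w # ws)) (u @ Y # X # v)" for w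
    by (rule Cons.IH[OF swapsym_Cons[OF Cons.prems]])
  then show ?case by (simp only: append_Cons exts.simps pair_fun_mult)
qed

lemma admS_exts:
  assumes h: "slotadm h" "swapsym h"
  shows "admS (\<lambda>Xs. if Xs \<in> words H1 then exts h Xs else 0)"
  unfolding adm_Srel_iff[OF gclosed_H1]
proof (intro conjI allI impI)
  show "(if w \<in> words H1 then exts h w else 0) = 0" if "w \<notin> words H1" for w
    using that by simp
  show "mlin H1 (\<lambda>Xs. if Xs \<in> words H1 then exts h Xs else 0)"
    unfolding mlin_def
  proof (intro allI impI conjI ballI)
    fix u v d x c assume x: "x \<in> comp H1 d"
    have sx: "gscale H1 c x \<in> comp H1 d" using gclosed_H1 x unfolding gclosed_def by blast
    show "(if u @ (d, gscale H1 c x) # v \<in> words H1 then exts h (u @ (d, gscale H1 c x) # v) else 0)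
        = c * (if u @ (d, x) # v \<in> words H1 then exts h (u @ (d, x) # v) else 0)"
      using x sx exts_scale_slot[OF x h(1), of u c v]
      by (simp add: words_iff okl_def[of _ "(_, _)"] del: gshift_simps)
    fix y assume y: "y \<in> comp H1 d"
    have sxy: "gadd H1 x y \<in> comp H1 d" using gclosed_H1 x y unfolding gclosed_def by blast
    show "(if u @ (d, gadd H1 x y) # v \<in> words H1 then exts h (u @ (d, gadd H1 x y) # v) else 0)
        = (if u @ (d, x) # v \<in> words H1 then exts h (u @ (d, x) # v) else 0)
        + (if u @ (d, y) # v \<in> words H1 then exts h (u @ (d, y) # v) else 0)"
      using x y sxy exts_add_slot[OF x y h(1), of u v]
      by (simp add: words_iff okl_def[of _ "(_, _)"] del: gshift_simps)
  qed
  fix u v a b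
  show "(if u @ a # b # v \<in> words H1 then exts h (u @ a # b # v) else 0)
      = sg (fst a * fst b) * (if u @ b # a # v \<in> words H1 then exts h (u @ b # a # v) else 0)"
  proof (cases "u @ a # b # v \<in> words H1")
    case True
    then have ab: "okl H1 a" "okl H1 b" "u @ b # a # v \<in> words H1" by (auto simp: words_iff)
    show ?thesis using True ab(3) exts_swap[OF ab(1,2) h(2), of u v] by simp
  next
    case False
    then have "u @ b # a # v \<notin> words H1" by (auto simp: words_iff)
    then show ?thesis using False by simp
  qed
qed

lemma exts_hletter: "\<lbrakk>slotadm h; valid ws\<rbrakk> \<Longrightarrow> exts h (map (hletter V) ws) = h ws"
proof (induction ws arbitrary: h)
  case (Cons w ws)
  then have w: "w \<in> words V" by simp
  have "tcls (Hrel V) (rep (hletter V w)) = tcls (Hrel V) (Poly_Mapping.single w 1)"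
    using rep_spec(1)[OF hletter_okl[OF w]] by (simp add: hletter_def hcls_def)
  then have "exts h (map (hletter V) (w # ws)) = exts (\<lambda>ws. h (w # ws)) (map (hletter V) ws)"
    using adm_pair_eq[OF admH_exts_head[OF Cons.prems(1)], of "rep (hletter V w)" "Poly_Mapping.single w 1"]
    by simp
  also have "\<dots> = h (w # ws)"
    by (rule Cons.IH) (use Cons.prems slotadm_Cons in auto)
  finally show ?case .
qed simp

lemma kap_Phi: "admT \<phi> \<Longrightarrow> slotadm (kap (Phi \<phi>)) \<and> swapsym (kap (Phi \<phi>))"
  unfolding slotadm_def using kap_slotadm[OF good_Phi] kap_swap[OF good_Phi] by (blast intro: swapsymI)

lemma pair_extv_kappa:
  "\<lbrakk>admT \<phi>; list_all (okl H1) Xs\<rbrakk> \<Longrightarrow> pair \<phi> (extv (kappa_word V) Xs) = exts (kap (Phi \<phi>)) Xs"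
  unfolding pair_extv by (rule exts_cong) (simp_all add: pair_kappa_word)

lemma rel_on_T: "rel_on (words2 SHV) (T2rel SHV)"
  by (rule rel_on_T2rel[OF gclosed_SHV])

text \<open>The values of \<kappa> are prescribed on classes of single words only. The map is
  therefore built from \<open>extv\<close>, which expands every letter in its representative, and
  \<open>exts_hletter\<close> recovers the prescribed values.\<close>

lemma kappa_exists:
  "\<exists>f. glinear SHV (tensor2 SHV) f \<and> (\<forall>ws. ws \<noteq> [] \<and> set ws \<subseteq> words V \<longrightarrow>
     f (scls H1 (map (hletter V) ws)) = tcls (T2rel SHV) (kappa_word V ws))"
proof -
  have k: "Poly_Mapping.keys (extv (kappa_word V) Xs :: ('k, ('k, ('k, 'v) formal set) formal set) formal) \<subseteq> words2 SHV"
    if "Xs \<in> words H1" for Xs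
    by (rule keys_extv) (use that keys_kappa_word in \<open>auto simp: words_iff\<close>)
  have "\<exists>f. glinear (gquot (words H1) (Srel H1)) (gquot (words2 SHV) (T2rel SHV)) f \<and>
    (\<forall>Xs\<in>words H1. f (tcls (Srel H1) (Poly_Mapping.single Xs 1)) = tcls (T2rel SHV) (extv (kappa_word V) Xs))"
  proof (rule glinear_exists[OF rel_on_S rel_on_T k])
    fix \<chi> assume \<chi>: "admT \<chi>"
    have "(\<lambda>Xs. if Xs \<in> words H1 then pair \<chi> (extv (kappa_word V) Xs) else 0)
        = (\<lambda>Xs. if Xs \<in> words H1 then exts (kap (Phi \<chi>)) Xs else 0)"
      using pair_extv_kappa[OF \<chi>] by (auto simp: words_iff)
    then show "admS (\<lambda>Xs. if Xs \<in> words H1 then pair \<chi> (extv (kappa_word V) Xs) else 0)"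
      using admS_exts kap_Phi[OF \<chi>] by simp
  qed
  then obtain f where f: "glinear SHV (tensor2 SHV) f"
    "\<And>Xs. Xs \<in> words H1 \<Longrightarrow> f (tcls (Srel H1) (Poly_Mapping.single Xs 1)) = tcls (T2rel SHV) (extv (kappa_word V) Xs)"
    unfolding Splus_def tensor2_def by blast
  have "f (scls H1 (map (hletter V) ws)) = tcls (T2rel SHV) (kappa_word V ws)"
    if ws: "ws \<noteq> []" "set ws \<subseteq> words V" for ws
  proof -
    have v: "valid ws" using ws by (auto simp: list_all_iff)
    have m: "map (hletter V) ws \<in> words H1" by (rule map_hletter_words[OF ws(1) v])
    have "tcls (T2rel SHV) (extv (kappa_word V) (map (hletter V) ws)) = tcls (T2rel SHV) (kappa_word V ws)"
    proof (rule tcls_eqI[OF rel_on_T k[OF m] keys_kappa_word[OF v]])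
      fix \<chi> assume \<chi>: "admT \<chi>"
      show "pair \<chi> (extv (kappa_word V) (map (hletter V) ws)) = pair \<chi> (kappa_word V ws)"
        using pair_extv_kappa[OF \<chi>] m exts_hletter[OF conjunct1[OF kap_Phi[OF \<chi>]] v] pair_kappa_word[OF \<chi> v]
        by (simp add: words_iff)
    qed
    then show ?thesis using f(2)[OF m] by (simp add: scls_def)
  qed
  then show ?thesis using f(1) by blast
qed

lemmas kappa_spec = someI_ex[OF kappa_exists, folded kappa_def]

end

section \<open>Transposes of linear maps and tensor products of maps\<close>

lemma glinear_adm:
  assumes f: "glinear (gquot A E) (gquot A' E') f" and E: "rel_on A E" and \<chi>: "adm A' E' \<chi>"
  defines "N \<equiv> \<lambda>w. if w \<in> A then ev \<chi> (f (tcls E (Poly_Mapping.single w 1))) else 0"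
  shows "Poly_Mapping.keys p \<subseteq> A \<Longrightarrow> ev \<chi> (f (tcls E p)) = pair N p" and "adm A E N"
proof -
  \<comment> \<open>Some representative of the image of each word. No formula for it is required, so
    that \<kappa> can be transposed on words with arbitrary letters.\<close>
  define G where "G w = (SOME q. f (tcls E (Poly_Mapping.single w 1)) = tcls E' q)" for w
  have G: "f (tcls E (Poly_Mapping.single w 1)) = tcls E' (G w)" if "w \<in> A" for w
  proof -
    have "f (tcls E (Poly_Mapping.single w 1)) \<in> gcarrier (gquot A' E')"
      using f tcls_in_gcarrier[OF keys_single_subset[OF that]] unfolding glinear_def by blast
    then have "\<exists>q. f (tcls E (Poly_Mapping.single w 1)) = tcls E' q"
      by (auto simp: gcarrier_gquot)
    then show ?thesis unfolding G_def by (rule someI_ex)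
  qed
  have ev: "ev \<chi> (f (tcls E p)) = pair N p" if p: "Poly_Mapping.keys p \<subseteq> A" for p
  proof -
    have "f (tcls E p) = tcls E' (lext G p)"
      by (rule glinear_tcls[OF f _ p]) (rule G)
    then have "ev \<chi> (f (tcls E p)) = pair \<chi> (lext G p)"
      by (simp only: ev_tcls[OF \<chi>])
    also have "\<dots> = pair N p"
      unfolding pair_lext by (rule pair_cong) (use p in \<open>auto simp: N_def G ev_tcls[OF \<chi>]\<close>)
    finally show ?thesis .
  qed
  then show "Poly_Mapping.keys p \<subseteq> A \<Longrightarrow> ev \<chi> (f (tcls E p)) = pair N p" .
  show "adm A E N"
    unfolding adm_def
  proof (intro conjI ballI allI impI)
    fix e assume e: "e \<in> E"
    have "tcls E e = tcls E 0" using e by (simp add: tcls_eq_iff free.span_base)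
    then have "pair N e = ev \<chi> (tcls E' 0)"
      using ev[of e] E e by (auto simp: rel_on_def glinear_zero[OF f])
    then show "pair N e = 0" by (simp add: ev_tcls[OF \<chi>])
  qed (simp add: N_def)
qed

definition gendo :: "('k, 'v) gspace \<Rightarrow> int \<Rightarrow> ('v \<Rightarrow> 'v) \<Rightarrow> bool" where
  "gendo W m f \<longleftrightarrow> (\<forall>d. \<forall>x\<in>comp W d. f x \<in> comp W (d + m)
     \<and> (\<forall>y\<in>comp W d. f (gadd W x y) = gadd W (f x) (f y)) \<and> (\<forall>c. f (gscale W c x) = gscale W c (f x)))"

definition tmap_word :: "int \<Rightarrow> ('v \<Rightarrow> 'v) \<Rightarrow> int \<Rightarrow> ('v \<Rightarrow> 'v) \<Rightarrow> 'v letter list \<Rightarrow> ('k::field, 'v) formal" where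
  "tmap_word m f n g w = Poly_Mapping.single [(fst (w ! 0) + m, f (snd (w ! 0))), (fst (w ! 1) + n, g (snd (w ! 1)))]
     (sg (n * fst (w ! 0)))"

lemma words2_iff: "w \<in> words2 W \<longleftrightarrow> (\<exists>a b. w = [a, b] \<and> okl W a \<and> okl W b)"
  by (auto simp: words2_def words_iff length_Suc_conv numeral_2_eq_2)

lemma adm_tmap_word:
  assumes W: "gclosed W" and f: "gendo W m f" and g: "gendo W n g" and \<chi>: "adm (words2 W) (T2rel W) \<chi>"
  shows "adm (words2 W) (T2rel W) (\<lambda>w. if w \<in> words2 W then pair \<chi> (tmap_word m f n g w) else 0)" (is "adm _ _ ?N")
  unfolding adm_T2rel_iff[OF W]
proof (intro conjI allI impI)
  have ml: "mlin W \<chi>" using \<chi> by (simp add: adm_T2rel_iff[OF W])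
  have 1: "\<chi> [(e, gadd W x y), b] = \<chi> [(e, x), b] + \<chi> [(e, y), b]" "\<chi> [a, (e, gadd W x y)] = \<chi> [a, (e, x)] + \<chi> [a, (e, y)]"
    if "x \<in> comp W e" "y \<in> comp W e" for x y e a b
    using mlin_add[OF ml that, of "[]" "[b]"] mlin_add[OF ml that, of "[a]" "[]"] by simp_all
  have 2: "\<chi> [(e, gscale W c x), b] = c * \<chi> [(e, x), b]" "\<chi> [a, (e, gscale W c x)] = c * \<chi> [a, (e, x)]"
    if "x \<in> comp W e" for x c e a b
    using mlin_scale[OF ml that, of "[]" c "[b]"] mlin_scale[OF ml that, of "[a]" c "[]"] by simp_all
  have ff: "f x \<in> comp W (e + m)" "g x \<in> comp W (e + n)" "f (gscale W c x) = gscale W c (f x)"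
      "g (gscale W c x) = gscale W c (g x)" "gscale W c x \<in> comp W e" if "x \<in> comp W e" for x e c
    using f g W that unfolding gendo_def gclosed_def by blast+
  have ff2: "f (gadd W x y) = gadd W (f x) (f y)" "g (gadd W x y) = gadd W (g x) (g y)" "gadd W x y \<in> comp W e"
    if "x \<in> comp W e" "y \<in> comp W e" for x y e
    using f g W that unfolding gendo_def gclosed_def by blast+
  show "?N w = 0" if "w \<notin> words2 W" for w using that by simp
  show "mlin W ?N"
    unfolding mlin_def
  proof (intro allI impI conjI ballI)
    fix u v d x c assume x: "x \<in> comp W d"
    \<comment> \<open>In a word of length 2 the slot is the first or the second letter; any other
      context, also one with an invalid neighbour, lies outside \<open>words2 W\<close> whatever the
      slot contains.\<close>
    consider (l) b where "u = []" "v = [b]" "okl W b" | (r) a where "u = [a]" "v = []" "okl W a"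
      | (n) "\<And>z. u @ (d, z) # v \<notin> words2 W"
      by (cases u; cases v) (auto simp: words2_iff)
    note cs = this
    from cs show "?N (u @ (d, gscale W c x) # v) = c * ?N (u @ (d, x) # v)"
      by cases (auto simp: words2_iff okl_def tmap_word_def x ff ff[OF x] 2)
    fix y assume y: "y \<in> comp W d"
    from cs show "?N (u @ (d, gadd W x y) # v) = ?N (u @ (d, x) # v) + ?N (u @ (d, y) # v)"
      by cases (auto simp: words2_iff okl_def tmap_word_def x y ff ff2[OF x y] 1 distrib_left)
  qed
qed

lemma keys_tmap_word:
  assumes "gendo W m f" "gendo W n g" "w \<in> words2 W"
  shows "Poly_Mapping.keys (tmap_word m f n g w :: ('k::field, 'v) formal) \<subseteq> words2 (W :: ('k, 'v) gspace)"
  unfolding tmap_word_def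
  by (rule keys_single_subset) (use assms in \<open>auto simp: words2_iff okl_def gendo_def\<close>)

lemma tensor_map_tcls:
  fixes W :: "('k::field, 'v) gspace"
  assumes W: "gclosed W" and fg: "gendo W m f" "gendo W n g" and p: "Poly_Mapping.keys p \<subseteq> words2 W"
  shows "tensor_map W m f n g (tcls (T2rel W) p) = tcls (T2rel W) (lext (tmap_word m f n g) p)"
proof -
  have "\<exists>h. glinear (tensor2 W) (tensor2 W) h \<and>
    (\<forall>w\<in>words2 W. h (tcls (T2rel W) (Poly_Mapping.single w 1)) = tcls (T2rel W) (tmap_word m f n g w))"
    unfolding tensor2_def
    by (rule glinear_exists[OF rel_on_T2rel[OF W] rel_on_T2rel[OF W] keys_tmap_word[OF fg] adm_tmap_word[OF W fg]])
  then obtain h where h: "glinear (tensor2 W) (tensor2 W) h"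
    "\<And>w. w \<in> words2 W \<Longrightarrow> h (tcls (T2rel W) (Poly_Mapping.single w 1)) = tcls (T2rel W) (tmap_word m f n g w)"
    by blast
  \<comment> \<open>The condition under \<open>SOME\<close> in \<open>tensor_map\<close>: the map
    \<open>h\<close> found on words of length 2, restated for pairs of homogeneous elements.\<close>
  have "\<exists>h. glinear (tensor2 W) (tensor2 W) h \<and>
     (\<forall>x y u v. u \<in> comp W x \<and> v \<in> comp W y \<longrightarrow>
        h (tcls (T2rel W) (Poly_Mapping.single [(x, u), (y, v)] 1)) =
        tcls (T2rel W) (Poly_Mapping.single [(x + m, f u), (y + n, g v)] ((-1) powi (n * x))))"
    using h by (intro exI[of _ h]) (simp add: words2_iff okl_def tmap_word_def powi_eq_sg)
  from someI_ex[OF this]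
  have t: "glinear (tensor2 W) (tensor2 W) (tensor_map W m f n g)"
    "\<And>x y u v. u \<in> comp W x \<and> v \<in> comp W y \<Longrightarrow>
        tensor_map W m f n g (tcls (T2rel W) (Poly_Mapping.single [(x, u), (y, v)] 1)) =
        tcls (T2rel W) (Poly_Mapping.single [(x + m, f u), (y + n, g v)] ((-1) powi (n * x)))"
    unfolding tensor_map_def[symmetric] by blast+
  show ?thesis
  proof (rule glinear_tcls[OF t(1)[unfolded tensor2_def] _ p])
    fix w assume "w \<in> words2 W"
    then obtain x u y v where "w = [(x, u), (y, v)]" "u \<in> comp W x" "v \<in> comp W y"
      by (auto simp: words2_iff okl_def)
    then show "tensor_map W m f n g (tcls (T2rel W) (Poly_Mapping.single w 1)) = tcls (T2rel W) (tmap_word m f n g w)"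
      using t(2)[of u x v y] by (simp add: tmap_word_def powi_eq_sg)
  qed
qed

section \<open>The identity on S^+(H[1])\<close>

context graded_bracket
begin

lemma gendo_id: "gendo W 0 id"
  by (simp add: gendo_def)

lemma gendo_ell: "gendo SHV 1 (ell V brk)"
proof -
  have c: "x \<in> comp SHV d \<Longrightarrow> x \<in> gcarrier SHV" for x d
    by (auto simp: Splus_def comp_gquot gcarrier_gquot)
  show ?thesis
    using ell_spec c ell_comp unfolding gendo_def glinear_def by blast
qed

text \<open>Every homogeneous letter is a combination of classes of words, to which multilinearity
  reduces the claim. Letters are replaced from left to right; \<open>ws\<close> holds those already
  replaced.\<close>

lemma mlin_zero:
  assumes N: "mlin H1 N" and z: "\<And>ws. \<lbrakk>ws \<noteq> []; valid ws\<rbrakk> \<Longrightarrow> N (map (hletter V) ws) = 0"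
  shows "\<lbrakk>valid ws; list_all (okl H1) Xs; ws \<noteq> [] \<or> Xs \<noteq> []\<rbrakk> \<Longrightarrow> N (map (hletter V) ws @ Xs) = 0"
proof (induction Xs arbitrary: ws)
  case Nil
  then show ?case using z by simp
next
  case (Cons X Xs)
  then have "okl H1 X" by simp
  then obtain x p where X: "X = (x, tcls (Hrel V) p)" and p: "Poly_Mapping.keys p \<subseteq> {w \<in> words V. wdeg w = x + 1}"
    by (rule okl_H1E)
  have "N (map (hletter V) ws @ X # Xs) = pair (\<lambda>z. N (map (hletter V) ws @ (x, tcls (Hrel V) (Poly_Mapping.single z 1)) # Xs)) p"
    unfolding X by (rule slot_pair[OF N presented_H1 p])
  also have "\<dots> = pair (\<lambda>z. 0) p"
  proof (rule pair_cong)
    fix w assume "w \<in> Poly_Mapping.keys p"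
    then have w: "w \<in> words V" "wdeg w = x + 1" using p by auto
    have "N (map (hletter V) (ws @ [w]) @ Xs) = 0"
      by (rule Cons.IH) (use Cons.prems w in auto)
    then show "N (map (hletter V) ws @ (x, tcls (Hrel V) (Poly_Mapping.single w 1)) # Xs) = 0"
      using w(2) by (simp add: hletter_def hcls_def)
  qed
  also have "\<dots> = 0" by (simp add: pair_def)
  finally show ?case .
qed

text \<open>The composite of \<chi> with \<open>\<ell> \<otimes> id\<close>, as a functional on
  words of length 2.\<close>

definition dual_ell_id where
  "dual_ell_id \<chi> w = (if w \<in> words2 SHV then pair \<chi> (tmap_word 1 (ell V brk) 0 id w) else (0::'k))"

definition dual_id_ell where
  "dual_id_ell \<chi> w = (if w \<in> words2 SHV then pair \<chi> (tmap_word 0 id 1 (ell V brk) w) else (0::'k))"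

lemma admT_dual_ell_id: "admT \<chi> \<Longrightarrow> admT (dual_ell_id \<chi>)"
  using adm_tmap_word[OF gclosed_SHV gendo_ell gendo_id] unfolding dual_ell_id_def[abs_def] .

lemma admT_dual_id_ell: "admT \<chi> \<Longrightarrow> admT (dual_id_ell \<chi>)"
  using adm_tmap_word[OF gclosed_SHV gendo_id gendo_ell] unfolding dual_id_ell_def[abs_def] .

lemma slet_words2: "\<lbrakk>A \<noteq> []; valid A; C \<noteq> []; valid C\<rbrakk> \<Longrightarrow> [slet A, slet C] \<in> words2 SHV"
  by (simp add: words2_iff okl_SHV map_hletter_words)

lemma wdeg_map_hletter: "wdeg (map (hletter V) A) = dgs A"
  by (simp add: wdeg_def dgs_def o_def fst_hletter)

lemma ell_scls:
  assumes "Xs \<in> words H1" "mlin SHV \<chi>"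
  shows "\<chi> (u @ (wdeg Xs + 1, ell V brk (scls H1 Xs)) # v)
    = pair (\<lambda>Z. if Z \<in> words H1 then \<chi> (u @ sletter H1 Z # v) else 0) (ell_word V brk Xs)"
proof -
  have k: "Poly_Mapping.keys (ell_word V brk Xs :: ('k, ('k, 'v) formal set) formal) \<subseteq> {Z \<in> words H1. wdeg Z = (wdeg Xs + 1) + 0}"
    using keys_ell_word[OF assms(1)] by simp
  have "ell V brk (scls H1 Xs) = tcls (Srel H1) (ell_word V brk Xs)"
    using ell_spec assms(1) by blast
  then have "\<chi> (u @ (wdeg Xs + 1, ell V brk (scls H1 Xs)) # v)
    = pair (\<lambda>Z. \<chi> (u @ (wdeg Xs + 1, tcls (Srel H1) (Poly_Mapping.single Z 1)) # v)) (ell_word V brk Xs)"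
    using slot_pair[OF assms(2) presented_SHV k, of u v] by simp
  also have "\<dots> = pair (\<lambda>Z. if Z \<in> words H1 then \<chi> (u @ sletter H1 Z # v) else 0) (ell_word V brk Xs)"
    by (rule pair_cong) (use k in \<open>auto simp: sletter_eq\<close>)
  finally show ?thesis .
qed

text \<open>On classes of words composing with \<ell> becomes \<open>el\<close>. With
  \<open>Phi_dual_id_ell\<close> this identifies the two summands of
  \<open>LL (Phi \<chi>)\<close>.\<close>

lemma Phi_dual_ell_id:
  assumes \<chi>: "admT \<chi>" and A: "A \<noteq> []" "valid A" and C: "C \<noteq> []" "valid C"
  shows "Phi (dual_ell_id \<chi>) A C = el (\<lambda>A. Phi \<chi> A C) A"
proof -
  let ?A = "map (hletter V) A"
  have sA: "set A \<subseteq> words V" using A by (auto simp: list_all_iff)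
  have "Phi (dual_ell_id \<chi>) A C = \<chi> [(wdeg ?A + 1, ell V brk (scls H1 ?A)), slet C]"
    using A C slet_words2[OF A C] by (simp add: Phi_def dual_ell_id_def tmap_word_def sletter_def)
  also have "\<dots> = pair (sw1 \<chi> (slet C)) (ell_word V brk ?A)"
    using ell_scls[OF map_hletter_words[OF A] admT_mlin[OF \<chi>], of "[]" "[slet C]"]
    by (simp add: sw1_def[abs_def] cong: if_cong)
  also have "\<dots> = L.el (sw1 \<chi> (slet C)) ?A"
    by (rule pair_ell_word[OF admS_sw1[OF \<chi>]])
  also have "\<dots> = el (\<lambda>ws. sw1 \<chi> (slet C) (map (hletter V) ws)) A"
    by (rule el_hletter[OF admS_mlin[OF admS_sw1[OF \<chi>]] sA])
  also have "\<dots> = el (\<lambda>A. Phi \<chi> A C) A"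
    by (rule el_cong_ok) (use A C in \<open>simp_all add: Phi_sw1\<close>)
  finally show ?thesis .
qed

lemma Phi_dual_id_ell:
  assumes \<chi>: "admT \<chi>" and A: "A \<noteq> []" "valid A" and C: "C \<noteq> []" "valid C"
  shows "Phi (dual_id_ell \<chi>) A C = sg (dgs A) * el (Phi \<chi> A) C"
proof -
  let ?C = "map (hletter V) C"
  have sC: "set C \<subseteq> words V" using C by (auto simp: list_all_iff)
  have "Phi (dual_id_ell \<chi>) A C = sg (dgs A) * \<chi> [slet A, (wdeg ?C + 1, ell V brk (scls H1 ?C))]"
    using A C slet_words2[OF A C] by (simp add: Phi_def dual_id_ell_def tmap_word_def sletter_def wdeg_map_hletter)
  also have "\<chi> [slet A, (wdeg ?C + 1, ell V brk (scls H1 ?C))] = pair (sw2 \<chi> (slet A)) (ell_word V brk ?C)"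
    using ell_scls[OF map_hletter_words[OF C] admT_mlin[OF \<chi>], of "[slet A]" "[]"]
    by (simp add: sw2_def[abs_def] cong: if_cong)
  also have "\<dots> = L.el (sw2 \<chi> (slet A)) ?C"
    by (rule pair_ell_word[OF admS_sw2[OF \<chi>]])
  also have "\<dots> = el (\<lambda>ws. sw2 \<chi> (slet A) (map (hletter V) ws)) C"
    by (rule el_hletter[OF admS_mlin[OF admS_sw2[OF \<chi>]] sC])
  also have "\<dots> = el (Phi \<chi> A) C"
    by (rule el_cong_ok) (use A C in \<open>simp_all add: Phi_sw2\<close>)
  finally show ?thesis .
qed

text \<open>The composite is taken with the map itself, evaluated on classes, because \<kappa> has
  an explicit formula only on products of classes of words.\<close>

definition dual_kappa where
  "dual_kappa \<chi> Xs = (if Xs \<in> words H1 then ev \<chi> (kappa V (tcls (Srel H1) (Poly_Mapping.single Xs 1))) else (0::'k))"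

lemma admS_dual_kappa: "admT \<chi> \<Longrightarrow> admS (dual_kappa \<chi>)"
  using glinear_adm(2)[OF conjunct1[OF kappa_spec, unfolded tensor2_def, unfolded Splus_def[of H1]] rel_on_S]
  unfolding dual_kappa_def[abs_def] Splus_def[of H1] by blast

lemma ev_kappa:
  "\<lbrakk>admT \<chi>; Poly_Mapping.keys p \<subseteq> words H1\<rbrakk> \<Longrightarrow> ev \<chi> (kappa V (tcls (Srel H1) p)) = pair (dual_kappa \<chi>) p"
  using glinear_adm(1)[OF conjunct1[OF kappa_spec, unfolded tensor2_def, unfolded Splus_def[of H1]] rel_on_S]
  unfolding dual_kappa_def[abs_def] Splus_def[of H1] by blast

lemma dual_kappa_hletter:
  assumes \<chi>: "admT \<chi>" and ws: "ws \<noteq> []" "valid ws"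
  shows "dual_kappa \<chi> (map (hletter V) ws) = kap (Phi \<chi>) ws"
proof -
  have "set ws \<subseteq> words V" using ws by (auto simp: list_all_iff)
  then have "kappa V (scls H1 (map (hletter V) ws)) = tcls (T2rel SHV) (kappa_word V ws)"
    using kappa_spec ws(1) by blast
  then have "dual_kappa \<chi> (map (hletter V) ws) = pair \<chi> (kappa_word V ws)"
    using map_hletter_words[OF ws] by (simp add: dual_kappa_def scls_def ev_tcls[OF \<chi>])
  then show ?thesis by (simp only: pair_kappa_word[OF \<chi> ws(2)])
qed

text \<open>All three terms are multilinear in the letters, so by \<open>mlin_zero\<close> it
  suffices to consider classes of words, where the sum vanishes by \<open>kap_LL\<close> for
  \<open>Phi \<chi>\<close>.\<close>

lemma kappa_ell_words:
  assumes \<chi>: "admT \<chi>" and Xs: "Xs \<in> words H1"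
  shows "dual_kappa (dual_ell_id \<chi>) Xs + dual_kappa (dual_id_ell \<chi>) Xs + L.el (dual_kappa \<chi>) Xs = 0"
proof -
  \<comment> \<open>The cutoff outside the words of H[1] is the form in which \<open>admS_el\<close>
    provides multilinearity.\<close>
  let ?e = "\<lambda>Xs. if Xs \<in> words H1 then L.el (dual_kappa \<chi>) Xs else 0"
  let ?N = "\<lambda>Xs. dual_kappa (dual_ell_id \<chi>) Xs + dual_kappa (dual_id_ell \<chi>) Xs + ?e Xs"
  have m: "mlin H1 (dual_kappa (dual_ell_id \<chi>))" "mlin H1 (dual_kappa (dual_id_ell \<chi>))" "mlin H1 ?e"
    by (intro admS_mlin admS_dual_kappa admS_el admT_dual_ell_id admT_dual_id_ell \<chi>)+
  have "mlin H1 ?N"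
    unfolding mlin_def
  proof (intro allI impI conjI ballI)
    fix u v d x c assume x: "x \<in> comp H1 d"
    show "?N (u @ (d, gscale H1 c x) # v) = c * ?N (u @ (d, x) # v)"
      unfolding mlin_scale[OF m(1) x] mlin_scale[OF m(2) x] mlin_scale[OF m(3) x] by (simp only: distrib_left)
    fix y assume y: "y \<in> comp H1 d"
    show "?N (u @ (d, gadd H1 x y) # v) = ?N (u @ (d, x) # v) + ?N (u @ (d, y) # v)"
      unfolding mlin_add[OF m(1) x y] mlin_add[OF m(2) x y] mlin_add[OF m(3) x y] by (simp only: add_ac)
  qed
  moreover have "?N (map (hletter V) ws) = 0" if ws: "ws \<noteq> []" "valid ws" for ws
  proof -
    have sws: "set ws \<subseteq> words V" using ws by (auto simp: list_all_iff)
    have "dual_kappa (dual_ell_id \<chi>) (map (hletter V) ws) + dual_kappa (dual_id_ell \<chi>) (map (hletter V) ws) = kap (\<lambda>A C. Phi (dual_ell_id \<chi>) A C + Phi (dual_id_ell \<chi>) A C) ws"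
      unfolding dual_kappa_hletter[OF admT_dual_ell_id[OF \<chi>] ws] dual_kappa_hletter[OF admT_dual_id_ell[OF \<chi>] ws] by (rule kap_add[symmetric])
    also have "\<dots> = kap (LL (Phi \<chi>)) ws"
      by (rule kap_cong_ok[OF _ ws(2)]) (simp add: Phi_dual_ell_id[OF \<chi>] Phi_dual_id_ell[OF \<chi>] LL_def)
    finally have 1: "dual_kappa (dual_ell_id \<chi>) (map (hletter V) ws) + dual_kappa (dual_id_ell \<chi>) (map (hletter V) ws) = kap (LL (Phi \<chi>)) ws" .
    have "L.el (dual_kappa \<chi>) (map (hletter V) ws) = el (\<lambda>ws. dual_kappa \<chi> (map (hletter V) ws)) ws"
      by (rule el_hletter[OF admS_mlin[OF admS_dual_kappa[OF \<chi>]] sws])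
    also have "\<dots> = el (kap (Phi \<chi>)) ws"
      by (rule el_cong_ok[OF ws(2)]) (rule dual_kappa_hletter[OF \<chi>])
    finally have "L.el (dual_kappa \<chi>) (map (hletter V) ws) = el (kap (Phi \<chi>)) ws" .
    then show ?thesis
      using 1 kap_LL[OF good_Phi[OF \<chi>], of ws] map_hletter_words[OF ws] by simp
  qed
  ultimately have "?N (map (hletter V) [] @ Xs) = 0"
    by (rule mlin_zero) (use Xs in \<open>simp_all add: words_iff\<close>)
  then show ?thesis using Xs by simp
qed

theorem kappa_ell:
  assumes s: "s \<in> gcarrier SHV"
  shows "gadd (tensor2 SHV) (tensor_map SHV 0 id 1 (ell V brk) (kappa V s)) (tensor_map SHV 1 (ell V brk) 0 id (kappa V s))
    = gscale (tensor2 SHV) (-1) (kappa V (ell V brk s))"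
proof -
  have kc: "\<exists>q. kappa V t = tcls (T2rel SHV) q \<and> Poly_Mapping.keys q \<subseteq> words2 SHV" if "t \<in> gcarrier SHV" for t
  proof -
    have "kappa V t \<in> gcarrier (tensor2 SHV)"
      using kappa_spec that unfolding glinear_def by blast
    then show ?thesis by (auto simp: tensor2_def gcarrier_gquot)
  qed
  obtain p where p: "s = tcls (Srel H1) p" "Poly_Mapping.keys p \<subseteq> words H1"
    using s by (auto simp: Splus_def gcarrier_gquot)
  have pe: "Poly_Mapping.keys (lext (ell_word V brk) p :: ('k, ('k, 'v) formal set) formal) \<subseteq> words H1"
    using keys_ell_word p(2) by (intro keys_lext) blast
  have es: "ell V brk s = tcls (Srel H1) (lext (ell_word V brk) p)"
    unfolding p(1) by (rule ell_tcls[OF p(2)])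
  have "ell V brk s \<in> gcarrier SHV"
    unfolding es Splus_def by (rule tcls_in_gcarrier[OF pe])
  then obtain r where r: "kappa V (ell V brk s) = tcls (T2rel SHV) r" "Poly_Mapping.keys r \<subseteq> words2 SHV"
    using kc by blast
  obtain q where q: "kappa V s = tcls (T2rel SHV) q" "Poly_Mapping.keys q \<subseteq> words2 SHV"
    using kc[OF s] by blast
  let ?l = "lext (tmap_word 1 (ell V brk) 0 id) q :: ('k, ('k, ('k, 'v) formal set) formal set) formal"
  let ?r = "lext (tmap_word 0 id 1 (ell V brk)) q :: ('k, ('k, ('k, 'v) formal set) formal set) formal"
  have k: "Poly_Mapping.keys ?l \<subseteq> words2 SHV" "Poly_Mapping.keys ?r \<subseteq> words2 SHV"
    using keys_tmap_word[OF gendo_ell gendo_id] keys_tmap_word[OF gendo_id gendo_ell] q(2)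
    by (intro keys_lext; blast)+
  \<comment> \<open>Against \<chi> each term becomes a functional of the representative
    \<open>p\<close> of s, and \<open>kappa_ell_words\<close> applies to every word of
    \<open>p\<close>.\<close>
  have "tcls (T2rel SHV) (?r + ?l) = tcls (T2rel SHV) (fscale (- 1) r)"
  proof (rule tcls_eqI[OF rel_on_T])
    fix \<chi> assume \<chi>: "admT \<chi>"
    have "pair \<chi> ?l = pair (dual_ell_id \<chi>) q" "pair \<chi> ?r = pair (dual_id_ell \<chi>) q"
      unfolding pair_lext by (rule pair_cong; use q(2) in \<open>auto simp: dual_ell_id_def dual_id_ell_def\<close>)+
    moreover have "pair (dual_ell_id \<chi>) q = pair (dual_kappa (dual_ell_id \<chi>)) p" "pair (dual_id_ell \<chi>) q = pair (dual_kappa (dual_id_ell \<chi>)) p"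
      using ev_kappa[OF admT_dual_ell_id[OF \<chi>] p(2)] ev_kappa[OF admT_dual_id_ell[OF \<chi>] p(2)]
      unfolding p(1)[symmetric] q(1) ev_tcls[OF admT_dual_ell_id[OF \<chi>]] ev_tcls[OF admT_dual_id_ell[OF \<chi>]] by blast+
    moreover have "pair \<chi> r = pair (L.el (dual_kappa \<chi>)) p"
      using ev_kappa[OF \<chi> pe]
      unfolding es[symmetric] r(1) ev_tcls[OF \<chi>] pair_lext pair_ell_word[OF admS_dual_kappa[OF \<chi>]] .
    moreover have "pair (\<lambda>Xs. dual_kappa (dual_ell_id \<chi>) Xs + dual_kappa (dual_id_ell \<chi>) Xs + L.el (dual_kappa \<chi>) Xs) p = pair (\<lambda>_. 0) p"
      by (rule pair_cong, rule kappa_ell_words[OF \<chi>]) (use p(2) in blast)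
    then have "pair (dual_kappa (dual_ell_id \<chi>)) p + pair (dual_kappa (dual_id_ell \<chi>)) p + pair (L.el (dual_kappa \<chi>)) p = 0"
      unfolding pair_fun_add by (simp add: pair_def)
    ultimately show "pair \<chi> (?r + ?l) = pair \<chi> (fscale (- 1) r)"
      unfolding pair_add pair_fscale by (simp add: algebra_simps eq_neg_iff_add_eq_0)
  qed (intro subset_trans[OF keys_add] subset_trans[OF keys_fscale] Un_least k r(2))+
  then show ?thesis
    unfolding q(1) r(1) tensor_map_tcls[OF gclosed_SHV gendo_id gendo_ell q(2)]
      tensor_map_tcls[OF gclosed_SHV gendo_ell gendo_id q(2)]
    unfolding tensor2_def gadd_tcls gscale_tcls .
qed

end

theorem proposition6p3:
  fixes scale :: "'k::field_char_0 \<Rightarrow> 'g::ab_group_add \<Rightarrow> 'g"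
    and gr :: "int \<Rightarrow> 'g set"
    and wedge brk :: "'g \<Rightarrow> 'g \<Rightarrow> 'g"
    and G1 :: "('k, 'g) gspace"
  assumes "gerstenhaber_algebra scale gr wedge brk"
    and "G1 = gshift (gspace_of scale gr)"
  shows "\<forall>s\<in>gcarrier (SH G1).
    gadd (tensor2 (SH G1))
      (tensor_map (SH G1) 0 id 1 (ell G1 brk) (kappa G1 s))
      (tensor_map (SH G1) 1 (ell G1 brk) 0 id (kappa G1 s))
    = gscale (tensor2 (SH G1)) (-1) (kappa G1 (ell G1 brk s))"
proof -
  interpret gerstenhaber_algebra scale gr wedge brk by (rule assms(1))
  \<comment> \<open>The shift gives the bracket degree 0 and turns the exponents m - 1 and n - 1 of
    the antisymmetry into the degrees in G[1].\<close>
  have [simp]: "comp G1 d = gr (d + 1)" "gadd G1 = (+)" "gscale G1 = scale" for d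
    by (simp_all add: assms(2) gspace_of_def)
  interpret graded_bracket G1 brk
  proof
    show "gclosed G1"
      using subspace_gr by (simp add: gclosed_def subspace_def)
    show "brk x y \<in> comp G1 (m + n)" if "x \<in> comp G1 m" "y \<in> comp G1 n" for x y m n
      using brk_degree[of x "m + 1" y "n + 1"] that by (simp add: algebra_simps)
    show "brk x y = gscale G1 (- sg (m * n)) (brk y x)" if "x \<in> comp G1 m" "y \<in> comp G1 n" for x y m n
      using brk_antisym[of x "m + 1" y "n + 1"] that by (simp add: powi_eq_sg scale_minus_left)
    fix x y z c
    interpret l: Vector_Spaces.linear scale scale "\<lambda>x. brk x z" by (rule brk_linear_left)
    show "brk (gadd G1 x y) z = gadd G1 (brk x z) (brk y z)" "brk (gscale G1 c x) z = gscale G1 c (brk x z)"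
      by (simp_all add: l.add l.scale)
  qed
  show ?thesis using kappa_ell by blast
qed

end
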